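(* Let $\mathcal{H}$ be a finite collection of complex linear hyperplanes $H=\{h=0\}\subset\mathbb{C}^n$, let $\nabla=d-\sum_{H\in\mathcal{H}}A_H\,dh/h$ be a flat, torsion free, unitary standard connection, and let $g$ be a Kähler metric on $(\mathbb{C}^n)^\circ=\mathbb{C}^n\setminus\bigcup_{H\in\mathcal H}H$ with $\nabla g=0$. Assume that for every $L\in\mathcal{L}_{irr}(\mathcal{H})$ the weight $a_L$ satisfies $a_L\notin\mathbb{Z}$ and $1-a_L>0$. Let $H\in\mathcal{H}$ and $x\in H^\circ$. Then close to $x$ the metric $g$ is holomorphically isometric to $\mathbb{C}^{n-1}\times\mathbb{C}_{\alpha_H}$, where $\alpha_H=1-a_H=1-\operatorname{tr}A_H$.
   Context: Arrangements. For each $H\in\mathcal{H}$ a linear function $h$ with $H=\{h=0\}$ is fixed. $\mathcal{L}(\mathcal{H})$ is the set of all linear subspaces that are intersections of members of $\mathcal{H}$; $\mathcal{H}_L=\{H\in\mathcal{H}:L\subset H\}$; $H^\circ=H\setminus\bigcup_{H'\in\mathcal{H},\,H'\ne H}H'$. For $\mathcal{B}\subset\mathcal{H}$ let $W(\mathcal{B})\subset(\mathbb{C}^n)^*$ be the span of the linear equations of its members; $\mathcal{B}$ is reducible if it is a union of two non-empty subsets $\mathcal{B}_1,\mathcal{B}_2$ with $W(\mathcal{B})=W(\mathcal{B}_1)\oplus W(\mathcal{B}_2)$, irreducible otherwise. $\mathcal{L}_{irr}(\mathcal{H})$ is the set of $L\in\mathcal{L}(\mathcal{H})$, $L\ne\mathbb{C}^n$,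 with $\mathcal{H}_L$ irreducible. Connections. A standard connection is a meromorphic connection $\nabla=d-\sum_{H}A_H\,dh/h$ on $T\mathbb{C}^n$, in the frame of linear coordinate vector fields, with constant matrices $A_H$. It is flat, torsion free, unitary if it is so on $(\mathbb{C}^n)^\circ$ (unitary: it preserves a positive definite Hermitian inner product). The weight at $L\in\mathcal{L}_{irr}(\mathcal{H})$ is $a_L=(\operatorname{codim}L)^{-1}\sum_{H\in\mathcal{H}_L}\operatorname{tr}A_H$. $\mathbb{C}_\alpha$ ($\alpha>0$) denotes $\mathbb{C}$ with the metric of a 2-cone of total angle $2\pi\alpha$ with vertex at $0$, given by the line element $|z|^{\alpha-1}|dz|$; $\mathbb{C}^{n-1}$ carries the Euclidean metric. "Close to $x$ holomorphically isometric" means that there is a biholomorphism from a neighbourhood of $x$ in $\mathbb{C}^n$ to a neighbourhood of the origin in $\mathbb{C}^{n-1}\times\mathbb{C}$, sending $x$ to $0$ and $H$ to $\mathbb{C}^{n-1}\times\{0\}$, which is isometric away from $H$. *)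

theory Defs
  imports "HOL-Analysis.Analysis" "HOL-Library.Complex_Order"
begin

text \<open>
  Differentiability is over the reals, so a tangent vector at a point of \<^typ>\<open>complex^'n\<close> is an
  element of \<^typ>\<open>complex^'n\<close>, with complex structure \<open>v \<mapsto> \<i> *s v\<close>. The sets \<open>U\<close> below are meant
  to be open.
\<close>

fun iter_deriv :: "'a::real_normed_vector list \<Rightarrow> ('a \<Rightarrow> 'b::real_normed_vector) \<Rightarrow> 'a \<Rightarrow> 'b" where
  "iter_deriv [] f = f"
| "iter_deriv (v # vs) f = (\<lambda>z. frechet_derivative (iter_deriv vs f) (at z) v)"

definition smooth_on :: "'a::real_normed_vector set \<Rightarrow> ('a \<Rightarrow> 'b::real_normed_vector) \<Rightarrow> bool" where
  "smooth_on U f \<longleftrightarrow> (\<forall>vs. \<forall>z\<in>U. iter_deriv vs f differentiable (at z))"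

definition holomorphic_map_on :: "(complex^'n) set \<Rightarrow> (complex^'n \<Rightarrow> complex^'m) \<Rightarrow> bool" where
  "holomorphic_map_on U F \<longleftrightarrow>
     (\<forall>z\<in>U. \<exists>F'. (F has_derivative F') (at z) \<and> Vector_Spaces.linear (*s) (*s) F')"

definition biholomorphism ::
    "(complex^'n) set \<Rightarrow> (complex^'n) set \<Rightarrow> (complex^'n \<Rightarrow> complex^'n) \<Rightarrow> bool" where
  "biholomorphism U V F \<longleftrightarrow>
     open U \<and> open V \<and> bij_betw F U V \<and>
     holomorphic_map_on U F \<and> holomorphic_map_on V (inv_into U F)"

text \<open>A connection is given by its action \<open>D X Y = \<nabla>\<^sub>X Y\<close> on vector fields.\<close>

type_synonym 'n vfield = "complex^'n \<Rightarrow> complex^'n"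
type_synonym 'n connection = "'n vfield \<Rightarrow> 'n vfield \<Rightarrow> 'n vfield"

definition lie_bracket :: "'n::finite vfield \<Rightarrow> 'n vfield \<Rightarrow> 'n vfield" where
  "lie_bracket X Y z =
     frechet_derivative Y (at z) (X z) - frechet_derivative X (at z) (Y z)"

definition curvature ::
    "'n::finite connection \<Rightarrow> 'n vfield \<Rightarrow> 'n vfield \<Rightarrow> 'n vfield \<Rightarrow> 'n vfield" where
  "curvature D X Y Z z = D X (D Y Z) z - D Y (D X Z) z - D (lie_bracket X Y) Z z"

definition torsion :: "'n::finite connection \<Rightarrow> 'n vfield \<Rightarrow> 'n vfield \<Rightarrow> 'n vfield" where
  "torsion D X Y z = D X Y z - D Y X z - lie_bracket X Y z"

definition flat_on :: "(complex^'n) set \<Rightarrow> 'n::finite connection \<Rightarrow> bool" where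
  "flat_on U D \<longleftrightarrow>
     (\<forall>X Y Z. smooth_on U X \<longrightarrow> smooth_on U Y \<longrightarrow> smooth_on U Z \<longrightarrow>
        (\<forall>z\<in>U. curvature D X Y Z z = 0))"

definition torsion_free_on :: "(complex^'n) set \<Rightarrow> 'n::finite connection \<Rightarrow> bool" where
  "torsion_free_on U D \<longleftrightarrow>
     (\<forall>X Y. smooth_on U X \<longrightarrow> smooth_on U Y \<longrightarrow> (\<forall>z\<in>U. torsion D X Y z = 0))"

text \<open>
  A metric is given by its Hermitian forms \<open>g z\<close>, complex linear in the first argument; the
  underlying Riemannian metric is \<open>Re (g z u v)\<close>.
\<close>

type_synonym 'n metric = "complex^'n \<Rightarrow> complex^'n \<Rightarrow> complex^'n \<Rightarrow> complex"

definition hermitian_inner_product :: "(complex^'n \<Rightarrow> complex^'n \<Rightarrow> complex) \<Rightarrow> bool" where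
  "hermitian_inner_product b \<longleftrightarrow>
     (\<forall>v. Vector_Spaces.linear (*s) (*) (\<lambda>u. b u v)) \<and>
     (\<forall>u v. b v u = cnj (b u v)) \<and>
     (\<forall>u. u \<noteq> 0 \<longrightarrow> 0 < Re (b u u))"

definition hermitian_metric_on :: "(complex^'n) set \<Rightarrow> 'n::finite metric \<Rightarrow> bool" where
  "hermitian_metric_on U g \<longleftrightarrow>
     (\<forall>z\<in>U. hermitian_inner_product (g z)) \<and> (\<forall>u v. smooth_on U (\<lambda>z. g z u v))"

definition kaehler_form :: "'n::finite metric \<Rightarrow> complex^'n \<Rightarrow> complex^'n \<Rightarrow> complex^'n \<Rightarrow> real" where
  "kaehler_form g z u v = Re (g z (\<i> *s u) v)"

text \<open>
  The last clause is closedness of the Kaehler form: the exterior derivative evaluated on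
  constant vector fields.
\<close>

definition kaehler_metric_on :: "(complex^'n) set \<Rightarrow> 'n::finite metric \<Rightarrow> bool" where
  "kaehler_metric_on U g \<longleftrightarrow>
     hermitian_metric_on U g \<and>
     (\<forall>z\<in>U. \<forall>u v w.
        frechet_derivative (\<lambda>y. kaehler_form g y v w) (at z) u
      + frechet_derivative (\<lambda>y. kaehler_form g y w u) (at z) v
      + frechet_derivative (\<lambda>y. kaehler_form g y u v) (at z) w = 0)"

definition parallel_metric_on ::
    "(complex^'n) set \<Rightarrow> 'n::finite connection \<Rightarrow> 'n metric \<Rightarrow> bool" where
  "parallel_metric_on U D g \<longleftrightarrow>
     (\<forall>X Y Z. smooth_on U X \<longrightarrow> smooth_on U Y \<longrightarrow> smooth_on U Z \<longrightarrow>
        (\<forall>z\<in>U. frechet_derivative (\<lambda>y. g y (Y y) (Z y)) (at z) (X z)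
                 = g z (D X Y z) (Z z) + g z (Y z) (D X Z z)))"

definition unitary_on :: "(complex^'n) set \<Rightarrow> 'n::finite connection \<Rightarrow> bool" where
  "unitary_on U D \<longleftrightarrow> (\<exists>g. hermitian_metric_on U g \<and> parallel_metric_on U D g)"

text \<open>
  The dual of \<^typ>\<open>complex^'n\<close> is identified with \<^typ>\<open>complex^'n\<close> (row vectors): \<open>a\<close> is the linear
  function \<open>z \<mapsto> scalar_product a z\<close>, the bilinear pairing without complex conjugation. An arrangement
  is a set \<open>\<H>\<close> of hyperplanes with a function \<open>h\<close> choosing a linear equation for each of them.
\<close>

definition arrangement ::
    "(complex^'n) set set \<Rightarrow> ((complex^'n) set \<Rightarrow> complex^'n) \<Rightarrow> bool" where
  "arrangement \<H> h \<longleftrightarrow>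
     finite \<H> \<and> (\<forall>H\<in>\<H>. h H \<noteq> 0 \<and> H = {z. scalar_product (h H) z = 0})"

definition intersection_lattice :: "(complex^'n) set set \<Rightarrow> (complex^'n) set set" where
  "intersection_lattice \<H> = {\<Inter>\<B> | \<B>. \<B> \<subseteq> \<H>}"

definition localization :: "(complex^'n) set set \<Rightarrow> (complex^'n) set \<Rightarrow> (complex^'n) set set" where
  "localization \<H> L = {H \<in> \<H>. L \<subseteq> H}"

definition hyperplane_regular_part ::
    "(complex^'n) set set \<Rightarrow> (complex^'n) set \<Rightarrow> (complex^'n) set" where
  "hyperplane_regular_part \<H> H = H - \<Union>(\<H> - {H})"

definition equation_span ::
    "((complex^'n) set \<Rightarrow> complex^'n) \<Rightarrow> (complex^'n) set set \<Rightarrow> (complex^'n) set" where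
  "equation_span h \<B> = vec.span (h ` \<B>)"

definition is_direct_sum :: "(complex^'n) set \<Rightarrow> (complex^'n) set \<Rightarrow> (complex^'n) set \<Rightarrow> bool" where
  "is_direct_sum W W1 W2 \<longleftrightarrow> W = {u + v | u v. u \<in> W1 \<and> v \<in> W2} \<and> W1 \<inter> W2 = {0}"

definition reducible_arr ::
    "((complex^'n) set \<Rightarrow> complex^'n) \<Rightarrow> (complex^'n) set set \<Rightarrow> bool" where
  "reducible_arr h \<B> \<longleftrightarrow>
     (\<exists>\<B>1 \<B>2. \<B>1 \<noteq> {} \<and> \<B>2 \<noteq> {} \<and> \<B> = \<B>1 \<union> \<B>2 \<and>
        is_direct_sum (equation_span h \<B>) (equation_span h \<B>1) (equation_span h \<B>2))"

definition irreducible_intersections ::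
    "(complex^'n) set set \<Rightarrow> ((complex^'n) set \<Rightarrow> complex^'n) \<Rightarrow> (complex^'n) set set" where
  "irreducible_intersections \<H> h =
     {L \<in> intersection_lattice \<H>. L \<noteq> UNIV \<and> \<not> reducible_arr h (localization \<H> L)}"

definition standard_connection ::
    "(complex^'n) set set \<Rightarrow> ((complex^'n) set \<Rightarrow> complex^'n) \<Rightarrow>
     ((complex^'n) set \<Rightarrow> complex^'n^'n) \<Rightarrow> 'n::finite connection" where
  "standard_connection \<H> h A X Y z =
     frechet_derivative Y (at z) (X z)
     - (\<Sum>H\<in>\<H>. (scalar_product (h H) (X z) / scalar_product (h H) z) *s (A H *v Y z))"

text \<open>
  Weights are complex numbers. In the order of \<^theory>\<open>HOL-Library.Complex_Order\<close>, \<open>0 < 1 - w\<close>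
  says that \<open>1 - w\<close> is a positive real number.
\<close>

definition weight ::
    "(complex^'n) set set \<Rightarrow> ((complex^'n) set \<Rightarrow> complex^'n^'n) \<Rightarrow> (complex^'n) set \<Rightarrow> complex" where
  "weight \<H> A L =
     (\<Sum>H\<in>localization \<H> L. trace (A H)) / of_nat (CARD('n) - vec.dim L)"

text \<open>
  The product of Euclidean (n-1)-space with the 2-cone of angle \<open>2 * pi * \<alpha>\<close>, realised on
  \<^typ>\<open>complex^'n\<close>: coordinate \<open>k\<close> is the cone factor, the remaining coordinates are the Euclidean
  factor. The line element of the cone squares to \<open>\<bar>z\<bar> powr (2 * (\<alpha> - 1)) * \<bar>dz\<bar>\<^sup>2\<close>.
\<close>

definition cone_product_metric :: "'n \<Rightarrow> real \<Rightarrow> 'n::finite metric" where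
  "cone_product_metric k \<alpha> y u v =
     (\<Sum>i\<in>UNIV - {k}. u $ i * cnj (v $ i))
     + of_real (cmod (y $ k) powr (2 * (\<alpha> - 1))) * (u $ k * cnj (v $ k))"

text \<open>
  The condition \<open>U \<inter> \<Union>\<H> \<subseteq> H\<close> says that \<open>g\<close>, which lives on the complement of \<open>\<Union>\<H>\<close>, is defined
  on all of \<open>U - H\<close>. The isometry condition is \<open>g = F\<^sup>* (model metric)\<close>.
\<close>

definition locally_isometric_to_cone_product ::
    "(complex^'n) set set \<Rightarrow> 'n::finite metric \<Rightarrow> (complex^'n) set \<Rightarrow> complex^'n \<Rightarrow>
     'n \<Rightarrow> real \<Rightarrow> bool" where
  "locally_isometric_to_cone_product \<H> g H x k \<alpha> \<longleftrightarrow>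
     (\<exists>U V F. biholomorphism U V F \<and> x \<in> U \<and> F x = 0 \<and>
        U \<inter> \<Union>\<H> \<subseteq> H \<and>
        F ` (U \<inter> H) = V \<inter> {y. y $ k = 0} \<and>
        (\<forall>z\<in>U - H. \<forall>u v.
           g z u v = cone_product_metric k \<alpha> (F z)
             (frechet_derivative F (at z) u) (frechet_derivative F (at z) v)))"

end

theory Submission
  imports Defs "HOL-Complex_Analysis.Cauchy_Integral_Formula"
begin

text \<open>
  Write \<open>x + v\<close> for a point near \<open>x\<close> and let \<open>h\<close> be the equation of \<open>H\<close>. Torsion freeness forces the
  residue \<open>A\<^sub>H\<close> to have rank one, \<open>A\<^sub>H Y = h(Y) n\<close>, and \<open>h(n) = tr A\<^sub>H = a\<close>. On one-forms the residue is
  therefore \<open>\<beta> \<mapsto> \<beta>(n) h\<close>, with eigenvalue \<open>0\<close> on the forms that vanish on \<open>n\<close> and eigenvalue \<open>a\<close> on the line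
  of \<open>h\<close>. Since \<open>a\<close> is not an integer there is no resonance, and the dual connection, which near
  \<open>x\<close> has a logarithmic pole along \<open>h = 0\<close> and no other, has a normal form: every \<open>\<beta>\<close> with \<open>\<beta>(n) = 0\<close> is the
  value at \<open>x\<close> of a holomorphic flat one-form, and \<open>h\<close> is the value at \<open>x\<close> of a holomorphic one-form \<open>\<Psi>\<close> such that the
  multivalued form \<open>h\<^sup>-\<^sup>a \<Psi>\<close> is flat.

  These forms are found along the rays through \<open>x\<close>. On a ray the equation is an ordinary differential
  equation with a simple pole at \<open>0\<close>; non-resonance solves it uniquely by a power series, whose
  coefficients are homogeneous polynomials in \<open>v\<close>. Flatness makes the failure of the
  equation in the other directions again a solution of such an equation, with vanishing initial
  value, so it is zero (\<open>defect_eq_0\<close>). Torsion freeness makes the forms closed, and their primitives are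
  obtained by dividing the homogeneous parts by their degrees. This gives flat functions with
  independent differentials, one fewer than the dimension, and one function \<open>\<theta> = h \<psi>\<close> with \<open>d(h\<^sup>-\<^sup>a \<theta>) = h\<^sup>-\<^sup>a \<Psi>\<close>; here \<open>\<psi>\<close> is holomorphic and
  nonzero at \<open>x\<close>, so \<open>y = h ((1 - a) \<psi>)\<^bsup>1/(1 - a)\<^esup>\<close> is a holomorphic coordinate vanishing on \<open>H\<close>, and
  \<open>\<bar>y\<bar>\<^bsup>-a\<^esup> \<bar>dy\<bar> = \<bar>h\<bar>\<^bsup>-a\<^esup> \<bar>\<Psi>\<bar>\<close>.

  A parallel metric has constant coefficients in a flat coframe. Written in the coframe above, the
  coefficients of the single-valued flat forms are constant; a mixed coefficient with \<open>\<Psi>\<close> is multiplied by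
  \<open>exp (2 \<pi> \<i> a)\<close> along a small loop around \<open>H\<close>, hence vanishes (\<open>G_cross\<close>); the coefficient of \<open>\<Psi>\<close> with itself is
  a positive constant times \<open>\<bar>h\<bar>\<^bsup>-2a\<^esup>\<close>. After a linear change of the flat functions and a rescaling of \<open>y\<close> this
  is the product of a Euclidean metric and a cone of angle \<open>2 \<pi> (1 - a)\<close> (\<open>adapted_chart\<close>), and the
  inverse function theorem turns the functions into a chart.
\<close>

section \<open>Pairing and linear maps on complex coordinate space\<close>

abbreviation pairing :: "complex^'n \<Rightarrow> complex^'n \<Rightarrow> complex" (infixl \<open>\<cdot>\<close> 70)
  where "a \<cdot> b \<equiv> scalar_product a b"

abbreviation clinear_map :: "(complex^'n \<Rightarrow> complex^'m) \<Rightarrow> bool"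
  where "clinear_map \<equiv> Vector_Spaces.linear (*s) (*s)"

lemma norm_smult: "norm (c *s (v::complex^'n)) = cmod c * norm v"
  by (simp add: norm_vec_def L2_set_right_distrib norm_mult)

lemma norm_pairing_le: "cmod (a \<cdot> b) \<le> norm a * norm b"
proof -
  have "cmod (a \<cdot> b) \<le> (\<Sum>i\<in>UNIV. \<bar>cmod (a$i)\<bar> * \<bar>cmod (b$i)\<bar>)"
    unfolding scalar_product_def by (rule order_trans[OF norm_sum]) (simp add: norm_mult)
  also have "\<dots> \<le> norm a * norm b"
    unfolding norm_vec_def by (rule L2_set_mult_ineq)
  finally show ?thesis .
qed

lemma pairing_simps:
  "(a + b) \<cdot> v = a \<cdot> v + b \<cdot> v" "a \<cdot> (v + w) = a \<cdot> v + a \<cdot> w"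
  "(a - b) \<cdot> v = a \<cdot> v - b \<cdot> v" "a \<cdot> (v - w) = a \<cdot> v - a \<cdot> w"
  "(- a) \<cdot> v = - (a \<cdot> v)" "a \<cdot> (- v) = - (a \<cdot> v)"
  "(c *s a) \<cdot> v = c * (a \<cdot> v)" "a \<cdot> (c *s v) = c * (a \<cdot> v)"
  "(r *\<^sub>R a) \<cdot> v = r *\<^sub>R (a \<cdot> v)" "a \<cdot> (r *\<^sub>R v) = r *\<^sub>R (a \<cdot> v)"
  "0 \<cdot> v = 0" "a \<cdot> 0 = 0"
  by (simp_all add: scalar_product_def algebra_simps sum.distrib sum_subtractf sum_negf
      sum_distrib_left scaleR_sum_right mult_scaleR_left mult_scaleR_right)

lemma pairing_sum: "(\<Sum>i\<in>I. f i) \<cdot> v = (\<Sum>i\<in>I. f i \<cdot> v)" "v \<cdot> (\<Sum>i\<in>I. f i) = (\<Sum>i\<in>I. v \<cdot> f i)"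
  by (induction I rule: infinite_finite_induct) (simp_all add: pairing_simps)

lemma scaleR_smult: "r *\<^sub>R (v::complex^'n) = complex_of_real r *s v"
  by (simp add: vec_eq_iff scaleR_conv_of_real[where 'a = complex])

lemma bounded_bilinear_pairing: "bounded_bilinear (\<lambda>a b :: complex^'n. a \<cdot> b)"
  by (intro bounded_bilinear.intro exI[of _ 1]) (auto simp: pairing_simps norm_pairing_le)

lemma bounded_bilinear_smult: "bounded_bilinear (\<lambda>c (v :: complex^'n). c *s v)"
  by (intro bounded_bilinear.intro exI[of _ 1])
    (auto simp: norm_smult algebra_simps vec_eq_iff mult_scaleR_left)

lemmas has_derivative_pairing [derivative_intros] =
  bounded_bilinear.FDERIV[OF bounded_bilinear_pairing]
lemmas has_derivative_smult [derivative_intros] =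
  bounded_bilinear.FDERIV[OF bounded_bilinear_smult]
lemmas continuous_on_pairing [continuous_intros] =
  bounded_bilinear.continuous_on[OF bounded_bilinear_pairing]
lemmas continuous_on_smult [continuous_intros] =
  bounded_bilinear.continuous_on[OF bounded_bilinear_smult]
lemmas tendsto_pairing [tendsto_intros] = bounded_bilinear.tendsto[OF bounded_bilinear_pairing]
lemmas tendsto_smult [tendsto_intros] = bounded_bilinear.tendsto[OF bounded_bilinear_smult]

lemma bounded_linear_pairing_right: "bounded_linear (\<lambda>v. a \<cdot> v)"
  using bounded_bilinear.bounded_linear_right[OF bounded_bilinear_pairing] .
lemma bounded_linear_pairing_left: "bounded_linear (\<lambda>a. a \<cdot> v)"
  using bounded_bilinear.bounded_linear_left[OF bounded_bilinear_pairing] .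
lemma bounded_linear_smult_right: "bounded_linear (\<lambda>v::complex^'n. c *s v)"
  using bounded_bilinear.bounded_linear_right[OF bounded_bilinear_smult] .

lemma clinear_map_simps:
  assumes "clinear_map B"
  shows "B (a + b) = B a + B b" "B (a - b) = B a - B b" "B (- a) = - B a" "B (c *s a) = c *s B a"
    "B 0 = 0" "B (r *\<^sub>R a) = r *\<^sub>R B a"
proof -
  interpret Vector_Spaces.linear "(*s)" "(*s)" B by fact
  show "B (a + b) = B a + B b" "B (a - b) = B a - B b" "B (- a) = - B a" "B (c *s a) = c *s B a"
    "B 0 = 0" "B (r *\<^sub>R a) = r *\<^sub>R B a"
    by (simp_all add: add diff neg scale scaleR_smult)
qed

lemma clinear_map_bounded:
  assumes "clinear_map (B :: complex^'n \<Rightarrow> complex^'m)" shows "bounded_linear B"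
  by (rule linear_conv_bounded_linear[THEN iffD1], rule linearI)
    (auto simp: clinear_map_simps[OF assms])

lemma clinear_mapI:
  assumes "\<And>a b. B (a + b) = B a + B b" "\<And>c a. B (c *s a) = c *s B a"
  shows "clinear_map B"
  using assms by unfold_locales auto

section \<open>Power series along a ray\<close>

lemma power_series_tendsto_0:
  fixes x :: "nat \<Rightarrow> 'a::banach"
  assumes bd: "\<And>m. norm (x m) \<le> K * (1/2)^m"
  shows "((\<lambda>s. \<Sum>m. s^m *\<^sub>R x m) \<longlongrightarrow> x 0) (at_right (0::real))"
    and "\<And>s::real. 0 < s \<Longrightarrow> s < 1 \<Longrightarrow> summable (\<lambda>m. s^m *\<^sub>R x m)"
proof -
  have K: "K \<ge> 0" using order_trans[OF norm_ge_zero bd[of 0]] by simp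
  have geo: "summable (\<lambda>m. K * (1/2)^m)" by (intro summable_mult summable_geometric) simp
  have nb: "norm (s^m *\<^sub>R x m) \<le> K * (1/2)^m" if "0 < s" "s < 1" for s :: real and m
  proof -
    have "norm (s^m *\<^sub>R x m) = s^m * norm (x m)" using that by simp
    also have "\<dots> \<le> 1 * norm (x m)" using that by (intro mult_right_mono power_le_one) auto
    finally show ?thesis using bd[of m] by simp
  qed
  show sm: "summable (\<lambda>m. s^m *\<^sub>R x m)" if "0 < s" "s < 1" for s :: real
    by (rule summable_comparison_test'[OF geo, of 0]) (use nb[OF that] in auto)
  have key: "norm ((\<Sum>m. s^m *\<^sub>R x m) - x 0) \<le> s * K" if s: "0 < s" "s < 1" for s :: real
  proof -
    have eq: "(\<Sum>m. s^m *\<^sub>R x m) - x 0 = (\<Sum>m. s^Suc m *\<^sub>R x (Suc m))"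
      using suminf_split_head[OF sm[OF s]] by simp
    have b: "norm (s^Suc m *\<^sub>R x (Suc m)) \<le> s * K * ((1/2)^Suc m)" for m
    proof -
      have "norm (s^Suc m *\<^sub>R x (Suc m)) = s * (s^m * norm (x (Suc m)))" using s by simp
      also have "\<dots> \<le> s * (1 * (K * (1/2)^Suc m))"
        using s bd[of "Suc m"] by (intro mult_left_mono mult_mono power_le_one) auto
      finally show ?thesis by simp
    qed
    have su: "(\<lambda>m. s * K * ((1/2)^Suc m)) sums (s * K * 1)"
      by (rule sums_mult) (rule power_half_series)
    have "norm (\<Sum>m. s^Suc m *\<^sub>R x (Suc m)) \<le> s * K * 1"
      using suminf_le[of "\<lambda>m. norm (s^Suc m *\<^sub>R x (Suc m))", OF b _ sums_summable[OF su]]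
        summable_norm[of "\<lambda>m. s^Suc m *\<^sub>R x (Suc m)"] sums_unique[OF su]
        summable_comparison_test'[OF sums_summable[OF su], of 0 "\<lambda>m. norm (s^Suc m *\<^sub>R x (Suc m))"] b
      by auto
    then show ?thesis using eq by simp
  qed
  show "((\<lambda>s. \<Sum>m. s^m *\<^sub>R x m) \<longlongrightarrow> x 0) (at_right (0::real))"
  proof (rule LIM_zero_cancel, rule Lim_null_comparison)
    show "\<forall>\<^sub>F s in at_right 0. norm ((\<Sum>m. s^m *\<^sub>R x m) - x 0) \<le> s * K"
      using eventually_at_right_real[of 0 1]
      by (auto elim!: eventually_mono intro: key)
    show "((\<lambda>s. s * K) \<longlongrightarrow> 0) (at_right 0)" by (auto intro!: tendsto_eq_intros)
  qed
qed

text \<open>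
  Uniqueness for a singular equation: \<open>y\<close> stands for the coefficients of \<open>s e' + R e\<close>. Non-resonance enters
  through \<open>y m = 0 \<longleftrightarrow> e m = 0\<close>, and the rest of the equation enters only through the factor \<open>s\<close> on the
  right-hand side. If the coefficients below \<open>m\<close> vanish, dividing by \<open>s ^ m\<close> and letting \<open>s\<close> tend to \<open>0\<close>
  kills the coefficient \<open>m\<close>.
\<close>

lemma fuchsian_series_unique:
  fixes e y :: "nat \<Rightarrow> 'a::banach"
  assumes be: "\<And>m. norm (e m) \<le> K * (1/2)^m" and bdy: "\<And>m. norm (y m) \<le> K * (1/2)^m"
    and iff: "\<And>m. y m = 0 \<longleftrightarrow> e m = 0"
    and ode: "\<And>s::real. 0 < s \<Longrightarrow> s < 1 \<Longrightarrow>
        norm (\<Sum>m. s^m *\<^sub>R y m) \<le> L * s * norm (\<Sum>m. s^m *\<^sub>R e m)"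
  shows "e m = 0"
proof (induction m rule: less_induct)
  case (less m)
  have K: "K \<ge> 0" using order_trans[OF norm_ge_zero be[of 0]] by simp
  have sh: "norm (f (k + m)) \<le> K * (1/2)^k" if "\<And>m. norm (f m) \<le> K * (1/2)^m"
    for f :: "nat \<Rightarrow> 'a" and k
  proof -
    have "(1/2)^(k+m) \<le> (1/2::real)^k" by (rule power_decreasing) auto
    then show ?thesis using that[of "k+m"] K by (meson mult_left_mono order_trans)
  qed
  note ls = power_series_tendsto_0(1)[where x = "\<lambda>k. e (k + m)", OF sh[where f = e, OF be]]
  note ly = power_series_tendsto_0(1)[where x = "\<lambda>k. y (k + m)", OF sh[where f = y, OF bdy]]
  have split: "(\<Sum>k. s^k *\<^sub>R f k) = s^m *\<^sub>R (\<Sum>k. s^k *\<^sub>R f (k+m))"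
    if s: "0 < s" "s < 1" and f: "\<And>m. norm (f m) \<le> K * (1/2)^m" and z: "\<And>k. k < m \<Longrightarrow> f k = 0"
    for s :: real and f :: "nat \<Rightarrow> 'a"
  proof -
    note sm = power_series_tendsto_0(2)[OF f s]
    note sm' = power_series_tendsto_0(2)[where x = "\<lambda>k. f (k+m)", OF sh[where f = f, OF f] s]
    have "(\<Sum>k. s^k *\<^sub>R f k) = (\<Sum>k. s^(k+m) *\<^sub>R f (k+m)) + (\<Sum>k<m. s^k *\<^sub>R f k)"
      by (rule suminf_split_initial_segment[OF sm])
    also have "\<dots> = (\<Sum>k. s^m *\<^sub>R (s^k *\<^sub>R f (k+m)))"
      using z by (simp add: power_add mult.commute)
    also have "\<dots> = s^m *\<^sub>R (\<Sum>k. s^k *\<^sub>R f (k+m))" by (rule suminf_scaleR_right[OF sm', symmetric])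
    finally show ?thesis .
  qed
  have red: "norm (\<Sum>k. s^k *\<^sub>R y (k+m)) \<le> L * s * norm (\<Sum>k. s^k *\<^sub>R e (k+m))"
    if s: "0 < s" "s < 1" for s :: real
  proof -
    have "s^m * norm (\<Sum>k. s^k *\<^sub>R y (k+m)) \<le> s^m * (L * s * norm (\<Sum>k. s^k *\<^sub>R e (k+m)))"
      using ode[OF s] split[OF s be] split[OF s bdy] less.IH iff s
      by (simp add: mult.assoc mult.left_commute)
    then show ?thesis using s by simp
  qed
  have "((\<lambda>s. norm (\<Sum>k. s^k *\<^sub>R y (k+m))) \<longlongrightarrow> 0) (at_right (0::real))"
  proof (rule tendsto_sandwich[of "\<lambda>_. 0" _ _ "\<lambda>s. L * s * norm (\<Sum>k. s^k *\<^sub>R e (k+m))"])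
    show "\<forall>\<^sub>F s in at_right 0. norm (\<Sum>k. s^k *\<^sub>R y (k+m)) \<le> L * s * norm (\<Sum>k. s^k *\<^sub>R e (k+m))"
      using eventually_at_right_real[of 0 1] by (auto elim!: eventually_mono intro: red)
    show "((\<lambda>s. L * s * norm (\<Sum>k. s^k *\<^sub>R e (k+m))) \<longlongrightarrow> 0) (at_right (0::real))"
      using ls by (auto intro!: tendsto_eq_intros)
  qed auto
  from tendsto_unique[OF _ tendsto_norm[OF ly] this] have "y m = 0"
    by (simp add: trivial_limit_at_right_real)
  then show ?case using iff by simp
qed

section \<open>The non-resonant recursion along rays\<close>

lemma reciprocal_shift_bounded:
  obtains K where "K > 0" "\<And>m. cmod (1 / (of_nat m - c)) \<le> K"
proof -
  have "filterlim (\<lambda>m. of_nat m - c) at_infinity sequentially"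
    using tendsto_add_filterlim_at_infinity'[OF tendsto_of_nat tendsto_const[of "- c"]] by simp
  then have "(\<lambda>m. 1 / (of_nat m - c)) \<longlonglongrightarrow> 0"
    by (rule tendsto_divide_0[OF tendsto_const])
  then have "Bseq (\<lambda>m. 1 / (of_nat m - c))" by (rule convergent_imp_Bseq[OF convergentI])
  then show ?thesis using that unfolding Bseq_def by blast
qed

text \<open>
  On row vectors \<open>\<beta>\<close> (one-forms) consider the connection \<open>d + (R + c) dh/h + \<Sum>\<^sub>j B\<^sub>j dl\<^sub>j / (1 + l\<^sub>j)\<close>, twisted by the power
  \<open>h\<^sup>-\<^sup>c\<close>, where \<open>R \<beta> = (\<beta> \<cdot> n) h - c \<beta>\<close>. On the ray \<open>s \<mapsto> s v\<close> the form \<open>dh/h\<close> becomes \<open>ds/s\<close>, which makes sense for \<open>v\<close> in the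
  hyperplane too, so the radial equation is \<open>s \<phi>' + R \<phi> + s \<Sum>\<^sub>j l\<^sub>j(v) B\<^sub>j \<phi> / (1 + s l\<^sub>j(v)) = 0\<close>. The eigenvalues of
  \<open>m + R\<close> are \<open>m - c\<close> and \<open>m - c + h \<cdot> n\<close>; \<open>nonres\<close> asks that they do not vanish for \<open>m \<ge> 1\<close>.
\<close>

locale fuchsian_recursion =
  fixes I :: "'i set" and l :: "'i \<Rightarrow> complex^'n" and B :: "'i \<Rightarrow> complex^'n \<Rightarrow> complex^'n"
    and h n :: "complex^'n" and c :: complex
  assumes finI: "finite I" and linB: "\<And>j. j \<in> I \<Longrightarrow> clinear_map (B j)"
    and nonres: "\<And>m::nat. m \<ge> 1 \<Longrightarrow> of_nat m \<noteq> c" "\<And>m::nat. m \<ge> 1 \<Longrightarrow> of_nat m - c + h \<cdot> n \<noteq> 0"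
begin

definition R where "R \<beta> = (\<beta> \<cdot> n) *s h - c *s \<beta>"

text \<open>
  The inverse of \<open>m + R\<close>, which is a multiple of the identity plus a rank one operator.
\<close>

definition J :: "nat \<Rightarrow> complex^'n \<Rightarrow> complex^'n"
  where "J m \<gamma> = (1 / (of_nat m - c)) *s (\<gamma> - (\<gamma> \<cdot> n / (of_nat m - c + h \<cdot> n)) *s h)"

text \<open>
  Instead of convolving with the geometric series of \<open>1 / (1 + s l\<^sub>j(v))\<close>, the recursion carries along, for
  every form \<open>\<eta>\<close> in question, the coefficients of \<open>\<phi> / (1 + s \<eta>(v))\<close>. The pair of equations
  \<open>(m + R) \<phi>\<^sub>m = - \<Sum>\<^sub>j l\<^sub>j(v) B\<^sub>j (\<phi> / (1 + s l\<^sub>j))\<^bsub>m-1\<^esub>\<close> and \<open>(\<phi> / (1 + s \<eta>))\<^sub>m = \<phi>\<^sub>m - \<eta>(v) (\<phi> / (1 + s \<eta>))\<^bsub>m-1\<^esub>\<close> has order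
  one. The argument \<open>\<eta> = 0\<close> gives \<open>\<phi>\<close> itself.
\<close>

definition radial_step :: "nat \<Rightarrow> complex^'n \<Rightarrow> complex^'n \<Rightarrow> (complex^'n \<Rightarrow> complex^'n) \<Rightarrow> complex^'n"
  where "radial_step m \<eta> v Z = - J m (\<Sum>j\<in>I. (l j \<cdot> v) *s B j (Z (l j))) - (\<eta> \<cdot> v) *s Z \<eta>"

primrec S :: "complex^'n \<Rightarrow> nat \<Rightarrow> complex^'n \<Rightarrow> complex^'n \<Rightarrow> complex^'n" where
  "S \<beta> 0 v \<eta> = \<beta>"
| "S \<beta> (Suc m) v \<eta> = radial_step (Suc m) \<eta> v (S \<beta> m v)"

text \<open>
  The derivative of \<open>S \<beta> m\<close> at \<open>v\<close> in the direction \<open>u\<close>, by the product rule: a step is linear both in \<open>v\<close> and in its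
  last argument.
\<close>

primrec DS :: "complex^'n \<Rightarrow> nat \<Rightarrow> complex^'n \<Rightarrow> complex^'n \<Rightarrow> complex^'n \<Rightarrow> complex^'n" where
  "DS \<beta> 0 v u \<eta> = 0"
| "DS \<beta> (Suc m) v u \<eta> = radial_step (Suc m) \<eta> u (S \<beta> m v) + radial_step (Suc m) \<eta> v (DS \<beta> m v u)"

definition \<Lambda> where "\<Lambda> = insert 0 (l ` I)"

lemma clinear_R: "clinear_map R"
  unfolding R_def by (rule clinear_mapI) (auto simp: pairing_simps vec_eq_iff algebra_simps)

lemma clinear_J: "clinear_map (J m)"
  unfolding J_def by (rule clinear_mapI)
    (auto simp: pairing_simps vec_eq_iff algebra_simps add_divide_distrib)

text \<open>
  Pairing \<open>J m \<gamma>\<close> with \<open>n\<close> shows that the rank one part contributes \<open>\<gamma> \<cdot> n / (m - c + h \<cdot> n)\<close>, which is exactly what \<open>J\<close>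
  subtracts.
\<close>

lemma R_J:
  assumes "m \<ge> 1" shows "of_nat m *s J m \<gamma> + R (J m \<gamma>) = \<gamma>"
proof -
  let ?p = "of_nat m - c" and ?q = "of_nat m - c + h \<cdot> n"
  have [simp]: "?p \<noteq> 0" "?q \<noteq> 0" using nonres[OF assms] by auto
  have "J m \<gamma> \<cdot> n = (\<gamma> \<cdot> n) * ((1 - (h \<cdot> n) / ?q) / ?p)"
    by (simp add: J_def pairing_simps algebra_simps diff_divide_distrib)
  also have "(1 - (h \<cdot> n) / ?q) / ?p = 1 / ?q"
  proof -
    have "1 - (h \<cdot> n) / ?q = ?p / ?q"
      using diff_divide_distrib[of ?q "h \<cdot> n" ?q] by simp
    then show ?thesis using nonres(1)[OF assms] by simp
  qed
  finally have jn: "J m \<gamma> \<cdot> n = \<gamma> \<cdot> n / ?q" by simp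
  have "of_nat m *s J m \<gamma> + R (J m \<gamma>) = ?p *s J m \<gamma> + (\<gamma> \<cdot> n / ?q) *s h"
    by (simp add: R_def jn vec_eq_iff algebra_simps)
  also have "?p *s J m \<gamma> = \<gamma> - (\<gamma> \<cdot> n / ?q) *s h"
    using nonres(1)[OF assms] by (simp add: J_def)
  finally show ?thesis by simp
qed

lemma nonresonant_inj:
  assumes "m \<ge> 1" "of_nat m *s \<beta> + R \<beta> = 0" shows "\<beta> = 0"
proof -
  let ?p = "of_nat m - c" and ?q = "of_nat m - c + h \<cdot> n"
  have nz: "?p \<noteq> 0" "?q \<noteq> 0" using nonres[OF assms(1)] by auto
  have 1: "?p *s \<beta> + (\<beta> \<cdot> n) *s h = 0" using assms(2) by (simp add: R_def vec_eq_iff algebra_simps)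
  have "(?p *s \<beta> + (\<beta> \<cdot> n) *s h) \<cdot> n = ?q * (\<beta> \<cdot> n)" by (simp add: pairing_simps algebra_simps)
  then have "?q * (\<beta> \<cdot> n) = 0" unfolding 1 by (simp add: pairing_simps)
  then have "\<beta> \<cdot> n = 0" using nz by simp
  then have "?p *s \<beta> = 0" using 1 by simp
  then show ?thesis using nz by (simp add: vec_eq_iff)
qed

lemma radial_step_linear:
  shows "radial_step m \<eta> (v + w) Z = radial_step m \<eta> v Z + radial_step m \<eta> w Z" "radial_step m \<eta> (k *s v) Z = k *s radial_step m \<eta> v Z"
    "radial_step m \<eta> v (\<lambda>\<mu>. k *s Z \<mu>) = k *s radial_step m \<eta> v Z"
    "radial_step m \<eta> v (\<lambda>\<mu>. Z \<mu> + Y \<mu>) = radial_step m \<eta> v Z + radial_step m \<eta> v Y"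
proof -
  have B: "\<And>j. j \<in> I \<Longrightarrow> B j (k *s Z (l j)) = k *s B j (Z (l j))"
    "\<And>j. j \<in> I \<Longrightarrow> B j (Z (l j) + Y (l j)) = B j (Z (l j)) + B j (Y (l j))"
    using linB clinear_map_simps by blast+
  have sm: "k *s (\<Sum>j\<in>I. f j) = (\<Sum>j\<in>I. k *s f j)" for f :: "'i \<Rightarrow> complex^'n"
    by (simp add: vec_eq_iff sum_distrib_left)
  note J = clinear_map_simps[OF clinear_J]
  show "radial_step m \<eta> (v + w) Z = radial_step m \<eta> v Z + radial_step m \<eta> w Z"
    by (simp add: radial_step_def pairing_simps J sum.distrib vector_sadd_rdistrib)
  have "(\<Sum>j\<in>I. (k * (l j \<cdot> v)) *s B j (Z (l j))) = k *s (\<Sum>j\<in>I. (l j \<cdot> v) *s B j (Z (l j)))"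
    by (simp add: sm)
  then show "radial_step m \<eta> (k *s v) Z = k *s radial_step m \<eta> v Z"
    by (simp add: radial_step_def pairing_simps J vector_ssub_ldistrib vector_smult_rneg)
  have "(\<Sum>j\<in>I. (l j \<cdot> v) *s B j (k *s Z (l j))) = k *s (\<Sum>j\<in>I. (l j \<cdot> v) *s B j (Z (l j)))"
    by (simp add: sm B mult.commute cong: sum.cong)
  then show "radial_step m \<eta> v (\<lambda>\<mu>. k *s Z \<mu>) = k *s radial_step m \<eta> v Z"
    by (simp add: radial_step_def J vector_ssub_ldistrib vector_smult_rneg mult.commute)
  have "(\<Sum>j\<in>I. (l j \<cdot> v) *s B j (Z (l j) + Y (l j)))
      = (\<Sum>j\<in>I. (l j \<cdot> v) *s B j (Z (l j))) + (\<Sum>j\<in>I. (l j \<cdot> v) *s B j (Y (l j)))"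
    by (simp add: B vector_add_ldistrib sum.distrib cong: sum.cong)
  then show "radial_step m \<eta> v (\<lambda>\<mu>. Z \<mu> + Y \<mu>) = radial_step m \<eta> v Z + radial_step m \<eta> v Y"
    by (simp add: radial_step_def J vector_add_ldistrib)
qed

lemma radial_step_scaleR:
  "radial_step m \<eta> (r *\<^sub>R v) Z = r *\<^sub>R radial_step m \<eta> v Z" "radial_step m \<eta> v (\<lambda>\<mu>. r *\<^sub>R Z \<mu>) = r *\<^sub>R radial_step m \<eta> v Z"
  by (simp_all add: scaleR_smult radial_step_linear)

lemma S_homogeneous: "S \<beta> m (r *\<^sub>R v) = (\<lambda>\<eta>. r ^ m *\<^sub>R S \<beta> m v \<eta>)"
proof (induction m)
  case (Suc m)
  show ?case by (simp add: Suc.IH radial_step_scaleR fun_eq_iff)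
qed (simp add: fun_eq_iff)

lemma DS_homogeneous: "r *\<^sub>R DS \<beta> m (r *\<^sub>R v) u \<eta> = r ^ m *\<^sub>R DS \<beta> m v u \<eta>"
proof (induction m arbitrary: \<eta>)
  case (Suc m)
  have "radial_step (Suc m) \<eta> (r *\<^sub>R v) (DS \<beta> m (r *\<^sub>R v) u)
      = radial_step (Suc m) \<eta> v (\<lambda>\<mu>. r *\<^sub>R DS \<beta> m (r *\<^sub>R v) u \<mu>)" by (simp add: radial_step_scaleR)
  also have "\<dots> = r ^ m *\<^sub>R radial_step (Suc m) \<eta> v (DS \<beta> m v u)" by (simp add: Suc.IH radial_step_scaleR)
  finally show ?case by (simp add: S_homogeneous radial_step_scaleR scaleR_add_right)
qed simp

lemma DS_linear:
  "DS \<beta> m v (a + b) = (\<lambda>\<eta>. DS \<beta> m v a \<eta> + DS \<beta> m v b \<eta>)"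
  "DS \<beta> m v (k *s a) = (\<lambda>\<eta>. k *s DS \<beta> m v a \<eta>)"
proof (induction m)
  case (Suc m)
  { case 1 show ?case by (simp add: Suc.IH radial_step_linear fun_eq_iff) }
  { case 2 show ?case by (simp add: Suc.IH radial_step_linear fun_eq_iff vector_add_ldistrib) }
qed (simp_all add: fun_eq_iff)

lemma has_derivative_S: "((\<lambda>v. S \<beta> m v \<eta>) has_derivative (\<lambda>u. DS \<beta> m v u \<eta>)) (at v)"
proof (induction m arbitrary: \<eta>)
  case (Suc m)
  have JB: "(J (Suc m) has_derivative J (Suc m)) (at w)" for w
    by (rule bounded_linear_imp_has_derivative[OF clinear_map_bounded[OF clinear_J]])
  have BB: "((\<lambda>v. B j (S \<beta> m v (l j))) has_derivative (\<lambda>u. B j (DS \<beta> m v u (l j)))) (at v)"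
    if "j \<in> I" for j
    using bounded_linear.has_derivative[OF clinear_map_bounded[OF linB[OF that]] Suc.IH] .
  have lb: "((\<lambda>v. \<eta> \<cdot> v) has_derivative (\<lambda>u. \<eta> \<cdot> u)) (at v)" for \<eta>
    by (rule bounded_linear_imp_has_derivative[OF bounded_linear_pairing_right])
  have inner: "((\<lambda>v. \<Sum>j\<in>I. (l j \<cdot> v) *s B j (S \<beta> m v (l j))) has_derivative
     (\<lambda>u. \<Sum>j\<in>I. (l j \<cdot> v) *s B j (DS \<beta> m v u (l j)) + (l j \<cdot> u) *s B j (S \<beta> m v (l j)))) (at v)"
    by (intro has_derivative_sum has_derivative_smult lb BB)
  have "((\<lambda>v. - J (Suc m) (\<Sum>j\<in>I. (l j \<cdot> v) *s B j (S \<beta> m v (l j))) - (\<eta> \<cdot> v) *s S \<beta> m v \<eta>)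
    has_derivative (\<lambda>u. - J (Suc m) (\<Sum>j\<in>I. (l j \<cdot> v) *s B j (DS \<beta> m v u (l j))
        + (l j \<cdot> u) *s B j (S \<beta> m v (l j)))
      - ((\<eta> \<cdot> v) *s DS \<beta> m v u \<eta> + (\<eta> \<cdot> u) *s S \<beta> m v \<eta>))) (at v)"
    by (intro has_derivative_diff has_derivative_minus has_derivative_smult lb Suc.IH
        bounded_linear.has_derivative[OF clinear_map_bounded[OF clinear_J] inner])
  also have "(\<lambda>u. - J (Suc m) (\<Sum>j\<in>I. (l j \<cdot> v) *s B j (DS \<beta> m v u (l j))
        + (l j \<cdot> u) *s B j (S \<beta> m v (l j)))
      - ((\<eta> \<cdot> v) *s DS \<beta> m v u \<eta> + (\<eta> \<cdot> u) *s S \<beta> m v \<eta>)) = (\<lambda>u. DS \<beta> (Suc m) v u \<eta>)"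
    by (simp add: fun_eq_iff radial_step_def sum.distrib clinear_map_simps[OF clinear_J])
  finally show ?case by (simp add: radial_step_def)
qed simp

lemma recursion:
  "of_nat m *s S \<beta> m v 0 + R (S \<beta> m v 0)
    = (case m of 0 \<Rightarrow> R \<beta> | Suc k \<Rightarrow> - (\<Sum>j\<in>I. (l j \<cdot> v) *s B j (S \<beta> k v (l j))))"
proof (cases m)
  case (Suc k)
  have "S \<beta> m v 0 = J m (- (\<Sum>j\<in>I. (l j \<cdot> v) *s B j (S \<beta> k v (l j))))"
    using Suc by (simp add: radial_step_def pairing_simps clinear_map_simps[OF clinear_J])
  then show ?thesis using R_J[of m] Suc by simp
qed simp

lemma DS_recursion:
  "of_nat (Suc k) *s DS \<beta> (Suc k) v u 0 + R (DS \<beta> (Suc k) v u 0)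
    = - (\<Sum>j\<in>I. (l j \<cdot> u) *s B j (S \<beta> k v (l j)) + (l j \<cdot> v) *s B j (DS \<beta> k v u (l j)))"
proof -
  have "DS \<beta> (Suc k) v u 0 = J (Suc k) (- (\<Sum>j\<in>I. (l j \<cdot> u) *s B j (S \<beta> k v (l j)) + (l j \<cdot> v) *s B j (DS \<beta> k v u (l j))))"
    by (simp add: radial_step_def pairing_simps clinear_map_simps[OF clinear_J] sum.distrib)
  then show ?thesis using R_J[of "Suc k"] by simp
qed

lemma S_split: "S \<beta> (Suc m) v \<eta> = S \<beta> (Suc m) v 0 - (\<eta> \<cdot> v) *s S \<beta> m v \<eta>"
  by (simp add: radial_step_def pairing_simps)

lemma DS_split: "DS \<beta> (Suc m) v u \<eta>
    = DS \<beta> (Suc m) v u 0 - (\<eta> \<cdot> u) *s S \<beta> m v \<eta> - (\<eta> \<cdot> v) *s DS \<beta> m v u \<eta>"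
  by (simp add: radial_step_def pairing_simps)

text \<open>
  Uniformity in \<open>m\<close> holds because the eigenvalues of \<open>J m\<close> tend to \<open>0\<close>.
\<close>

lemma radial_step_bound:
  obtains C where "C \<ge> 1" "\<And>\<eta>. \<eta> \<in> \<Lambda> \<Longrightarrow> norm \<eta> \<le> C"
    "\<And>m v Z \<sigma> \<eta>. \<eta> \<in> \<Lambda> \<Longrightarrow> (\<And>\<mu>. \<mu> \<in> \<Lambda> \<Longrightarrow> norm (Z \<mu>) \<le> \<sigma>) \<Longrightarrow> norm (radial_step m \<eta> v Z) \<le> C * norm v * \<sigma>"
proof -
  obtain K1 where K1: "K1 > 0" "\<And>m. cmod (1 / (of_nat m - c)) \<le> K1"
    using reciprocal_shift_bounded by blast
  obtain K2 where K2: "K2 > 0" "\<And>m. cmod (1 / (of_nat m - (c - h \<cdot> n))) \<le> K2"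
    using reciprocal_shift_bounded by blast
  define K where "K = K1 * (1 + norm n * K2 * norm h)"
  have K0: "K \<ge> 0" using K1 K2 by (simp add: K_def)
  have JK: "norm (J m \<gamma>) \<le> K * norm \<gamma>" for m \<gamma>
  proof -
    have "cmod (\<gamma> \<cdot> n / (of_nat m - c + h \<cdot> n)) \<le> (norm \<gamma> * norm n) * K2"
      using mult_mono[OF norm_pairing_le[of \<gamma> n] K2(2)[of m]]
      by (simp add: norm_divide algebra_simps)
    then have "norm ((\<gamma> \<cdot> n / (of_nat m - c + h \<cdot> n)) *s h) \<le> (norm \<gamma> * norm n) * K2 * norm h"
      by (simp add: norm_smult mult_right_mono)
    then have "norm (\<gamma> - (\<gamma> \<cdot> n / (of_nat m - c + h \<cdot> n)) *s h) \<le> norm \<gamma> + (norm \<gamma> * norm n) * K2 * norm h"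
      by (smt (verit) norm_triangle_ineq4)
    then have "norm (J m \<gamma>) \<le> K1 * (norm \<gamma> + (norm \<gamma> * norm n) * K2 * norm h)"
      unfolding J_def norm_smult using K1 by (intro mult_mono) auto
    also have "\<dots> = K * norm \<gamma>" by (simp add: K_def algebra_simps)
    finally show ?thesis .
  qed
  define M where "M = (\<Sum>j\<in>I. norm (l j) * onorm (B j))"
  have on: "onorm (B j) \<ge> 0" "norm (B j w) \<le> onorm (B j) * norm w" if "j \<in> I" for j w
    using onorm_pos_le[OF clinear_map_bounded[OF linB[OF that]]]
      onorm[OF clinear_map_bounded[OF linB[OF that]]] by auto
  have M0: "M \<ge> 0" unfolding M_def by (intro sum_nonneg mult_nonneg_nonneg on) auto
  define L where "L = (\<Sum>j\<in>I. norm (l j))"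
  have L0: "L \<ge> 0" unfolding L_def by (intro sum_nonneg) auto
  have L: "norm \<eta> \<le> L" if "\<eta> \<in> \<Lambda>" for \<eta>
  proof (cases "\<eta> = 0")
    case False
    then obtain j where "j \<in> I" "\<eta> = l j" using \<open>\<eta> \<in> \<Lambda>\<close> by (auto simp: \<Lambda>_def)
    then show ?thesis unfolding L_def using member_le_sum[of j I "\<lambda>j. norm (l j)"] finI by auto
  qed (use L0 in simp)
  show ?thesis
  proof (rule that[of "K * M + L + 1"])
    show "K * M + L + 1 \<ge> 1" using K0 M0 L0 by simp
    show "norm \<eta> \<le> K * M + L + 1" if "\<eta> \<in> \<Lambda>" for \<eta> using L[OF that] K0 M0 by (smt (verit) mult_nonneg_nonneg)
    fix m v Z \<sigma> \<eta> assume lam: "\<eta> \<in> \<Lambda>" and Z: "\<And>\<mu>. \<mu> \<in> \<Lambda> \<Longrightarrow> norm (Z \<mu> :: complex^'n) \<le> \<sigma>"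
    have s0: "\<sigma> \<ge> 0" using Z[OF lam] by (smt (verit) norm_ge_zero)
    have "norm ((l j \<cdot> v) *s B j (Z (l j))) \<le> norm (l j) * onorm (B j) * (norm v * \<sigma>)" if "j \<in> I" for j
    proof -
      have "norm (B j (Z (l j))) \<le> onorm (B j) * \<sigma>"
        by (rule order_trans[OF on(2)[OF that] mult_left_mono[OF Z on(1)[OF that]]])
          (use that in \<open>simp add: \<Lambda>_def\<close>)
      then have "norm ((l j \<cdot> v) *s B j (Z (l j))) \<le> (norm (l j) * norm v) * (onorm (B j) * \<sigma>)"
        unfolding norm_smult by (intro mult_mono norm_pairing_le) auto
      then show ?thesis by (simp add: mult_ac)
    qed
    then have "norm (\<Sum>j\<in>I. (l j \<cdot> v) *s B j (Z (l j))) \<le> M * (norm v * \<sigma>)"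
      unfolding M_def sum_distrib_right by (intro sum_norm_le) auto
    then have a: "norm (J m (\<Sum>j\<in>I. (l j \<cdot> v) *s B j (Z (l j)))) \<le> K * (M * (norm v * \<sigma>))"
      using JK K0 by (meson mult_left_mono order_trans)
    have "norm ((\<eta> \<cdot> v) *s Z \<eta>) \<le> (norm \<eta> * norm v) * \<sigma>"
      unfolding norm_smult using Z[OF lam] by (intro mult_mono norm_pairing_le) auto
    also have "\<dots> \<le> (L * norm v) * \<sigma>"
      using L[OF lam] s0 by (intro mult_right_mono) auto
    finally have b: "norm ((\<eta> \<cdot> v) *s Z \<eta>) \<le> (L * norm v) * \<sigma>" .
    have "norm (radial_step m \<eta> v Z) \<le> K * (M * (norm v * \<sigma>)) + (L * norm v) * \<sigma>"
      unfolding radial_step_def using a b norm_triangle_ineq4[of "- J m (\<Sum>j\<in>I. (l j \<cdot> v) *s B j (Z (l j)))" "(\<eta> \<cdot> v) *s Z \<eta>"]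
      by simp
    also have "\<dots> \<le> (K * M + L + 1) * norm v * \<sigma>" using s0 by (simp add: algebra_simps)
    finally show "norm (radial_step m \<eta> v Z) \<le> (K * M + L + 1) * norm v * \<sigma>" .
  qed
qed

text \<open>
  A growth constant: one step multiplies the size of the coefficients by at most \<open>C * norm v\<close>.
\<close>

definition C where "C = (SOME C. C \<ge> 1 \<and> (\<forall>\<eta>\<in>\<Lambda>. norm \<eta> \<le> C) \<and>
  (\<forall>m v Z \<sigma>. \<forall>\<eta>\<in>\<Lambda>. (\<forall>\<mu>\<in>\<Lambda>. norm (Z \<mu>) \<le> \<sigma>) \<longrightarrow> norm (radial_step m \<eta> v Z) \<le> C * norm v * \<sigma>))"

lemma C_props:
  shows "C \<ge> 1" "\<eta> \<in> \<Lambda> \<Longrightarrow> norm \<eta> \<le> C"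
    "\<eta> \<in> \<Lambda> \<Longrightarrow> (\<And>\<mu>. \<mu> \<in> \<Lambda> \<Longrightarrow> norm (Z \<mu>) \<le> \<sigma>) \<Longrightarrow> norm (radial_step m \<eta> v Z) \<le> C * norm v * \<sigma>"
proof -
  have "\<exists>C\<ge>1. (\<forall>\<eta>\<in>\<Lambda>. norm \<eta> \<le> C) \<and>
  (\<forall>m v Z \<sigma>. \<forall>\<eta>\<in>\<Lambda>. (\<forall>\<mu>\<in>\<Lambda>. norm (Z \<mu>) \<le> \<sigma>) \<longrightarrow> norm (radial_step m \<eta> v Z) \<le> C * norm v * \<sigma>)"
    by (rule radial_step_bound) (intro exI conjI, assumption, auto)
  note C = someI_ex[OF this, folded C_def]
  show "C \<ge> 1" using C by (rule conjunct1)
  show "\<eta> \<in> \<Lambda> \<Longrightarrow> norm \<eta> \<le> C" using C[THEN conjunct2, THEN conjunct1] by (rule bspec)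
  assume "\<eta> \<in> \<Lambda>" "\<And>\<mu>. \<mu> \<in> \<Lambda> \<Longrightarrow> norm (Z \<mu>) \<le> \<sigma>"
  then show "norm (radial_step m \<eta> v Z) \<le> C * norm v * \<sigma>"
    using C[THEN conjunct2, THEN conjunct2, rule_format, of \<eta> Z \<sigma> m v] by simp
qed

lemma S_bound:
  assumes v: "C * norm v \<le> 1/8" and "\<eta> \<in> \<Lambda>"
  shows "norm (S \<beta> m v \<eta>) \<le> norm \<beta> * (1/8)^m"
  using assms(2)
proof (induction m arbitrary: \<eta>)
  case (Suc m)
  have "norm (S \<beta> (Suc m) v \<eta>) \<le> C * norm v * (norm \<beta> * (1/8)^m)"
    using C_props(3)[OF Suc.prems Suc.IH] by simp
  also have "\<dots> \<le> 1/8 * (norm \<beta> * (1/8)^m)" by (intro mult_right_mono v) auto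
  finally show ?case by simp
qed simp

text \<open>
  The derivative obeys the recursion of \<open>S\<close> with \<open>S\<close> itself as a source. The weaker rate \<open>1/4\<close> absorbs
  this source: with \<open>D = 8 C\<close> one needs \<open>C + D / 8 \<le> D / 4\<close>.
\<close>

lemma DS_bound:
  assumes v: "C * norm v \<le> 1/8" and "\<eta> \<in> \<Lambda>"
  shows "norm (DS \<beta> m v u \<eta>) \<le> 8 * C * norm \<beta> * norm u * (1/4)^m"
  using assms(2)
proof (induction m arbitrary: \<eta>)
  case 0 then show ?case using C_props(1) by simp
next
  case (Suc m)
  have C0: "C \<ge> 0" using C_props(1) by simp
  have "norm (radial_step (Suc m) \<eta> u (S \<beta> m v)) \<le> C * norm u * (norm \<beta> * (1/8)^m)"
    by (rule C_props(3)[OF Suc.prems S_bound[OF v]])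
  also have "\<dots> \<le> C * norm u * (norm \<beta> * (1/4)^m)"
    using C0 by (intro mult_left_mono power_mono) auto
  finally have a: "norm (radial_step (Suc m) \<eta> u (S \<beta> m v)) \<le> C * norm u * (norm \<beta> * (1/4)^m)" .
  have "norm (radial_step (Suc m) \<eta> v (DS \<beta> m v u)) \<le> C * norm v * (8 * C * norm \<beta> * norm u * (1/4)^m)"
    by (rule C_props(3)[OF Suc.prems Suc.IH])
  also have "\<dots> \<le> 1/8 * (8 * C * norm \<beta> * norm u * (1/4)^m)"
    using C0 by (intro mult_right_mono v) auto
  finally have b: "norm (radial_step (Suc m) \<eta> v (DS \<beta> m v u)) \<le> C * norm u * (norm \<beta> * (1/4)^m)"
    by (simp add: mult_ac)
  have "norm (DS \<beta> (Suc m) v u \<eta>) \<le> C * norm u * (norm \<beta> * (1/4)^m) + C * norm u * (norm \<beta> * (1/4)^m)"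
    using norm_triangle_mono[OF a b] by simp
  then show ?case by simp
qed

end

section \<open>Geometrically decaying coefficients\<close>

definition geometric_decay :: "real \<Rightarrow> (nat \<Rightarrow> 'a::real_normed_vector) \<Rightarrow> bool"
  where "geometric_decay q f \<longleftrightarrow> (\<exists>K. \<forall>m. norm (f m) \<le> K * q ^ m)"

lemma geometric_decayI: "(\<And>m. norm (f m) \<le> K * q ^ m) \<Longrightarrow> geometric_decay q f"
  unfolding geometric_decay_def by blast

lemma geometric_decayE:
  assumes "geometric_decay q f" "q \<ge> 0"
  obtains K where "K \<ge> 0" "\<And>m. norm (f m) \<le> K * q ^ m"
proof -
  obtain K where K: "\<And>m. norm (f m) \<le> K * q ^ m" using assms unfolding geometric_decay_def by blast
  have "norm (f 0) \<le> K" using K[of 0] by simp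
  then have "K \<ge> 0" using norm_ge_zero order_trans by blast
  then show ?thesis using K that by blast
qed

lemma geometric_decay_add:
  assumes "geometric_decay q f" "geometric_decay q g" shows "geometric_decay q (\<lambda>m. f m + g m)"
proof -
  obtain K L where "\<And>m. norm (f m) \<le> K * q ^ m" "\<And>m. norm (g m) \<le> L * q ^ m"
    using assms unfolding geometric_decay_def by blast
  then have "norm (f m + g m) \<le> (K + L) * q ^ m" for m
    by (simp add: distrib_right norm_triangle_mono)
  then show ?thesis by (rule geometric_decayI)
qed

lemma geometric_decay_linear:
  assumes "bounded_linear T" "geometric_decay q f" shows "geometric_decay q (\<lambda>m. T (f m))"
proof -
  obtain K where K: "\<And>m. norm (f m) \<le> K * q ^ m"
    using assms unfolding geometric_decay_def by blast
  obtain L where L: "L \<ge> 0" "\<And>x. norm (T x) \<le> norm x * L"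
    using bounded_linear.nonneg_bounded[OF assms(1)] by blast
  have "norm (T (f m)) \<le> (K * L) * q ^ m" for m
  proof -
    have "norm (T (f m)) \<le> (K * q ^ m) * L"
      using L(2)[of "f m"] mult_right_mono[OF K[of m] L(1)] by linarith
    then show ?thesis by (simp add: mult_ac)
  qed
  then show ?thesis by (rule geometric_decayI)
qed

lemma geometric_decay_zero: "q \<ge> 0 \<Longrightarrow> geometric_decay q (\<lambda>m. 0)"
  by (rule geometric_decayI[of _ 0]) simp

lemma geometric_decay_sum:
  "q \<ge> 0 \<Longrightarrow> (\<And>i. i \<in> I \<Longrightarrow> geometric_decay q (f i)) \<Longrightarrow> geometric_decay q (\<lambda>m. \<Sum>i\<in>I. f i m)"
  by (induction I rule: infinite_finite_induct) (auto intro: geometric_decay_add geometric_decay_zero)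

lemma geometric_decay_mono:
  assumes "0 \<le> q" "q \<le> p" "geometric_decay q f" shows "geometric_decay p f"
proof -
  obtain K where K: "K \<ge> 0" "\<And>m. norm (f m) \<le> K * q ^ m" using geometric_decayE[OF assms(3,1)] by blast
  have "norm (f m) \<le> K * p ^ m" for m
    using K(2)[of m] mult_left_mono[OF power_mono[OF assms(2,1), of m] K(1)] by linarith
  then show ?thesis by (rule geometric_decayI)
qed

text \<open>
  The Euler operator \<open>s d/ds\<close> multiplies the coefficient \<open>m\<close> by \<open>m \<le> 2 ^ m\<close>, which costs a factor \<open>2\<close> in the rate.
\<close>

lemma geometric_decay_index:
  assumes "geometric_decay (1/4) f" shows "geometric_decay (1/2) (\<lambda>m. real m *\<^sub>R f m)"
proof -
  obtain K where K: "K \<ge> 0" "\<And>m. norm (f m) \<le> K * (1/4) ^ m" using geometric_decayE[OF assms] by auto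
  have "norm (real m *\<^sub>R f m) \<le> K * (1/2) ^ m" for m
  proof -
    have "norm (real m *\<^sub>R f m) \<le> 2 ^ m * (K * (1/4) ^ m)"
      using K of_nat_less_two_power[of m] by (simp add: mult_mono less_imp_le)
    also have "\<dots> = K * (1/2) ^ m"
      by (simp add: power_mult_distrib[symmetric] mult.left_commute)
    finally show ?thesis .
  qed
  then show ?thesis by (rule geometric_decayI)
qed

lemma geometric_decay_shift:
  assumes "q > 0" "geometric_decay q f" shows "geometric_decay q (\<lambda>m. case m of 0 \<Rightarrow> a | Suc k \<Rightarrow> f k)"
proof -
  obtain K where K: "K \<ge> 0" "\<And>m. norm (f m) \<le> K * q ^ m" using geometric_decayE[OF assms(2)] assms(1) by auto
  have "norm (case m of 0 \<Rightarrow> a | Suc k \<Rightarrow> f k) \<le> (norm a + K / q) * q ^ m" for m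
  proof (cases m)
    case 0 then show ?thesis using K assms by simp
  next
    case (Suc k)
    have "norm (f k) \<le> (K / q) * q ^ m" using K(2)[of k] assms Suc by simp
    also have "\<dots> \<le> (norm a + K / q) * q ^ m" using assms by (intro mult_right_mono) auto
    finally show ?thesis using Suc by simp
  qed
  then show ?thesis by (rule geometric_decayI)
qed

lemma geometric_decay_summable:
  fixes f :: "nat \<Rightarrow> 'a::banach"
  assumes "0 \<le> q" "q < 1" "geometric_decay q f" shows "summable f"
proof -
  obtain K where K: "\<And>m. norm (f m) \<le> K * q ^ m" using assms(3) unfolding geometric_decay_def by blast
  have "summable (\<lambda>m. K * q ^ m)" using assms by (intro summable_mult summable_geometric) auto
  then show ?thesis by (rule summable_comparison_test') (use K in auto)
qed

lemma has_derivative_geometric_series: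
  fixes f :: "nat \<Rightarrow> 'a::real_normed_vector \<Rightarrow> 'b::banach"
  assumes "open S" "convex S" and v: "v \<in> S"
    and f': "\<And>m v. v \<in> S \<Longrightarrow> (f m has_derivative f' m v) (at v)"
    and bd: "\<And>m v u. v \<in> S \<Longrightarrow> norm (f' m v u) \<le> K * norm u * q ^ m"
    and q: "0 \<le> q" "q < 1"
    and g: "\<And>v. v \<in> S \<Longrightarrow> (\<lambda>m. f m v) sums g v"
  shows "(g has_derivative (\<lambda>u. \<Sum>m. f' m v u)) (at v)"
proof -
  have geo: "summable (\<lambda>m. K * norm u * q ^ m)" for u :: 'a
    using q by (intro summable_mult summable_geometric) auto
  have sm: "summable (\<lambda>m. f' m x u)" if "x \<in> S" for x u
    by (rule summable_comparison_test'[OF geo[of u]]) (use bd[OF that] in auto)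
  have tail: "norm ((\<Sum>i<k. f' i x u) - (\<Sum>m. f' m x u)) \<le> K / (1 - q) * q ^ k * norm u" if "x \<in> S" for x u k
  proof -
    have "(\<Sum>m. f' m x u) = (\<Sum>m. f' (m + k) x u) + (\<Sum>i<k. f' i x u)"
      by (rule suminf_split_initial_segment[OF sm[OF that]])
    then have "norm ((\<Sum>i<k. f' i x u) - (\<Sum>m. f' m x u)) = norm (\<Sum>m. f' (m + k) x u)" by simp
    also have "\<dots> \<le> (\<Sum>m. K * norm u * q ^ k * q ^ m)"
    proof (rule norm_suminf_le)
      show "norm (f' (m + k) x u) \<le> K * norm u * q ^ k * q ^ m" for m
        using bd[OF that, of "m + k" u] by (simp add: power_add mult_ac)
      show "summable (\<lambda>m. K * norm u * q ^ k * q ^ m)"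
        using q by (intro summable_mult summable_geometric) auto
    qed
    also have "\<dots> = K * norm u * q ^ k * (1 / (1 - q))"
      using q by (subst suminf_mult) (auto intro: summable_geometric simp: suminf_geometric)
    finally show ?thesis by (simp add: mult_ac)
  qed
  have "\<exists>G. \<forall>x\<in>S. (\<lambda>m. f m x) sums G x \<and> (G has_derivative (\<lambda>u. \<Sum>m. f' m x u)) (at x within S)"
  proof (rule has_derivative_series[where S = S and f = f and x = v, OF assms(2) _ _ v g[OF v]])
    show "\<And>m x. x \<in> S \<Longrightarrow> (f m has_derivative f' m x) (at x within S)"
      using f' has_derivative_at_withinI by blast
    fix e :: real assume "e > 0"
    have "(\<lambda>k. K / (1 - q) * q ^ k) \<longlonglongrightarrow> K / (1 - q) * 0"
      using q by (intro tendsto_mult tendsto_const LIMSEQ_power_zero) auto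
    then have "\<forall>\<^sub>F k in sequentially. K / (1 - q) * q ^ k < e"
      using \<open>e > 0\<close> by (intro order_tendstoD(2)) auto
    then show "\<forall>\<^sub>F k in sequentially. \<forall>x\<in>S. \<forall>u. norm ((\<Sum>i<k. f' i x u) - (\<Sum>m. f' m x u)) \<le> e * norm u"
    proof (rule eventually_mono, intro ballI allI)
      fix k :: nat and x u assume "K / (1 - q) * q ^ k < e" "x \<in> S"
      then show "norm ((\<Sum>i<k. f' i x u) - (\<Sum>m. f' m x u)) \<le> e * norm u"
        using tail[OF \<open>x \<in> S\<close>, where k = k and u = u] mult_right_mono[of "K / (1 - q) * q ^ k" e "norm u"] by force
    qed
  qed
  then obtain G where G: "\<And>x. x \<in> S \<Longrightarrow> (\<lambda>m. f m x) sums G x"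
    "\<And>x. x \<in> S \<Longrightarrow> (G has_derivative (\<lambda>u. \<Sum>m. f' m x u)) (at x within S)" by blast
  have "G x = g x" if "x \<in> S" for x using G(1)[OF that] g[OF that] sums_unique2 by blast
  moreover have "(G has_derivative (\<lambda>u. \<Sum>m. f' m v u)) (at v)"
    using G(2)[OF v] at_within_open[OF v \<open>open S\<close>] by simp
  ultimately show ?thesis
    using has_derivative_transform_within_open[OF _ \<open>open S\<close> v] by blast
qed

section \<open>Flatness propagates the radial solution to all directions\<close>

lemma smult_cancel:
  fixes a b :: "complex^'n"
  assumes "k \<noteq> 0" "k *s a = b" shows "a = (1 / k) *s b"
  using assms by auto

text \<open>
  \<open>Om v u\<close> is the connection form on row vectors at the point \<open>v\<close> in the direction \<open>u\<close>. It is a sum of closed forms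
  with constant coefficients, so flatness means that its values commute.
\<close>

locale flat_fuchsian = fuchsian_recursion I l B h n c
  for I :: "'i set" and l :: "'i \<Rightarrow> complex^'n" and B h n c +
  fixes Om
  assumes Om_def: "Om = (\<lambda>v u \<beta>. (h \<cdot> u / (h \<cdot> v)) *s ((\<beta> \<cdot> n) *s h) + (\<Sum>j\<in>I. (l j \<cdot> u / (1 + l j \<cdot> v)) *s B j \<beta>))"
    and flat: "\<And>v u u' \<beta>. h \<cdot> v \<noteq> 0 \<Longrightarrow> (\<And>j. j \<in> I \<Longrightarrow> 1 + l j \<cdot> v \<noteq> 0) \<Longrightarrow>
      Om v u (Om v u' \<beta>) = Om v u' (Om v u \<beta>)"
    and torsion_free: "\<And>v u u' \<beta>. h \<cdot> v \<noteq> 0 \<Longrightarrow> (\<And>j. j \<in> I \<Longrightarrow> 1 + l j \<cdot> v \<noteq> 0) \<Longrightarrow>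
      Om v u \<beta> \<cdot> u' = Om v u' \<beta> \<cdot> u"
begin

definition M where "M v u \<beta> = (\<Sum>j\<in>I. (l j \<cdot> u / (1 + l j \<cdot> v)) *s B j \<beta>)"

lemma clinear_M: "clinear_map (M v u)"
  unfolding M_def
proof (rule clinear_mapI)
  note B = clinear_map_simps[OF linB]
  show "(\<Sum>j\<in>I. (l j \<cdot> u / (1 + l j \<cdot> v)) *s B j (a + b)) =
     (\<Sum>j\<in>I. (l j \<cdot> u / (1 + l j \<cdot> v)) *s B j a) + (\<Sum>j\<in>I. (l j \<cdot> u / (1 + l j \<cdot> v)) *s B j b)" for a b
    by (simp add: B vector_add_ldistrib sum.distrib cong: sum.cong)
  show "(\<Sum>j\<in>I. (l j \<cdot> u / (1 + l j \<cdot> v)) *s B j (k *s b)) =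
     k *s (\<Sum>j\<in>I. (l j \<cdot> u / (1 + l j \<cdot> v)) *s B j b)" for k b
    by (simp add: B vec_eq_iff sum_distrib_left mult_ac cong: sum.cong)
qed

text \<open>
  On this ball the coefficients decay at the rate \<open>1/8\<close>, and \<open>1 + l\<^sub>j\<close> stays away from \<open>0\<close>.
\<close>

definition r where "r = 1 / (8 * C)"

lemma r_pos: "r > 0" using C_props(1) by (simp add: r_def)

lemma small: "norm v < r \<Longrightarrow> C * norm v \<le> 1/8"
  using C_props(1) by (simp add: r_def field_simps)

lemma small_pairing:
  assumes "norm v < r" "\<eta> \<in> \<Lambda>" shows "cmod (\<eta> \<cdot> v) \<le> 1/8" "1 + \<eta> \<cdot> v \<noteq> 0"
proof -
  have "cmod (\<eta> \<cdot> v) \<le> norm \<eta> * norm v" by (rule norm_pairing_le)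
  also have "\<dots> \<le> C * norm v" using C_props(2)[OF assms(2)] by (rule mult_right_mono) simp
  finally show 1: "cmod (\<eta> \<cdot> v) \<le> 1/8" using small[OF assms(1)] by simp
  show "1 + \<eta> \<cdot> v \<noteq> 0"
  proof
    assume "1 + \<eta> \<cdot> v = 0"
    then have "\<eta> \<cdot> v = -1" by (simp add: eq_neg_iff_add_eq_0 add.commute)
    then show False using 1 by simp
  qed
qed

lemma small_l: "norm v < r \<Longrightarrow> j \<in> I \<Longrightarrow> 1 + l j \<cdot> v \<noteq> 0"
  by (rule small_pairing(2)) (auto simp: \<Lambda>_def)

lemma zero_in_Lambda: "0 \<in> \<Lambda>" and l_in_Lambda: "j \<in> I \<Longrightarrow> l j \<in> \<Lambda>"
  by (auto simp: \<Lambda>_def)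

lemma decay_S: "norm v < r \<Longrightarrow> \<eta> \<in> \<Lambda> \<Longrightarrow> geometric_decay (1/8) (\<lambda>m. S \<beta> m v \<eta>)"
  by (rule geometric_decayI, rule S_bound[OF small])

lemma decay_S4: "norm v < r \<Longrightarrow> \<eta> \<in> \<Lambda> \<Longrightarrow> geometric_decay (1/4) (\<lambda>m. S \<beta> m v \<eta>)"
  by (rule geometric_decay_mono[OF _ _ decay_S]) auto

lemma decay_DS: "norm v < r \<Longrightarrow> \<eta> \<in> \<Lambda> \<Longrightarrow> geometric_decay (1/4) (\<lambda>m. DS \<beta> m v u \<eta>)"
  by (rule geometric_decayI, rule DS_bound[OF small])

definition \<Phi> where "\<Phi> \<beta> v = (\<Sum>m. S \<beta> m v 0)"
definition D\<Phi> where "D\<Phi> \<beta> v u = (\<Sum>m. DS \<beta> m v u 0)"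

text \<open>
  The series with parameter \<open>\<eta>\<close> are the quotients that they were designed to be; summing the splitting
  \<open>S_split\<close> gives \<open>\<psi> = \<phi> - \<eta>(v) \<psi>\<close>.
\<close>

lemma sums_S:
  assumes v: "norm v < r" and \<eta>: "\<eta> \<in> \<Lambda>"
  shows "(\<lambda>m. S \<beta> m v \<eta>) sums ((1 / (1 + \<eta> \<cdot> v)) *s \<Phi> \<beta> v)"
proof -
  have sm: "summable (\<lambda>m. S \<beta> m v \<mu>)" if "\<mu> \<in> \<Lambda>" for \<mu>
    by (rule geometric_decay_summable[OF _ _ decay_S[OF v that]]) auto
  define \<psi> where "\<psi> = (\<Sum>m. S \<beta> m v \<eta>)"
  have \<psi>: "(\<lambda>m. S \<beta> m v \<eta>) sums \<psi>" using sm[OF \<eta>] by (simp add: \<psi>_def summable_sums)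
  have \<phi>: "(\<lambda>m. S \<beta> m v 0) sums \<Phi> \<beta> v" using sm[OF zero_in_Lambda] by (simp add: \<Phi>_def summable_sums)
  have "(\<lambda>m. S \<beta> (Suc m) v \<eta>) sums (\<psi> - \<beta>)" using \<psi> by (subst sums_Suc_iff) simp
  moreover have "(\<lambda>m. S \<beta> (Suc m) v 0) sums (\<Phi> \<beta> v - \<beta>)" using \<phi> by (subst sums_Suc_iff) simp
  then have "(\<lambda>m. S \<beta> (Suc m) v \<eta>) sums (\<Phi> \<beta> v - \<beta> - (\<eta> \<cdot> v) *s \<psi>)"
    unfolding S_split[of \<beta> _ v \<eta>]
    by (intro sums_diff bounded_linear.sums[OF bounded_linear_smult_right \<psi>])
  ultimately have "\<psi> - \<beta> = \<Phi> \<beta> v - \<beta> - (\<eta> \<cdot> v) *s \<psi>" by (rule sums_unique2)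
  then have "(1 + \<eta> \<cdot> v) *s \<psi> = \<Phi> \<beta> v" by (simp add: vec_eq_iff algebra_simps)
  from smult_cancel[OF small_pairing(2)[OF v \<eta>] this] show ?thesis using \<psi> by simp
qed

lemma sums_DS:
  assumes v: "norm v < r" and \<eta>: "\<eta> \<in> \<Lambda>"
  shows "(\<lambda>m. DS \<beta> m v u \<eta>) sums
    ((1 / (1 + \<eta> \<cdot> v)) *s (D\<Phi> \<beta> v u - (\<eta> \<cdot> u / (1 + \<eta> \<cdot> v)) *s \<Phi> \<beta> v))"
proof -
  have sm: "summable (\<lambda>m. DS \<beta> m v u \<mu>)" if "\<mu> \<in> \<Lambda>" for \<mu>
    by (rule geometric_decay_summable[OF _ _ decay_DS[OF v that]]) auto
  define dd where "dd = (\<Sum>m. DS \<beta> m v u \<eta>)"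
  have dd: "(\<lambda>m. DS \<beta> m v u \<eta>) sums dd" using sm[OF \<eta>] by (simp add: dd_def summable_sums)
  have \<delta>: "(\<lambda>m. DS \<beta> m v u 0) sums D\<Phi> \<beta> v u" using sm[OF zero_in_Lambda] by (simp add: D\<Phi>_def summable_sums)
  have "(\<lambda>m. DS \<beta> (Suc m) v u \<eta>) sums (dd - 0)" using dd by (subst sums_Suc_iff) simp
  moreover have "(\<lambda>m. DS \<beta> (Suc m) v u 0) sums (D\<Phi> \<beta> v u - 0)" using \<delta> by (subst sums_Suc_iff) simp
  then have "(\<lambda>m. DS \<beta> (Suc m) v u \<eta>) sums
      (D\<Phi> \<beta> v u - 0 - (\<eta> \<cdot> u) *s ((1 / (1 + \<eta> \<cdot> v)) *s \<Phi> \<beta> v) - (\<eta> \<cdot> v) *s dd)"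
    unfolding DS_split[of \<beta> _ v u \<eta>]
    by (intro sums_diff bounded_linear.sums[OF bounded_linear_smult_right] dd sums_S v \<eta>)
  ultimately have "dd - 0 = D\<Phi> \<beta> v u - 0 - (\<eta> \<cdot> u) *s ((1 / (1 + \<eta> \<cdot> v)) *s \<Phi> \<beta> v) - (\<eta> \<cdot> v) *s dd"
    by (rule sums_unique2)
  then have "(1 + \<eta> \<cdot> v) *s dd = D\<Phi> \<beta> v u - (\<eta> \<cdot> u / (1 + \<eta> \<cdot> v)) *s \<Phi> \<beta> v"
    by (simp add: vec_eq_iff algebra_simps)
  from smult_cancel[OF small_pairing(2)[OF v \<eta>] this] show ?thesis using dd by simp
qed

lemma sums_B_S:
  assumes "norm v < r"
  shows "(\<lambda>m. \<Sum>j\<in>I. (l j \<cdot> u) *s B j (S \<beta> m v (l j))) sums M v u (\<Phi> \<beta> v)"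
proof -
  have "(\<lambda>m. \<Sum>j\<in>I. (l j \<cdot> u) *s B j (S \<beta> m v (l j))) sums
     (\<Sum>j\<in>I. (l j \<cdot> u) *s B j ((1 / (1 + l j \<cdot> v)) *s \<Phi> \<beta> v))"
    by (intro sums_sum bounded_linear.sums[OF bounded_linear_smult_right]
        bounded_linear.sums[OF clinear_map_bounded[OF linB]] sums_S assms l_in_Lambda)
  also have "(\<Sum>j\<in>I. (l j \<cdot> u) *s B j ((1 / (1 + l j \<cdot> v)) *s \<Phi> \<beta> v)) = M v u (\<Phi> \<beta> v)"
    unfolding M_def by (intro sum.cong refl) (simp add: clinear_map_simps[OF linB])
  finally show ?thesis .
qed

text \<open>
  The radial equation for \<open>\<Phi>\<close>, the sum on the left being the derivative of \<open>\<Phi>\<close> in the radial direction.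
\<close>

lemma sums_euler_S:
  assumes v: "norm v < r" and ker: "R \<beta> = 0"
  shows "(\<lambda>m. of_nat m *s S \<beta> m v 0) sums (- R (\<Phi> \<beta> v) - M v v (\<Phi> \<beta> v))"
proof -
  note Rb = clinear_map_bounded[OF clinear_R]
  have R: "(\<lambda>m. R (S \<beta> m v 0)) sums R (\<Phi> \<beta> v)"
    using bounded_linear.sums[OF Rb sums_S[OF v zero_in_Lambda]] by (simp add: pairing_simps)
  have "(\<lambda>m. of_nat (Suc m) *s S \<beta> (Suc m) v 0) sums (- M v v (\<Phi> \<beta> v) - (R (\<Phi> \<beta> v) - R \<beta>))"
  proof -
    have "of_nat (Suc m) *s S \<beta> (Suc m) v 0
      = - (\<Sum>j\<in>I. (l j \<cdot> v) *s B j (S \<beta> m v (l j))) - R (S \<beta> (Suc m) v 0)" for m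
      using recursion[of "Suc m" \<beta> v] unfolding nat.case(2) by (simp only: eq_diff_eq)
    moreover have "(\<lambda>m. R (S \<beta> (Suc m) v 0)) sums (R (\<Phi> \<beta> v) - R \<beta>)"
      using R by (subst sums_Suc_iff) simp
    ultimately show ?thesis using sums_diff[OF sums_minus[OF sums_B_S[OF v]]] by simp
  qed
  then have "(\<lambda>m. of_nat m *s S \<beta> m v 0) sums (- M v v (\<Phi> \<beta> v) - (R (\<Phi> \<beta> v) - R \<beta>) + of_nat 0 *s S \<beta> 0 v 0)"
    by (subst (asm) sums_Suc_iff) simp
  then show ?thesis using ker by (simp add: minus_diff_commute)
qed

lemma sums_Suc_S:
  assumes v: "norm v < r" and \<eta>: "\<eta> \<in> \<Lambda>" and ker: "R \<beta> = 0"
  shows "(\<lambda>m. of_nat (Suc m) *s S \<beta> m v \<eta>) sums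
   ((1 / (1 + \<eta> \<cdot> v)) *s (- R (\<Phi> \<beta> v) - M v v (\<Phi> \<beta> v) + (1 / (1 + \<eta> \<cdot> v)) *s \<Phi> \<beta> v))"
proof -
  have "summable (\<lambda>m. real m *\<^sub>R S \<beta> m v \<eta>)"
    by (rule geometric_decay_summable[OF _ _ geometric_decay_index[OF decay_S4[OF v \<eta>]]]) auto
  then have sm: "summable (\<lambda>m. of_nat m *s S \<beta> m v \<eta>)" by (simp add: scaleR_smult)
  define \<xi> where "\<xi> = (\<Sum>m. of_nat m *s S \<beta> m v \<eta>)"
  have \<xi>: "(\<lambda>m. of_nat m *s S \<beta> m v \<eta>) sums \<xi>" using sm by (simp add: \<xi>_def summable_sums)
  let ?\<psi> = "(1 / (1 + \<eta> \<cdot> v)) *s \<Phi> \<beta> v" and ?\<phi>' = "- R (\<Phi> \<beta> v) - M v v (\<Phi> \<beta> v)"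
  have suc: "(\<lambda>m. of_nat (Suc m) *s S \<beta> m v \<eta>) sums (\<xi> + ?\<psi>)"
    using sums_add[OF \<xi> sums_S[OF v \<eta>]] by (simp add: vector_sadd_rdistrib add.commute)
  have 1: "(\<lambda>m. of_nat (Suc m) *s S \<beta> (Suc m) v \<eta>) sums \<xi>"
    using \<xi> by (subst sums_Suc_iff) simp
  have "(\<lambda>m. of_nat (Suc m) *s S \<beta> (Suc m) v 0) sums ?\<phi>'"
    using sums_euler_S[OF v ker] by (subst sums_Suc_iff) simp
  from sums_diff[OF this bounded_linear.sums[OF bounded_linear_smult_right suc, of "\<eta> \<cdot> v"]]
  have 2: "(\<lambda>m. of_nat (Suc m) *s S \<beta> (Suc m) v \<eta>) sums (?\<phi>' - (\<eta> \<cdot> v) *s (\<xi> + ?\<psi>))"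
    unfolding S_split[of \<beta> _ v \<eta>] vector_ssub_ldistrib vector_smult_assoc mult.commute[of "\<eta> \<cdot> v"] .
  have shift: "a = p - q \<Longrightarrow> a + y + q = p + y" for a p q y :: "complex^'n" by simp
  have "\<xi> = ?\<phi>' - (\<eta> \<cdot> v) *s (\<xi> + ?\<psi>)" using 1 2 by (rule sums_unique2)
  then have "(1 + \<eta> \<cdot> v) *s (\<xi> + ?\<psi>) = ?\<phi>' + ?\<psi>"
    unfolding vector_sadd_rdistrib vector_smult_lid by (rule shift)
  from smult_cancel[OF small_pairing(2)[OF v \<eta>] this]
  have "(1 / (1 + \<eta> \<cdot> v)) *s (?\<phi>' + ?\<psi>) = \<xi> + ?\<psi>" by (rule sym)
  then show ?thesis using suc by simp
qed

text \<open>
  The homogeneous parts of \<open>h(v)\<close> times the covariant derivative of \<open>\<Phi>\<close> in the direction \<open>u\<close>. Multiplying by \<open>h\<close>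
  removes the pole, and it also removes the term that comes from the commutator of the
  radial field with the constant field \<open>u\<close>.
\<close>

definition defect :: "complex^'n \<Rightarrow> complex^'n \<Rightarrow> complex^'n \<Rightarrow> nat \<Rightarrow> complex^'n"
  where "defect \<beta> v u m = (case m of 0 \<Rightarrow> 0 | Suc k \<Rightarrow>
    (h \<cdot> v) *s DS \<beta> m v u 0 + (h \<cdot> u) *s R (S \<beta> m v 0)
      + (h \<cdot> v) *s (\<Sum>j\<in>I. (l j \<cdot> u) *s B j (S \<beta> k v (l j))))"

text \<open>
  Flatness for the radial direction and \<open>u\<close>, with the pole cleared. The connection form is \<open>R + c + M v v\<close> in the
  radial direction and \<open>(h(u) / h(v)) (R + c) + M v u\<close> in the direction \<open>u\<close>.
\<close>

lemma flat_M:
  assumes v: "norm v < r" and hv: "h \<cdot> v \<noteq> 0"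
  shows "(h \<cdot> u) *s (M v v (R \<beta>) - R (M v v \<beta>))
    = (h \<cdot> v) *s (M v u (R \<beta>) - R (M v u \<beta>) + M v u (M v v \<beta>) - M v v (M v u \<beta>))"
proof -
  define A where "A \<beta> = (\<beta> \<cdot> n) *s h" for \<beta>
  have clA: "clinear_map A"
    unfolding A_def by (rule clinear_mapI) (auto simp: pairing_simps vec_eq_iff algebra_simps)
  note lin = clinear_map_simps[OF clinear_M] clinear_map_simps[OF clA]
  have R: "R \<beta> = A \<beta> - c *s \<beta>" for \<beta> by (simp add: R_def A_def)
  have Om: "Om v w \<beta> = (h \<cdot> w / (h \<cdot> v)) *s A \<beta> + M v w \<beta>" for w \<beta>
    by (simp add: Om_def A_def M_def)
  define q where "q = h \<cdot> u / (h \<cdot> v)"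
  have "Om v u (Om v v \<beta>) = Om v v (Om v u \<beta>)" by (rule flat[OF hv small_l[OF v]])
  then have "q *s A (M v v \<beta>) + M v u (A \<beta>) + M v u (M v v \<beta>)
     = A (M v u \<beta>) + q *s M v v (A \<beta>) + M v v (M v u \<beta>)"
    using hv by (simp add: Om lin q_def[symmetric] vector_add_ldistrib) (simp add: algebra_simps)
  then have "q *s (M v v (R \<beta>) - R (M v v \<beta>))
    = M v u (R \<beta>) - R (M v u \<beta>) + M v u (M v v \<beta>) - M v v (M v u \<beta>)"
    by (simp add: R lin vector_ssub_ldistrib) (simp add: algebra_simps)
  then have "(h \<cdot> v) *s (q *s (M v v (R \<beta>) - R (M v v \<beta>)))
    = (h \<cdot> v) *s (M v u (R \<beta>) - R (M v u \<beta>) + M v u (M v v \<beta>) - M v v (M v u \<beta>))" by simp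
  then show ?thesis using hv by (simp add: q_def)
qed

lemma M_bound:
  obtains L where "L \<ge> 0" "\<And>w v \<beta>. norm w < r \<Longrightarrow> norm (M w v \<beta>) \<le> L * norm v * norm \<beta>"
proof
  let ?L = "\<Sum>j\<in>I. norm (l j) * 2 * onorm (B j)"
  have on: "onorm (B j) \<ge> 0" "norm (B j w) \<le> onorm (B j) * norm w" if "j \<in> I" for j w
    using onorm_pos_le[OF clinear_map_bounded[OF linB[OF that]]]
      onorm[OF clinear_map_bounded[OF linB[OF that]]] by auto
  show "?L \<ge> 0" by (intro sum_nonneg mult_nonneg_nonneg on) auto
  fix w v \<beta> assume w: "norm (w::complex^'n) < r"
  have "norm ((l j \<cdot> v / (1 + l j \<cdot> w)) *s B j \<beta>) \<le> norm (l j) * 2 * onorm (B j) * (norm v * norm \<beta>)"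
    if j: "j \<in> I" for j
  proof -
    have "cmod (1 + l j \<cdot> w) \<ge> 1 - cmod (l j \<cdot> w)"
      using norm_diff_ineq[of 1 "l j \<cdot> w"] by simp
    then have "cmod (1 + l j \<cdot> w) \<ge> 1/2" using small_pairing(1)[OF w l_in_Lambda[OF j]] by simp
    then have "cmod (1 / (1 + l j \<cdot> w)) \<le> 2" by (simp add: norm_divide divide_le_eq)
    then have "cmod (l j \<cdot> v) * cmod (1 / (1 + l j \<cdot> w)) \<le> (norm (l j) * norm v) * 2"
      by (intro mult_mono norm_pairing_le) auto
    then have "cmod (l j \<cdot> v / (1 + l j \<cdot> w)) \<le> (norm (l j) * norm v) * 2"
      by (simp add: norm_divide)
    then have "norm ((l j \<cdot> v / (1 + l j \<cdot> w)) *s B j \<beta>) \<le> ((norm (l j) * norm v) * 2) * (onorm (B j) * norm \<beta>)"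
      unfolding norm_smult using on[OF j] by (intro mult_mono) auto
    then show ?thesis by (simp add: mult_ac)
  qed
  then show "norm (M w v \<beta>) \<le> ?L * norm v * norm \<beta>"
    unfolding M_def sum_distrib_right mult.assoc[of ?L] by (intro sum_norm_le) (auto simp: mult.assoc)
qed

lemma sums_defect:
  assumes v: "norm v < r" and ker: "R \<beta> = 0"
  shows "defect \<beta> v u sums ((h \<cdot> v) *s D\<Phi> \<beta> v u + (h \<cdot> u) *s R (\<Phi> \<beta> v) + (h \<cdot> v) *s M v u (\<Phi> \<beta> v))"
proof -
  have "(\<lambda>m. DS \<beta> m v u 0) sums D\<Phi> \<beta> v u" using sums_DS[OF v zero_in_Lambda] by (simp add: pairing_simps)
  then have 1: "(\<lambda>m. DS \<beta> (Suc m) v u 0) sums D\<Phi> \<beta> v u" by (subst sums_Suc_iff) simp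
  have "(\<lambda>m. R (S \<beta> m v 0)) sums R (\<Phi> \<beta> v)"
    using bounded_linear.sums[OF clinear_map_bounded[OF clinear_R] sums_S[OF v zero_in_Lambda]]
    by (simp add: pairing_simps)
  then have 2: "(\<lambda>m. R (S \<beta> (Suc m) v 0)) sums R (\<Phi> \<beta> v)" using ker by (subst sums_Suc_iff) simp
  note bl = bounded_linear.sums[OF bounded_linear_smult_right]
  have "(\<lambda>m. defect \<beta> v u (Suc m)) sums ((h \<cdot> v) *s D\<Phi> \<beta> v u + (h \<cdot> u) *s R (\<Phi> \<beta> v) + (h \<cdot> v) *s M v u (\<Phi> \<beta> v))"
    unfolding defect_def nat.case(2) by (intro sums_add bl 1 2 sums_B_S v)
  then show ?thesis by (subst (asm) sums_Suc_iff) (simp add: defect_def)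
qed

text \<open>
  The radial and the \<open>u\<close>-directional covariant derivatives commute, so the covariant derivative of \<open>\<Phi>\<close> in
  the direction \<open>u\<close> satisfies the radial equation that \<open>\<Phi>\<close> satisfies. The computation is done on the level of
  sums, where every series is an explicit expression in \<open>\<Phi> \<beta> v\<close> and \<open>D\<Phi> \<beta> v u\<close>.
\<close>

lemma sums_euler_defect:
  assumes v: "norm v < r" and hv: "h \<cdot> v \<noteq> 0" and ker: "R \<beta> = 0"
  shows "(\<lambda>m. of_nat m *s defect \<beta> v u m + R (defect \<beta> v u m)) sums (- M v v (\<Sum>m. defect \<beta> v u m))"
proof -
  define P where "P k w = (\<Sum>j\<in>I. (l j \<cdot> w) *s B j (S \<beta> k v (l j)))" for k w
  define T where "T k j = (l j \<cdot> u) *s B j (of_nat (Suc k) *s S \<beta> k v (l j))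
      - (l j \<cdot> v) *s B j (DS \<beta> k v u (l j)) - (l j \<cdot> u) *s B j (S \<beta> k v (l j))" for k j
  let ?\<phi> = "\<Phi> \<beta> v" and ?\<delta> = "D\<Phi> \<beta> v u"
  note R = clinear_map_simps[OF clinear_R] and M = clinear_map_simps[OF clinear_M]
  have step: "of_nat (Suc k) *s defect \<beta> v u (Suc k) + R (defect \<beta> v u (Suc k))
     = (h \<cdot> v) *s (\<Sum>j\<in>I. T k j) - (h \<cdot> u) *s R (P k v) + (h \<cdot> v) *s R (P k u)" for k
  proof -
    let ?m = "of_nat (Suc k) :: complex"
    have 1: "?m *s DS \<beta> (Suc k) v u 0 + R (DS \<beta> (Suc k) v u 0)
       = - P k u - (\<Sum>j\<in>I. (l j \<cdot> v) *s B j (DS \<beta> k v u (l j)))"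
      unfolding DS_recursion by (simp add: P_def sum.distrib)
    have 2: "?m *s S \<beta> (Suc k) v 0 + R (S \<beta> (Suc k) v 0) = - P k v"
      unfolding recursion by (simp add: P_def)
    have "?m *s R (S \<beta> (Suc k) v 0) + R (R (S \<beta> (Suc k) v 0)) = R (- P k v)"
      unfolding 2[symmetric] R ..
    then have 3: "?m *s R (S \<beta> (Suc k) v 0) + R (R (S \<beta> (Suc k) v 0)) = - R (P k v)" by (simp only: R)
    have 4: "(\<Sum>j\<in>I. T k j) = ?m *s P k u - (\<Sum>j\<in>I. (l j \<cdot> v) *s B j (DS \<beta> k v u (l j))) - P k u"
    proof -
      have "(\<Sum>j\<in>I. (l j \<cdot> u) *s B j (?m *s S \<beta> k v (l j))) = ?m *s P k u"
        unfolding P_def by (simp add: clinear_map_simps[OF linB] vec_eq_iff sum_distrib_left mult_ac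
            del: of_nat_Suc cong: sum.cong)
      then show ?thesis by (simp add: T_def sum_subtractf P_def del: of_nat_Suc)
    qed
    have "?m *s defect \<beta> v u (Suc k) + R (defect \<beta> v u (Suc k))
     = (h \<cdot> v) *s (?m *s DS \<beta> (Suc k) v u 0 + R (DS \<beta> (Suc k) v u 0))
       + (h \<cdot> u) *s (?m *s R (S \<beta> (Suc k) v 0) + R (R (S \<beta> (Suc k) v 0)))
       + (h \<cdot> v) *s (?m *s P k u + R (P k u))"
      unfolding defect_def nat.case(2) P_def[symmetric] R vector_add_ldistrib vector_smult_assoc
        mult.commute[of ?m] by (simp only: add_ac)
    also have "\<dots> = (h \<cdot> v) *s (\<Sum>j\<in>I. T k j) - (h \<cdot> u) *s R (P k v) + (h \<cdot> v) *s R (P k u)"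
      unfolding 1 3 4 by (simp add: vec_eq_iff algebra_simps del: of_nat_Suc)
    finally show ?thesis .
  qed
  have sT: "(\<lambda>k. \<Sum>j\<in>I. T k j) sums (M v u (- R ?\<phi> - M v v ?\<phi>) - M v v ?\<delta>)"
  proof -
    note bl = bounded_linear.sums[OF bounded_linear_smult_right]
      bounded_linear.sums[OF clinear_map_bounded[OF linB]]
    let ?d = "\<lambda>j. 1 / (1 + l j \<cdot> v)"
    have "(\<lambda>k. \<Sum>j\<in>I. T k j) sums (\<Sum>j\<in>I. (l j \<cdot> u) *s B j (?d j *s (- R ?\<phi> - M v v ?\<phi> + ?d j *s ?\<phi>))
       - (l j \<cdot> v) *s B j (?d j *s (?\<delta> - (l j \<cdot> u / (1 + l j \<cdot> v)) *s ?\<phi>)) - (l j \<cdot> u) *s B j (?d j *s ?\<phi>))"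
      unfolding T_def
      by (intro sums_sum sums_diff bl sums_Suc_S sums_DS sums_S v ker l_in_Lambda)
    also have "(\<Sum>j\<in>I. (l j \<cdot> u) *s B j (?d j *s (- R ?\<phi> - M v v ?\<phi> + ?d j *s ?\<phi>))
       - (l j \<cdot> v) *s B j (?d j *s (?\<delta> - (l j \<cdot> u / (1 + l j \<cdot> v)) *s ?\<phi>)) - (l j \<cdot> u) *s B j (?d j *s ?\<phi>))
      = (\<Sum>j\<in>I. (l j \<cdot> u / (1 + l j \<cdot> v)) *s B j (- R ?\<phi> - M v v ?\<phi>) - (l j \<cdot> v / (1 + l j \<cdot> v)) *s B j ?\<delta>)"
    proof (intro sum.cong refl)
      fix j assume j: "j \<in> I"
      note Bj = clinear_map_simps[OF linB[OF j]]
      have q: "z / (1 + l j \<cdot> v) = z * ?d j" for z by simp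
      have id: "y * (1 / (1 + x)) * (1 / (1 + x)) + x * (1 / (1 + x)) * (y * (1 / (1 + x))) - y * (1 / (1 + x)) = 0"
        if "1 + x \<noteq> 0" for x y :: complex
        using that by (simp add: divide_simps) (simp add: algebra_simps)
      have expand: "y *s B j (d *s (a + d *s f)) - x *s B j (d *s (b - (y * d) *s f)) - y *s B j (d *s f)
        = (y * d) *s B j a - (x * d) *s B j b + (y * d * d + x * d * (y * d) - y * d) *s B j f" for x y d a b f
        by (simp add: Bj vec_eq_iff algebra_simps)
      show "(l j \<cdot> u) *s B j (?d j *s (- R ?\<phi> - M v v ?\<phi> + ?d j *s ?\<phi>))
       - (l j \<cdot> v) *s B j (?d j *s (?\<delta> - (l j \<cdot> u / (1 + l j \<cdot> v)) *s ?\<phi>)) - (l j \<cdot> u) *s B j (?d j *s ?\<phi>)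
       = (l j \<cdot> u / (1 + l j \<cdot> v)) *s B j (- R ?\<phi> - M v v ?\<phi>) - (l j \<cdot> v / (1 + l j \<cdot> v)) *s B j ?\<delta>"
        unfolding q[of "l j \<cdot> u"] q[of "l j \<cdot> v"] expand id[OF small_l[OF v j]] by simp
    qed
    also have "\<dots> = M v u (- R ?\<phi> - M v v ?\<phi>) - M v v ?\<delta>"
      by (simp add: M_def sum_subtractf)
    finally show ?thesis .
  qed
  note bl = bounded_linear.sums[OF bounded_linear_smult_right]
  note blR = bounded_linear.sums[OF clinear_map_bounded[OF clinear_R]]
  have "(\<lambda>k. of_nat (Suc k) *s defect \<beta> v u (Suc k) + R (defect \<beta> v u (Suc k))) sums
     ((h \<cdot> v) *s (M v u (- R ?\<phi> - M v v ?\<phi>) - M v v ?\<delta>) - (h \<cdot> u) *s R (M v v ?\<phi>) + (h \<cdot> v) *s R (M v u ?\<phi>))"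
    unfolding step P_def by (intro sums_add sums_diff bl blR sT sums_B_S v)
  then have "(\<lambda>m. of_nat m *s defect \<beta> v u m + R (defect \<beta> v u m)) sums
     ((h \<cdot> v) *s (M v u (- R ?\<phi> - M v v ?\<phi>) - M v v ?\<delta>) - (h \<cdot> u) *s R (M v v ?\<phi>) + (h \<cdot> v) *s R (M v u ?\<phi>))"
    by (subst (asm) sums_Suc_iff) (simp add: defect_def R)
  also have "((h \<cdot> v) *s (M v u (- R ?\<phi> - M v v ?\<phi>) - M v v ?\<delta>) - (h \<cdot> u) *s R (M v v ?\<phi>) + (h \<cdot> v) *s R (M v u ?\<phi>))
     = (h \<cdot> u) *s (M v v (R ?\<phi>) - R (M v v ?\<phi>)) - (h \<cdot> v) *s (M v u (R ?\<phi>) - R (M v u ?\<phi>) + M v u (M v v ?\<phi>))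
       - (h \<cdot> v) *s M v v ?\<delta> - (h \<cdot> u) *s M v v (R ?\<phi>)"
    by (simp add: M vec_eq_iff algebra_simps)
  also have "\<dots> = - M v v ((h \<cdot> v) *s ?\<delta> + (h \<cdot> u) *s R ?\<phi> + (h \<cdot> v) *s M v u ?\<phi>)"
    unfolding flat_M[OF v hv] by (simp add: M vec_eq_iff algebra_simps)
  finally show ?thesis using sums_unique[OF sums_defect[OF v ker, of u]] by simp
qed

lemma defect_homogeneous: "defect \<beta> (s *\<^sub>R v) u m = s ^ m *\<^sub>R defect \<beta> v u m"
proof (cases m)
  case (Suc k)
  note R = clinear_map_simps[OF clinear_R]
  have 1: "(h \<cdot> (s *\<^sub>R v)) *s DS \<beta> m (s *\<^sub>R v) u 0 = s ^ m *\<^sub>R ((h \<cdot> v) *s DS \<beta> m v u 0)"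
  proof -
    have "(h \<cdot> (s *\<^sub>R v)) *s DS \<beta> m (s *\<^sub>R v) u 0 = (h \<cdot> v) *s (s *\<^sub>R DS \<beta> m (s *\<^sub>R v) u 0)"
      by (simp add: pairing_simps scaleR_smult scaleR_conv_of_real mult.commute del: DS.simps)
    also have "\<dots> = s ^ m *\<^sub>R ((h \<cdot> v) *s DS \<beta> m v u 0)"
      unfolding DS_homogeneous by (simp add: scaleR_smult mult.commute)
    finally show ?thesis .
  qed
  have 2: "(h \<cdot> u) *s R (S \<beta> m (s *\<^sub>R v) 0) = s ^ m *\<^sub>R ((h \<cdot> u) *s R (S \<beta> m v 0))"
    unfolding S_homogeneous R by (simp add: scaleR_smult mult.commute)
  have "(\<Sum>j\<in>I. (l j \<cdot> u) *s B j (S \<beta> k (s *\<^sub>R v) (l j))) = s ^ k *\<^sub>R (\<Sum>j\<in>I. (l j \<cdot> u) *s B j (S \<beta> k v (l j)))"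
    unfolding S_homogeneous scaleR_sum_right
    by (intro sum.cong refl) (simp add: clinear_map_simps[OF linB] scaleR_smult mult.commute)
  then have 3: "(h \<cdot> (s *\<^sub>R v)) *s (\<Sum>j\<in>I. (l j \<cdot> u) *s B j (S \<beta> k (s *\<^sub>R v) (l j)))
      = s ^ m *\<^sub>R ((h \<cdot> v) *s (\<Sum>j\<in>I. (l j \<cdot> u) *s B j (S \<beta> k v (l j))))"
    by (simp add: pairing_simps scaleR_smult scaleR_conv_of_real Suc mult_ac)
  show ?thesis
    using 1 2 3 unfolding Suc by (simp only: defect_def nat.case(2) scaleR_add_right)
qed (simp add: defect_def)

lemma decay_defect:
  assumes v: "norm v < r" shows "geometric_decay (1/4) (defect \<beta> v u)"
proof -
  have "geometric_decay (1/4) (\<lambda>k. \<Sum>j\<in>I. (l j \<cdot> u) *s B j (S \<beta> k v (l j)))"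
    by (intro geometric_decay_sum geometric_decay_linear[OF bounded_linear_smult_right]
       geometric_decay_linear[OF clinear_map_bounded[OF linB]] decay_S4 v l_in_Lambda) auto
  from geometric_decay_shift[OF _ this, of 0]
  have 3: "geometric_decay (1/4) (\<lambda>m. case m of 0 \<Rightarrow> 0 | Suc k \<Rightarrow> (\<Sum>j\<in>I. (l j \<cdot> u) *s B j (S \<beta> k v (l j))))"
    by simp
  let ?f = "\<lambda>m. (h \<cdot> v) *s DS \<beta> m v u 0 + (h \<cdot> u) *s R (S \<beta> m v 0)
     + (h \<cdot> v) *s (case m of 0 \<Rightarrow> 0 | Suc k \<Rightarrow> (\<Sum>j\<in>I. (l j \<cdot> u) *s B j (S \<beta> k v (l j))))"
  have "geometric_decay (1/4) ?f"
    by (intro geometric_decay_add geometric_decay_linear[OF bounded_linear_smult_right] 3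
       geometric_decay_linear[OF clinear_map_bounded[OF clinear_R]] decay_S4 decay_DS v zero_in_Lambda)
  then obtain K where K: "K \<ge> 0" "\<And>m. norm (?f m) \<le> K * (1/4) ^ m" by (rule geometric_decayE) auto
  show ?thesis
  proof (rule geometric_decayI)
    fix m show "norm (defect \<beta> v u m) \<le> K * (1/4) ^ m"
      using K(1) K(2)[of m] by (cases m) (simp_all add: defect_def)
  qed
qed

text \<open>
  Restricting the previous equation to the ray \<open>s \<mapsto> s v\<close> and using homogeneity gives a singular equation in
  \<open>s\<close> with a solution that vanishes at \<open>s = 0\<close>.
\<close>

lemma defect_eq_0:
  assumes v: "norm v < r" and hv: "h \<cdot> v \<noteq> 0" and ker: "R \<beta> = 0"
  shows "defect \<beta> v u m = 0"
proof -
  let ?y = "\<lambda>m. of_nat m *s defect \<beta> v u m + R (defect \<beta> v u m)"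
  note R = clinear_map_simps[OF clinear_R]
  have de: "geometric_decay (1/2) (defect \<beta> v u)"
    by (rule geometric_decay_mono[OF _ _ decay_defect[OF v]]) auto
  have "geometric_decay (1/2) (\<lambda>m. real m *\<^sub>R defect \<beta> v u m + R (defect \<beta> v u m))"
    by (intro geometric_decay_add geometric_decay_index decay_defect v de
       geometric_decay_linear[OF clinear_map_bounded[OF clinear_R]])
  then have dy: "geometric_decay (1/2) ?y" by (simp add: scaleR_smult)
  obtain K1 where K1: "K1 \<ge> 0" "\<And>m. norm (defect \<beta> v u m) \<le> K1 * (1/2) ^ m" using geometric_decayE[OF de] by auto
  obtain K2 where K2: "K2 \<ge> 0" "\<And>m. norm (?y m) \<le> K2 * (1/2) ^ m" using geometric_decayE[OF dy] by auto
  obtain L where L: "L \<ge> 0" "\<And>w v \<beta>. norm w < r \<Longrightarrow> norm (M w v \<beta>) \<le> L * norm v * norm \<beta>"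
    using M_bound by blast
  show ?thesis
  proof (rule fuchsian_series_unique[of "defect \<beta> v u" "K1 + K2" ?y "L * norm v"])
    fix m
    have p: "(1/2 :: real) ^ m \<ge> 0" by simp
    show "norm (defect \<beta> v u m) \<le> (K1 + K2) * (1/2) ^ m"
      using K1(2)[of m] mult_right_mono[OF _ p, of K1 "K1 + K2"] K2(1) by linarith
    show "norm (?y m) \<le> (K1 + K2) * (1/2) ^ m"
      using K2(2)[of m] mult_right_mono[OF _ p, of K2 "K1 + K2"] K1(1) by linarith
    show "?y m = 0 \<longleftrightarrow> defect \<beta> v u m = 0"
    proof (cases m)
      case 0 then show ?thesis by (simp add: defect_def R)
    next
      case (Suc k)
      then have "m \<ge> 1" by simp
      show ?thesis
      proof
        show "?y m = 0 \<Longrightarrow> defect \<beta> v u m = 0" by (rule nonresonant_inj[OF \<open>m \<ge> 1\<close>])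
        show "defect \<beta> v u m = 0 \<Longrightarrow> ?y m = 0" by (simp only: R vector_smult_rzero add_0)
      qed
    qed
  next
    fix s :: real assume s: "0 < s" "s < 1"
    let ?w = "s *\<^sub>R v"
    have w: "norm ?w < r"
    proof -
      have "s * norm v \<le> 1 * norm v" using s by (intro mult_right_mono) auto
      then show ?thesis using v s by simp
    qed
    have hw: "h \<cdot> ?w \<noteq> 0" using hv s by (simp add: pairing_simps)
    have eq: "of_nat m *s defect \<beta> ?w u m + R (defect \<beta> ?w u m) = s ^ m *\<^sub>R ?y m" for m
      by (simp add: defect_homogeneous R scaleR_add_right) (simp add: scaleR_smult mult.commute)
    have sy: "(\<Sum>m. s ^ m *\<^sub>R ?y m) = - M ?w ?w (\<Sum>m. s ^ m *\<^sub>R defect \<beta> v u m)"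
      using sums_unique[OF sums_euler_defect[OF w hw ker, of u], symmetric]
      unfolding eq unfolding defect_homogeneous .
    have "norm (\<Sum>m. s ^ m *\<^sub>R ?y m) \<le> L * norm ?w * norm (\<Sum>m. s ^ m *\<^sub>R defect \<beta> v u m)"
      unfolding sy norm_minus_cancel by (rule L(2)[OF w])
    then show "norm (\<Sum>m. s ^ m *\<^sub>R ?y m) \<le> L * norm v * s * norm (\<Sum>m. s ^ m *\<^sub>R defect \<beta> v u m)"
      using s by (simp add: mult_ac)
  qed
qed

lemma D\<Phi>_eq:
  assumes v: "norm v < r" and hv: "h \<cdot> v \<noteq> 0" and ker: "R \<beta> = 0"
  shows "D\<Phi> \<beta> v u = - ((h \<cdot> u / (h \<cdot> v)) *s R (\<Phi> \<beta> v)) - M v u (\<Phi> \<beta> v)"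
proof -
  have neg: "a + b + d = 0 \<Longrightarrow> a = - b - d" for a b d :: "complex^'n"
    by (simp add: eq_diff_eq eq_neg_iff_add_eq_0 add_ac)
  have "(\<lambda>m. defect \<beta> v u m) sums 0" using defect_eq_0[OF v hv ker] by simp
  then have "(h \<cdot> v) *s D\<Phi> \<beta> v u + (h \<cdot> u) *s R (\<Phi> \<beta> v) + (h \<cdot> v) *s M v u (\<Phi> \<beta> v) = 0"
    using sums_defect[OF v ker] sums_unique2 by blast
  then have "(h \<cdot> v) *s D\<Phi> \<beta> v u = - ((h \<cdot> u) *s R (\<Phi> \<beta> v)) - (h \<cdot> v) *s M v u (\<Phi> \<beta> v)"
    by (rule neg)
  from smult_cancel[OF hv this] show ?thesis
    using hv by (simp add: vector_ssub_ldistrib vector_smult_rneg)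
qed

text \<open>
  Torsion freeness is an identity between functions of \<open>s\<close> on each ray; comparing coefficients makes it an
  identity for each degree.
\<close>

lemma torsion_termwise:
  assumes v: "norm v < r" and hv: "h \<cdot> v \<noteq> 0"
  shows "(\<Sum>j\<in>I. (l j \<cdot> u) *s B j (S \<beta> k v (l j))) \<cdot> v = (\<Sum>j\<in>I. (l j \<cdot> v) *s B j (S \<beta> k v (l j))) \<cdot> u"
proof -
  let ?P = "\<lambda>w k v. \<Sum>j\<in>I. (l j \<cdot> w) *s B j (S \<beta> k v (l j))"
  define X where "X k v = ?P u k v \<cdot> v - ?P v k v \<cdot> u" for k v
  have hom: "X k (s *\<^sub>R v) = s ^ Suc k *\<^sub>R X k v" for s :: real and k
  proof -
    have P1: "?P w k (s *\<^sub>R v) = s ^ k *\<^sub>R ?P w k v" for w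
      unfolding S_homogeneous scaleR_sum_right
      by (intro sum.cong refl) (simp add: clinear_map_simps[OF linB] scaleR_smult mult.commute)
    have P2: "?P (s *\<^sub>R v) k v = s *\<^sub>R ?P v k v"
      unfolding scaleR_sum_right by (intro sum.cong refl) (simp add: pairing_simps scaleR_smult scaleR_conv_of_real)
    show ?thesis unfolding X_def P1 unfolding P2 unfolding pairing_simps(9,10) by (simp add: algebra_simps)
  qed
  have sums: "(\<lambda>k. X k w) sums (M w u (\<Phi> \<beta> w) \<cdot> w - M w w (\<Phi> \<beta> w) \<cdot> u)" if "norm w < r" for w
    unfolding X_def
    by (intro sums_diff bounded_linear.sums[OF bounded_linear_pairing_left] sums_B_S that)
  have zero: "M w u \<phi> \<cdot> w = M w w \<phi> \<cdot> u" if "norm w < r" "h \<cdot> w \<noteq> 0" for w \<phi>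
  proof -
    have "Om w u \<phi> \<cdot> w = Om w w \<phi> \<cdot> u" by (rule torsion_free[OF that(2) small_l[OF that(1)]])
    then show ?thesis using that(2) by (simp add: Om_def M_def pairing_simps)
  qed
  have dX: "geometric_decay (1/2) (\<lambda>k. X k v)"
  proof -
    have "geometric_decay (1/4) (\<lambda>k. ?P w k v)" for w
      by (intro geometric_decay_sum geometric_decay_linear[OF bounded_linear_smult_right]
        geometric_decay_linear[OF clinear_map_bounded[OF linB]] decay_S4 v l_in_Lambda) auto
    then have P: "geometric_decay (1/2) (\<lambda>k. ?P w k v)" for w
      by (rule geometric_decay_mono[rotated 2]) auto
    have "geometric_decay (1/2) (\<lambda>k. ?P u k v \<cdot> v + - (?P v k v \<cdot> u))"
      by (intro geometric_decay_add geometric_decay_linear[OF bounded_linear_minus]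
         geometric_decay_linear[OF bounded_linear_pairing_left] P bounded_linear_pairing_left)
    then show ?thesis by (simp add: X_def)
  qed
  obtain K where K: "K \<ge> 0" "\<And>k. norm (X k v) \<le> K * (1/2) ^ k" using geometric_decayE[OF dX] by auto
  have "X k v = 0"
  proof (rule fuchsian_series_unique[of "\<lambda>k. X k v" K "\<lambda>k. X k v" 0])
    fix s :: real assume s: "0 < s" "s < 1"
    let ?w = "s *\<^sub>R v"
    have w: "norm ?w < r"
    proof -
      have "s * norm v \<le> 1 * norm v" using s by (intro mult_right_mono) auto
      then show ?thesis using v s by simp
    qed
    have hw: "h \<cdot> ?w \<noteq> 0" using hv s by (simp add: pairing_simps)
    have "(\<lambda>k. X k ?w) sums 0" using sums[OF w] zero[OF w hw] by simp
    from bounded_linear.sums[OF bounded_linear_scaleR_right this, of "1 / s"]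
    have "(\<lambda>k. s ^ k *\<^sub>R X k v) sums 0" using s unfolding hom by simp
    then show "norm (\<Sum>m. s ^ m *\<^sub>R X m v) \<le> 0 * s * norm (\<Sum>m. s ^ m *\<^sub>R X m v)"
      using sums_unique by force
  qed (use K in auto)
  then show ?thesis by (simp add: X_def)
qed

section \<open>Primitives of the flat forms\<close>

lemma has_derivative_\<Phi>:
  assumes "norm v < r" shows "(\<Phi> \<beta> has_derivative D\<Phi> \<beta> v) (at v)"
proof -
  have "(\<Phi> \<beta> has_derivative (\<lambda>u. \<Sum>m. DS \<beta> m v u 0)) (at v)"
  proof (rule has_derivative_geometric_series[where S = "ball 0 r" and f = "\<lambda>m v. S \<beta> m v 0"
        and K = "8 * C * norm \<beta>" and q = "1/4"])
    show "v \<in> ball 0 r" using assms by simp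
    show "norm (DS \<beta> m w u 0) \<le> 8 * C * norm \<beta> * norm u * (1/4) ^ m" if "w \<in> ball 0 r" for m w u
      using that by (intro DS_bound small zero_in_Lambda) simp
    show "(\<lambda>m. S \<beta> m w 0) sums \<Phi> \<beta> w" if "w \<in> ball 0 r" for w
      using sums_S[of w 0 \<beta>] that by (simp add: pairing_simps zero_in_Lambda)
  qed (auto intro: has_derivative_S)
  then show ?thesis by (simp add: D\<Phi>_def[abs_def])
qed

text \<open>
  A primitive of \<open>h\<^sup>-\<^sup>c \<Phi>\<close>, multiplied by \<open>h\<^sup>c\<close>. On a ray \<open>h\<^sup>-\<^sup>c\<close> is a constant times \<open>s\<^sup>-\<^sup>c\<close>, so integrating the part of
  degree \<open>m\<close> of \<open>\<Phi>\<close> against \<open>v\<close> divides it by \<open>m + 1 - c\<close>.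
\<close>

definition \<theta> where "\<theta> \<beta> v = (\<Sum>m. 1 / (of_nat (Suc m) - c) * (S \<beta> m v 0 \<cdot> v))"
definition D\<theta> where "D\<theta> \<beta> v u = (\<Sum>m. 1 / (of_nat (Suc m) - c) * (S \<beta> m v 0 \<cdot> u + DS \<beta> m v u 0 \<cdot> v))"

lemma geometric_decay_mult_bounded:
  fixes f :: "nat \<Rightarrow> complex"
  assumes "\<And>m. cmod (k m) \<le> K" "geometric_decay q f" "q \<ge> 0"
  shows "geometric_decay q (\<lambda>m. k m * f m)"
proof -
  obtain L where L: "L \<ge> 0" "\<And>m. norm (f m) \<le> L * q ^ m" using geometric_decayE[OF assms(2,3)] by blast
  have "norm (k m * f m) \<le> (K * L) * q ^ m" for m
    using mult_mono[OF assms(1) L(2), of m m] order_trans[OF norm_ge_zero assms(1)]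
    by (simp add: norm_mult mult_ac)
  then show ?thesis by (rule geometric_decayI)
qed

lemma reciprocal_bound: obtains K where "K > 0" "\<And>m. cmod (1 / (of_nat (Suc m) - c)) \<le> K"
  by (rule reciprocal_shift_bounded[of c]) (rule that)

lemma sums_\<theta>:
  assumes v: "norm v < r"
  shows "(\<lambda>m. 1 / (of_nat (Suc m) - c) * (S \<beta> m v 0 \<cdot> v)) sums \<theta> \<beta> v"
proof -
  obtain K where K: "K > 0" "\<And>m. cmod (1 / (of_nat (Suc m) - c)) \<le> K" using reciprocal_bound by blast
  have "geometric_decay (1/4) (\<lambda>m. 1 / (of_nat (Suc m) - c) * (S \<beta> m v 0 \<cdot> v))"
    by (rule geometric_decay_mult_bounded[OF K(2) geometric_decay_linear[OF bounded_linear_pairing_left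
          decay_S4[OF v zero_in_Lambda]]]) auto
  then show ?thesis unfolding \<theta>_def
    by (intro summable_sums geometric_decay_summable[of "1/4"]) auto
qed

lemma sums_D\<theta>:
  assumes v: "norm v < r"
  shows "(\<lambda>m. 1 / (of_nat (Suc m) - c) * (S \<beta> m v 0 \<cdot> u + DS \<beta> m v u 0 \<cdot> v)) sums D\<theta> \<beta> v u"
proof -
  obtain K where K: "K > 0" "\<And>m. cmod (1 / (of_nat (Suc m) - c)) \<le> K" using reciprocal_bound by blast
  have "geometric_decay (1/4) (\<lambda>m. 1 / (of_nat (Suc m) - c) * (S \<beta> m v 0 \<cdot> u + DS \<beta> m v u 0 \<cdot> v))"
    by (rule geometric_decay_mult_bounded[OF K(2)], intro geometric_decay_add
        geometric_decay_linear[OF bounded_linear_pairing_left] decay_S4 decay_DS v zero_in_Lambda) auto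
  then show ?thesis unfolding D\<theta>_def
    by (intro summable_sums geometric_decay_summable[of "1/4"]) auto
qed

lemma has_derivative_\<theta>:
  assumes "norm v < r" shows "(\<theta> \<beta> has_derivative D\<theta> \<beta> v) (at v)"
proof -
  obtain K where K: "K > 0" "\<And>m. cmod (1 / (of_nat (Suc m) - c)) \<le> K" using reciprocal_bound by blast
  have "(\<theta> \<beta> has_derivative (\<lambda>u. \<Sum>m. 1 / (of_nat (Suc m) - c) * (S \<beta> m v 0 \<cdot> u + DS \<beta> m v u 0 \<cdot> v))) (at v)"
  proof (rule has_derivative_geometric_series[where S = "ball 0 r"
        and f = "\<lambda>m v. 1 / (of_nat (Suc m) - c) * (S \<beta> m v 0 \<cdot> v)" and K = "K * (2 * norm \<beta>)" and q = "1/4"])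
    show "v \<in> ball 0 r" using assms by simp
    show "cmod (1 / (of_nat (Suc m) - c) * (S \<beta> m w 0 \<cdot> u + DS \<beta> m w u 0 \<cdot> w))
        \<le> K * (2 * norm \<beta>) * norm u * (1/4) ^ m" if "w \<in> ball 0 r" for m w u
    proof -
      have w: "norm w < r" using that by simp
      have "cmod (S \<beta> m w 0 \<cdot> u) \<le> norm (S \<beta> m w 0) * norm u" by (rule norm_pairing_le)
      also have "\<dots> \<le> (norm \<beta> * (1/4) ^ m) * norm u"
      proof (rule mult_right_mono)
        have "norm (S \<beta> m w 0) \<le> norm \<beta> * (1/8) ^ m" by (rule S_bound[OF small[OF w] zero_in_Lambda])
        also have "\<dots> \<le> norm \<beta> * (1/4) ^ m" by (intro mult_left_mono power_mono) auto
        finally show "norm (S \<beta> m w 0) \<le> norm \<beta> * (1/4) ^ m" .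
      qed simp
      finally have 1: "cmod (S \<beta> m w 0 \<cdot> u) \<le> norm \<beta> * norm u * (1/4) ^ m" by (simp add: mult_ac)
      have "cmod (DS \<beta> m w u 0 \<cdot> w) \<le> norm (DS \<beta> m w u 0) * norm w" by (rule norm_pairing_le)
      also have "\<dots> \<le> (8 * C * norm \<beta> * norm u * (1/4) ^ m) * norm w"
        by (intro mult_right_mono DS_bound small w zero_in_Lambda) auto
      also have "\<dots> = (8 * (C * norm w)) * (norm \<beta> * norm u * (1/4) ^ m)" by (simp add: mult_ac)
      also have "\<dots> \<le> 1 * (norm \<beta> * norm u * (1/4) ^ m)"
        using small[OF w] by (intro mult_right_mono) auto
      finally have "cmod (S \<beta> m w 0 \<cdot> u + DS \<beta> m w u 0 \<cdot> w) \<le> 2 * (norm \<beta> * norm u * (1/4) ^ m)"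
        using 1 norm_triangle_ineq[of "S \<beta> m w 0 \<cdot> u" "DS \<beta> m w u 0 \<cdot> w"] by linarith
      then have "cmod (1 / (of_nat (Suc m) - c)) * cmod (S \<beta> m w 0 \<cdot> u + DS \<beta> m w u 0 \<cdot> w)
          \<le> K * (2 * (norm \<beta> * norm u * (1/4) ^ m))"
        using K(1) by (intro mult_mono K(2)) auto
      then show ?thesis unfolding norm_mult by (simp only: mult_ac)
    qed
    show "((\<lambda>v. 1 / (of_nat (Suc m) - c) * (S \<beta> m v 0 \<cdot> v)) has_derivative
      (\<lambda>u. 1 / (of_nat (Suc m) - c) * (S \<beta> m w 0 \<cdot> u + DS \<beta> m w u 0 \<cdot> w))) (at w)" for m w
      by (intro has_derivative_mult_right has_derivative_pairing has_derivative_S has_derivative_ident)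
    show "(\<lambda>m. 1 / (of_nat (Suc m) - c) * (S \<beta> m w 0 \<cdot> w)) sums \<theta> \<beta> w" if "w \<in> ball 0 r" for w
      using that by (intro sums_\<theta>) simp
  qed auto
  then show ?thesis by (simp add: D\<theta>_def[abs_def])
qed

lemma D\<theta>_smult:
  assumes "norm v < r" shows "D\<theta> \<beta> v (k *s u) = k * D\<theta> \<beta> v u"
proof -
  have "1 / (of_nat (Suc m) - c) * (S \<beta> m v 0 \<cdot> (k *s u) + DS \<beta> m v (k *s u) 0 \<cdot> v)
     = k * (1 / (of_nat (Suc m) - c) * (S \<beta> m v 0 \<cdot> u + DS \<beta> m v u 0 \<cdot> v))" for m
    by (simp add: DS_linear(2) pairing_simps algebra_simps)
  then show ?thesis
    using sums_unique2[OF sums_D\<theta>[OF assms, of \<beta> "k *s u"] ] sums_mult[OF sums_D\<theta>[OF assms, of \<beta> u], of k]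
    by (simp only:)
qed

text \<open>
  Closedness of \<open>h\<^sup>-\<^sup>c \<Phi>\<close> in each degree: pair \<open>defect_eq_0\<close> with \<open>v\<close>, exchange \<open>u\<close> and \<open>v\<close> in the regular part by
  \<open>torsion_termwise\<close>, and replace the result by the recursion.
\<close>

lemma \<theta>_termwise:
  assumes v: "norm v < r" and hv: "h \<cdot> v \<noteq> 0" and ker: "R \<beta> = 0"
  shows "(h \<cdot> v) * (S \<beta> m v 0 \<cdot> u + DS \<beta> m v u 0 \<cdot> v)
    = c * (h \<cdot> u) * (S \<beta> m v 0 \<cdot> v) + (of_nat (Suc m) - c) * ((h \<cdot> v) * (S \<beta> m v 0 \<cdot> u))"
proof (cases m)
  case 0
  have k: "R \<beta> \<cdot> w = 0" for w using ker by (simp add: pairing_simps)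
  have "c * (\<beta> \<cdot> w) = (\<beta> \<cdot> n) * (h \<cdot> w)" for w using k[of w] by (simp add: R_def pairing_simps)
  then have "c * (h \<cdot> u) * (\<beta> \<cdot> v) = c * (\<beta> \<cdot> u) * (h \<cdot> v)"
    by (metis mult.assoc mult.commute)
  then show ?thesis using 0 by (auto simp: pairing_simps algebra_simps)
next
  case (Suc k)
  let ?s = "S \<beta> m v 0" and ?P = "\<lambda>w. \<Sum>j\<in>I. (l j \<cdot> w) *s B j (S \<beta> k v (l j))"
  have "defect \<beta> v u m \<cdot> v = 0" using defect_eq_0[OF v hv ker] by (simp add: pairing_simps)
  then have 1: "(h \<cdot> v) * (DS \<beta> m v u 0 \<cdot> v) + (h \<cdot> u) * (R ?s \<cdot> v) + (h \<cdot> v) * (?P u \<cdot> v) = 0"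
    unfolding defect_def Suc nat.case(2) by (simp only: pairing_simps)
  have "?P v = - (of_nat m *s ?s + R ?s)"
    using recursion[of m \<beta> v] unfolding Suc nat.case(2) by simp
  then have 2: "?P u \<cdot> v = - (of_nat m * (?s \<cdot> u) + R ?s \<cdot> u)"
    unfolding torsion_termwise[OF v hv] by (simp only: pairing_simps)
  have R: "R ?s \<cdot> w = (?s \<cdot> n) * (h \<cdot> w) - c * (?s \<cdot> w)" for w by (simp only: R_def pairing_simps)
  have m: "of_nat (Suc m) = of_nat m + (1::complex)" by simp
  show ?thesis using 1 unfolding 2 R m by algebra
qed

lemma D\<theta>_eq:
  assumes v: "norm v < r" and hv: "h \<cdot> v \<noteq> 0" and ker: "R \<beta> = 0"
  shows "D\<theta> \<beta> v u = c * (h \<cdot> u / (h \<cdot> v)) * \<theta> \<beta> v + \<Phi> \<beta> v \<cdot> u"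
proof -
  have t: "(h \<cdot> v) * (1 / (of_nat (Suc m) - c) * (S \<beta> m v 0 \<cdot> u + DS \<beta> m v u 0 \<cdot> v))
    = c * (h \<cdot> u) * (1 / (of_nat (Suc m) - c) * (S \<beta> m v 0 \<cdot> v)) + (h \<cdot> v) * (S \<beta> m v 0 \<cdot> u)" for m
  proof -
    let ?p = "of_nat (Suc m) - c"
    have p: "?p \<noteq> 0" using nonres(1)[of "Suc m"] by simp
    have "(h \<cdot> v) * (1 / ?p * (S \<beta> m v 0 \<cdot> u + DS \<beta> m v u 0 \<cdot> v))
      = 1 / ?p * ((h \<cdot> v) * (S \<beta> m v 0 \<cdot> u + DS \<beta> m v u 0 \<cdot> v))" by (simp only: mult_ac)
    also have "\<dots> = 1 / ?p * (c * (h \<cdot> u) * (S \<beta> m v 0 \<cdot> v)) + (1 / ?p * ?p) * ((h \<cdot> v) * (S \<beta> m v 0 \<cdot> u))"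
      unfolding \<theta>_termwise[OF assms] by (simp only: distrib_left mult_ac)
    finally show ?thesis using p by (simp only: mult_ac) simp
  qed
  have ph: "(\<lambda>m. S \<beta> m v 0 \<cdot> u) sums (\<Phi> \<beta> v \<cdot> u)"
    using bounded_linear.sums[OF bounded_linear_pairing_left sums_S[OF v zero_in_Lambda]]
    by (simp add: pairing_simps)
  have "(h \<cdot> v) * D\<theta> \<beta> v u = c * (h \<cdot> u) * \<theta> \<beta> v + (h \<cdot> v) * (\<Phi> \<beta> v \<cdot> u)"
    using sums_unique2[OF sums_mult[OF sums_D\<theta>[OF v, of \<beta> u], of "h \<cdot> v", unfolded t]
        sums_add[OF sums_mult[OF sums_\<theta>[OF v, of \<beta>], of "c * (h \<cdot> u)"] sums_mult[OF ph, of "h \<cdot> v"]]] .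
  then show ?thesis using hv by (simp add: field_simps)
qed

lemma S_at_0: "S \<beta> (Suc m) 0 \<eta> = 0"
  using fun_cong[OF S_homogeneous[of \<beta> "Suc m" 0 0], of \<eta>] by (simp del: S.simps)

lemma values_at_0:
  shows "\<Phi> \<beta> 0 = \<beta>" "\<theta> \<beta> 0 = 0" "D\<theta> \<beta> 0 u = (\<beta> \<cdot> u) / (1 - c)"
proof -
  have r: "norm (0 :: complex^'n) < r" using r_pos by simp
  have s0: "S \<beta> m 0 0 = (if m = 0 then \<beta> else 0)" for m by (cases m) (simp_all add: S_at_0 del: S.simps(2))
  show "\<theta> \<beta> 0 = 0" by (simp add: \<theta>_def pairing_simps)
  show "\<Phi> \<beta> 0 = \<beta>"
    unfolding \<Phi>_def s0 using sums_unique[OF sums_single[of 0 "\<lambda>_. \<beta>"]] by simp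
  have "D\<theta> \<beta> 0 u = (\<Sum>m. if m = 0 then (\<beta> \<cdot> u) / (1 - c) else 0)"
    unfolding D\<theta>_def by (rule suminf_cong) (simp add: s0 pairing_simps)
  also have "\<dots> = (\<beta> \<cdot> u) / (1 - c)"
    using sums_unique[OF sums_single[of 0 "\<lambda>_. (\<beta> \<cdot> u) / (1 - c)"]] by simp
  finally show "D\<theta> \<beta> 0 u = (\<beta> \<cdot> u) / (1 - c)" .
qed

text \<open>
  The assumption says that \<open>\<beta>\<close> is an eigenvector of the residue with eigenvalue \<open>c\<close>, which is what the equation of
  degree \<open>0\<close> demands of the value at the centre.
\<close>

lemma flat_form_exists:
  assumes ker: "(\<beta> \<cdot> n) *s h = c *s \<beta>"
  obtains \<Phi> D\<Phi> \<theta> D\<theta> where "\<Phi> 0 = \<beta>" "\<theta> 0 = 0" "\<And>u. D\<theta> 0 u = (\<beta> \<cdot> u) / (1 - c)"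
    "\<And>v. norm v < r \<Longrightarrow> (\<Phi> has_derivative D\<Phi> v) (at v)"
    "\<And>v u. norm v < r \<Longrightarrow> h \<cdot> v \<noteq> 0 \<Longrightarrow> D\<Phi> v u = (c * (h \<cdot> u / (h \<cdot> v))) *s \<Phi> v - Om v u (\<Phi> v)"
    "\<And>v. norm v < r \<Longrightarrow> (\<theta> has_derivative D\<theta> v) (at v)"
    "\<And>v k u. norm v < r \<Longrightarrow> D\<theta> v (k *s u) = k * D\<theta> v u"
    "\<And>v u. norm v < r \<Longrightarrow> h \<cdot> v \<noteq> 0 \<Longrightarrow> D\<theta> v u = c * (h \<cdot> u / (h \<cdot> v)) * \<theta> v + \<Phi> v \<cdot> u"
proof (rule that[of "\<Phi> \<beta>" "\<theta> \<beta>" "D\<theta> \<beta>" "D\<Phi> \<beta>"])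
  have ker': "R \<beta> = 0" using ker by (simp add: R_def)
  show "D\<Phi> \<beta> v u = (c * (h \<cdot> u / (h \<cdot> v))) *s \<Phi> \<beta> v - Om v u (\<Phi> \<beta> v)"
    if "norm v < r" "h \<cdot> v \<noteq> 0" for v u
    unfolding D\<Phi>_eq[OF that ker'] R_def Om_def M_def
    by (simp add: vector_ssub_ldistrib mult.commute)
qed (use ker in \<open>simp_all add: values_at_0 has_derivative_\<Phi> has_derivative_\<theta> D\<theta>_smult D\<theta>_eq R_def\<close>)

end

section \<open>Holomorphic functions across a hyperplane\<close>

lemma circle_mean_value:
  assumes f: "f holomorphic_on cball 0 \<rho>" and "\<rho> > 0"
  shows "((\<lambda>t. f (of_real \<rho> * exp (2 * of_real pi * \<i> * of_real t))) has_integral f 0) {0..1}"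
proof -
  have "((\<lambda>u. f u / (u - 0)) has_contour_integral (2 * of_real pi * \<i> * f 0)) (circlepath 0 \<rho>)"
    using Cauchy_integral_circlepath_simple[OF f, of 0] \<open>\<rho> > 0\<close> by simp
  then have "((\<lambda>t. f (circlepath 0 \<rho> t) / circlepath 0 \<rho> t
      * vector_derivative (circlepath 0 \<rho>) (at t within {0..1})) has_integral (2 * of_real pi * \<i> * f 0)) {0..1}"
    unfolding has_contour_integral_def by simp
  then have "((\<lambda>t. (2 * of_real pi * \<i>) * f (of_real \<rho> * exp (2 * of_real pi * \<i> * of_real t)))
      has_integral (2 * of_real pi * \<i> * f 0)) {0..1}"
  proof (rule has_integral_eq[rotated])
    fix t :: real assume "t \<in> {0..1}"
    then have "vector_derivative (circlepath 0 \<rho>) (at t within {0..1}) = 2 * of_real pi * \<i> * circlepath 0 \<rho> t"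
      by (simp add: vector_derivative_circlepath01) (simp add: circlepath)
    moreover have "circlepath 0 \<rho> t = of_real \<rho> * exp (2 * of_real pi * \<i> * of_real t)"
      by (simp add: circlepath)
    ultimately show "f (circlepath 0 \<rho> t) / circlepath 0 \<rho> t * vector_derivative (circlepath 0 \<rho>) (at t within {0..1})
        = (2 * of_real pi * \<i>) * f (of_real \<rho> * exp (2 * of_real pi * \<i> * of_real t))"
      using \<open>\<rho> > 0\<close> by simp
  qed
  from has_integral_mult_right[OF this, of "1 / (2 * of_real pi * \<i>)"] show ?thesis by simp
qed

lemma open_line_section: "open {\<zeta>. norm (v + \<zeta> *s (\<nu> :: complex^'n)) < r}"
  by (intro open_Collect_less continuous_intros)

lemma has_field_derivative_on_line:
  fixes \<theta> :: "complex^'n \<Rightarrow> complex"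
  assumes der: "\<And>v. norm v < r \<Longrightarrow> (\<theta> has_derivative D v) (at v)"
    and lin: "\<And>v k u. norm v < r \<Longrightarrow> D v (k *s u) = k * D v u"
    and v: "norm (v + \<zeta> *s \<nu>) < r"
  shows "((\<lambda>\<zeta>. \<theta> (v + \<zeta> *s \<nu>)) has_field_derivative D (v + \<zeta> *s \<nu>) \<nu>) (at \<zeta>)"
proof -
  have "((\<lambda>\<zeta>. v + \<zeta> *s \<nu>) has_derivative (\<lambda>k. k *s \<nu>)) (at \<zeta>)"
    by (auto intro!: derivative_eq_intros)
  from has_derivative_compose[OF this der[OF v]] show ?thesis
    by (simp add: has_field_derivative_def lin[OF v] mult.commute[of _ "D _ _"])
qed

lemma holomorphic_on_line:
  fixes \<theta> :: "complex^'n \<Rightarrow> complex"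
  assumes "\<And>v. norm v < r \<Longrightarrow> (\<theta> has_derivative D v) (at v)"
    and "\<And>v k u. norm v < r \<Longrightarrow> D v (k *s u) = k * D v u"
  shows "(\<lambda>\<zeta>. \<theta> (v + \<zeta> *s \<nu>)) holomorphic_on {\<zeta>. norm (v + \<zeta> *s \<nu>) < r}"
  using has_field_derivative_on_line[OF assms]
  by (subst holomorphic_on_open[OF open_line_section]) blast

text \<open>
  By the mean value property in the direction \<open>\<nu>\<close> transverse to the hyperplane, \<open>f v\<close> is the average of
  \<open>f\<close> over a circle in \<open>v + \<complex> \<nu>\<close>. If \<open>v\<close> is close enough to the hyperplane compared with the radius, the circle stays
  off the hyperplane, where \<open>f\<close> is continuously differentiable, and one differentiates under the
  integral.
\<close>

lemma C1_across_hyperplane: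
  fixes f :: "complex^'n \<Rightarrow> complex"
  assumes \<nu>: "h \<cdot> \<nu> = 1" and r: "r > 0"
    and der: "\<And>v. norm v < r \<Longrightarrow> h \<cdot> v \<noteq> 0 \<Longrightarrow> (f has_derivative (\<lambda>u. df v \<cdot> u)) (at v)"
    and cont: "continuous_on {v. norm v < r \<and> h \<cdot> v \<noteq> 0} df"
    and line: "\<And>v. norm v < r / 2 \<Longrightarrow> (\<lambda>\<zeta>. f (v + \<zeta> *s \<nu>)) holomorphic_on {\<zeta>. norm (v + \<zeta> *s \<nu>) < r}"
  obtains r' df' where "0 < r'" "r' \<le> r" "continuous_on (ball 0 r') df'"
    "\<And>v. norm v < r' \<Longrightarrow> (f has_derivative (\<lambda>u. df' v \<cdot> u)) (at v)"
proof -
  interpret pb: bounded_bilinear "\<lambda>a b :: complex^'n. a \<cdot> b" by (rule bounded_bilinear_pairing)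
  have "\<nu> \<noteq> 0" using \<nu> by (auto simp: pairing_simps)
  then have n0: "norm \<nu> > 0" by simp
  define \<rho> where "\<rho> = r / (4 * norm \<nu>)"
  have \<rho>: "\<rho> > 0" "\<rho> * norm \<nu> = r / 4" using r n0 by (auto simp: \<rho>_def)
  define r' where "r' = min (r / 2) (\<rho> / (norm h + 1))"
  have r': "r' > 0" "r' \<le> r / 2" using r \<rho> by (auto simp: r'_def add_nonneg_pos)
  have hv: "cmod (h \<cdot> v) < \<rho>" if "norm v < r'" for v
  proof -
    have "cmod (h \<cdot> v) \<le> norm h * norm v" by (rule norm_pairing_le)
    also have "\<dots> \<le> norm h * (\<rho> / (norm h + 1))" using that by (intro mult_left_mono) (auto simp: r'_def)
    also have "\<dots> < \<rho>"
      using \<rho>(1) pos_divide_less_eq[of "norm h + 1" "norm h * \<rho>" \<rho>]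
      by (simp add: add_nonneg_pos distrib_left mult.commute)
    finally show ?thesis .
  qed
  define p where "p v t = v + (of_real \<rho> * exp (2 * of_real pi * \<i> * of_real t)) *s \<nu>" for v :: "complex^'n" and t :: real
  have cm: "cmod (of_real \<rho> * exp (2 * of_real pi * \<i> * of_real t)) = \<rho>" for t
    using \<rho>(1) by (simp add: norm_mult)
  have pin: "norm (p v t) < r" "h \<cdot> p v t \<noteq> 0" if "norm v < r'" for v t
  proof -
    have "norm (p v t) \<le> norm v + \<rho> * norm \<nu>"
      unfolding p_def by (rule order_trans[OF norm_triangle_ineq]) (simp add: norm_smult cm)
    then show "norm (p v t) < r" using that r'(2) \<rho>(2) r by simp
    show "h \<cdot> p v t \<noteq> 0"
    proof
      assume "h \<cdot> p v t = 0"
      then have "h \<cdot> v = - (of_real \<rho> * exp (2 * of_real pi * \<i> * of_real t))"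
        using \<nu> by (simp add: p_def pairing_simps eq_neg_iff_add_eq_0)
      then have "cmod (h \<cdot> v) = \<rho>" using cm[of t] by simp
      then show False using hv[OF that] by simp
    qed
  qed
  have contp: "continuous_on (UNIV \<times> cbox 0 1) (\<lambda>(v, t). p v t)"
    unfolding p_def split_beta by (intro continuous_intros)
  have contdf: "continuous_on (ball 0 r' \<times> cbox 0 1) (\<lambda>(v, t). df (p v t))"
  proof -
    have "continuous_on (ball 0 r' \<times> cbox 0 1) (\<lambda>x. df (case x of (v, t) \<Rightarrow> p v t))"
      by (rule continuous_on_compose2[OF cont continuous_on_subset[OF contp]]) (use pin in auto)
    then show ?thesis by (simp add: split_beta)
  qed
  have mean: "((\<lambda>t. f (p v t)) has_integral f v) {0..1}" if "norm v < r'" for v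
  proof -
    have "(\<lambda>\<zeta>. f (v + \<zeta> *s \<nu>)) holomorphic_on cball 0 \<rho>"
    proof (rule holomorphic_on_subset[OF line])
      show "norm v < r / 2" using that r' by simp
      show "cball 0 \<rho> \<subseteq> {\<zeta>. norm (v + \<zeta> *s \<nu>) < r}"
      proof clarsimp
        fix \<zeta> assume "cmod \<zeta> \<le> \<rho>"
        then have "norm (v + \<zeta> *s \<nu>) \<le> norm v + \<rho> * norm \<nu>"
          by (intro order_trans[OF norm_triangle_ineq]) (simp add: norm_smult mult_right_mono)
        then show "norm (v + \<zeta> *s \<nu>) < r" using that r'(2) \<rho>(2) r by simp
      qed
    qed
    from circle_mean_value[OF this \<rho>(1)] show ?thesis by (simp add: p_def)
  qed
  define df' where "df' v = integral {0..1} (\<lambda>t. df (p v t))" for v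
  have intdf: "(\<lambda>t. df (p v t)) integrable_on {0..1}" if "norm v < r'" for v
  proof (rule integrable_continuous_real)
    have "continuous_on {0..1} ((\<lambda>(v, t). df (p v t)) \<circ> (\<lambda>t. (v, t)))"
      by (intro continuous_on_compose continuous_on_subset[OF contdf] continuous_intros) (use that in auto)
    then show "continuous_on {0..1} (\<lambda>t. df (p v t))" by (simp add: o_def)
  qed
  have cdf': "continuous_on (ball 0 r') df'"
    unfolding df'_def using integral_continuous_on_param[OF contdf] by simp
  have "(f has_derivative (\<lambda>u. df' v \<cdot> u)) (at v)" if v: "norm v < r'" for v
  proof -
    have fx: "((\<lambda>x. f (p x t)) has_derivative blinfun_apply (pb.prod_right (df (p x t)))) (at x within ball 0 r')"
      if "x \<in> ball 0 r'" for x t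
    proof -
      have "((\<lambda>x. p x t) has_derivative (\<lambda>u. u)) (at x)"
        unfolding p_def by (auto intro!: derivative_eq_intros)
      from has_derivative_compose[OF this der[OF pin]] that
      have "((\<lambda>x. f (p x t)) has_derivative (\<lambda>u. df (p x t) \<cdot> u)) (at x)" by simp
      then show ?thesis by (simp add: has_derivative_at_withinI)
    qed
    have "((\<lambda>x. integral (cbox 0 1) (\<lambda>t. f (p x t))) has_derivative
        integral (cbox 0 1) (\<lambda>t. pb.prod_right (df (p v t)))) (at v within ball 0 r')"
    proof (rule leibniz_rule[OF fx])
      show "(\<lambda>t. f (p x t)) integrable_on cbox 0 1" if "x \<in> ball 0 r'" for x
        using mean[of x] that by auto
      have "continuous_on (ball 0 r' \<times> cbox 0 1) (\<lambda>x. pb.prod_right ((\<lambda>(v, t). df (p v t)) x))"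
        by (rule bounded_linear.continuous_on[OF pb.bounded_linear_prod_right contdf])
      then show "continuous_on (ball 0 r' \<times> cbox 0 1) (\<lambda>(x, t). pb.prod_right (df (p x t)))"
        by (simp add: split_beta)
    qed (use v in auto)
    moreover have "blinfun_apply (integral (cbox 0 1) (\<lambda>t. pb.prod_right (df (p v t)))) = (\<lambda>u. df' v \<cdot> u)"
    proof -
      have "integral {0..1} (\<lambda>t. pb.prod_right (df (p v t))) = pb.prod_right (df' v)"
        using integral_linear[OF intdf[OF v] pb.bounded_linear_prod_right] by (simp add: df'_def o_def)
      then show ?thesis by (simp add: fun_eq_iff)
    qed
    ultimately have "((\<lambda>x. integral {0..1} (\<lambda>t. f (p x t))) has_derivative (\<lambda>u. df' v \<cdot> u)) (at v)"
      using v by (simp add: at_within_open[of v "ball 0 r'"])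
    then show ?thesis
      by (rule has_derivative_transform_within_open[of _ _ _ _ "ball 0 r'"])
        (use v mean integral_unique in auto)
  qed
  with that[OF r'(1) _ cdf'] r' r show ?thesis by simp
qed

text \<open>
  The equation for the derivative forces \<open>\<theta> = 0\<close> on the hyperplane because \<open>c \<noteq> 0\<close>: multiplied by \<open>h\<close>, it reads \<open>c \<theta> = 0\<close>
  there. On a transverse line the quotient by \<open>h\<close> then has a removable singularity, and
  \<open>C1_across_hyperplane\<close> gives regularity in all directions. On the hyperplane the value of the quotient is
  the transverse derivative of \<open>\<theta>\<close>.
\<close>

lemma divide_by_linear_form:
  fixes \<theta> :: "complex^'n \<Rightarrow> complex" and \<Phi> :: "complex^'n \<Rightarrow> complex^'n"
  assumes \<nu>: "h \<cdot> \<nu> = 1" and r: "r > 0" and "c \<noteq> 0"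
    and \<Phi>: "continuous_on (ball 0 r) \<Phi>"
    and der: "\<And>v. norm v < r \<Longrightarrow> (\<theta> has_derivative D v) (at v)"
    and lin: "\<And>v k u. norm v < r \<Longrightarrow> D v (k *s u) = k * D v u"
    and eq: "\<And>v u. norm v < r \<Longrightarrow> h \<cdot> v \<noteq> 0 \<Longrightarrow> D v u = c * (h \<cdot> u / (h \<cdot> v)) * \<theta> v + \<Phi> v \<cdot> u"
  obtains r' \<psi> d\<psi> where "0 < r'" "r' \<le> r" "continuous_on (ball 0 r') d\<psi>" "\<psi> 0 = D 0 \<nu>"
    "\<And>v. norm v < r' \<Longrightarrow> (\<psi> has_derivative (\<lambda>u. d\<psi> v \<cdot> u)) (at v)"
    "\<And>v. norm v < r \<Longrightarrow> h \<cdot> v \<noteq> 0 \<Longrightarrow> \<theta> v = (h \<cdot> v) * \<psi> v"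
proof -
  define \<Omega> where "\<Omega> v = {\<zeta>. norm (v + \<zeta> *s \<nu>) < r}" for v
  have op: "open (\<Omega> v)" for v unfolding \<Omega>_def by (rule open_line_section)
  have kder: "((\<lambda>\<zeta>. \<theta> (v + \<zeta> *s \<nu>)) has_field_derivative D (v + \<zeta> *s \<nu>) \<nu>) (at \<zeta>)" if "\<zeta> \<in> \<Omega> v" for v \<zeta>
    using that has_field_derivative_on_line[OF der lin] by (simp add: \<Omega>_def)
  have khol: "(\<lambda>\<zeta>. \<theta> (v + \<zeta> *s \<nu>)) holomorphic_on \<Omega> v" for v
    unfolding \<Omega>_def by (rule holomorphic_on_line[OF der lin])
  have zero: "\<theta> v = 0" if v: "norm v < r" "h \<cdot> v = 0" for v
  proof -
    let ?k = "\<lambda>\<zeta>. \<theta> (v + \<zeta> *s \<nu>)"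
    have 0: "0 \<in> \<Omega> v" using v by (simp add: \<Omega>_def)
    have ev: "\<forall>\<^sub>F \<zeta> in at 0. \<zeta> \<in> \<Omega> v \<and> \<zeta> \<noteq> 0"
      using eventually_at_in_open[OF op 0] by simp
    have "isCont (deriv ?k) 0"
      using holomorphic_deriv[OF khol op] op 0 continuous_on_eq_continuous_at holomorphic_on_imp_continuous_on by blast
    moreover have "isCont ?k 0"
      using khol op 0 continuous_on_eq_continuous_at holomorphic_on_imp_continuous_on by blast
    moreover have "isCont \<Phi> v" using \<Phi> v continuous_on_eq_continuous_at[of "ball 0 r" \<Phi>] by simp
    then have "((\<lambda>\<zeta>. \<Phi> (v + \<zeta> *s \<nu>)) \<longlongrightarrow> \<Phi> v) (at 0)"
    proof (rule isCont_tendsto_compose)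
      have "((\<lambda>\<zeta>. v + \<zeta> *s \<nu>) \<longlongrightarrow> v + 0 *s \<nu>) (at 0)" by (intro tendsto_intros)
      then show "((\<lambda>\<zeta>. v + \<zeta> *s \<nu>) \<longlongrightarrow> v) (at 0)" by simp
    qed
    ultimately have "((\<lambda>\<zeta>. \<zeta> * deriv ?k \<zeta> - c * ?k \<zeta> - \<zeta> * (\<Phi> (v + \<zeta> *s \<nu>) \<cdot> \<nu>)) \<longlongrightarrow>
        0 * deriv ?k 0 - c * ?k 0 - 0 * (\<Phi> v \<cdot> \<nu>)) (at 0)"
      unfolding isCont_def by (intro tendsto_intros)
    moreover have "((\<lambda>\<zeta>. \<zeta> * deriv ?k \<zeta> - c * ?k \<zeta> - \<zeta> * (\<Phi> (v + \<zeta> *s \<nu>) \<cdot> \<nu>)) \<longlongrightarrow> 0) (at 0)"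
    proof (rule tendsto_eventually, rule eventually_mono[OF ev], clarify)
      fix \<zeta> assume z: "\<zeta> \<in> \<Omega> v" "\<zeta> \<noteq> 0"
      have hz: "h \<cdot> (v + \<zeta> *s \<nu>) = \<zeta>" using v \<nu> by (simp add: pairing_simps)
      have "deriv ?k \<zeta> = D (v + \<zeta> *s \<nu>) \<nu>" by (rule DERIV_imp_deriv[OF kder[OF z(1)]])
      also have "\<dots> = c * (1 / \<zeta>) * \<theta> (v + \<zeta> *s \<nu>) + \<Phi> (v + \<zeta> *s \<nu>) \<cdot> \<nu>"
        using z hz \<nu> by (subst eq) (auto simp: \<Omega>_def)
      finally show "\<zeta> * deriv ?k \<zeta> - c * ?k \<zeta> - \<zeta> * (\<Phi> (v + \<zeta> *s \<nu>) \<cdot> \<nu>) = 0"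
        using z(2) by (simp add: field_simps)
    qed
    ultimately have "0 * deriv ?k 0 - c * ?k 0 - 0 * (\<Phi> v \<cdot> \<nu>) = 0"
      by (rule tendsto_unique[rotated]) simp
    then show ?thesis using \<open>c \<noteq> 0\<close> by simp
  qed
  define \<psi> where "\<psi> v = (if h \<cdot> v = 0 then D v \<nu> else \<theta> v / (h \<cdot> v))" for v
  define df where "df v = (1 / (h \<cdot> v)) *s \<Phi> v + ((c - 1) * \<theta> v / (h \<cdot> v)\<^sup>2) *s h" for v
  have c\<theta>: "continuous_on (ball 0 r) \<theta>"
    by (intro continuous_at_imp_continuous_on ballI has_derivative_continuous[OF der]) simp
  have line: "(\<lambda>\<zeta>. \<psi> (v + \<zeta> *s \<nu>)) holomorphic_on \<Omega> v" for v
  proof -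
    let ?k = "\<lambda>\<zeta>. \<theta> (v + \<zeta> *s \<nu>)" and ?z = "- (h \<cdot> v)"
    have hz: "h \<cdot> (v + \<zeta> *s \<nu>) = \<zeta> - ?z" for \<zeta> using \<nu> by (simp add: pairing_simps)
    show ?thesis
    proof (cases "?z \<in> \<Omega> v")
      case True
      have kz: "?k ?z = 0" by (rule zero) (use True hz[of ?z] in \<open>simp_all only: \<Omega>_def mem_Collect_eq diff_self\<close>)
      have "(\<lambda>\<zeta>. if \<zeta> = ?z then deriv ?k ?z else (?k \<zeta> - ?k ?z) / (\<zeta> - ?z)) holomorphic_on \<Omega> v"
        by (rule pole_lemma_open[OF khol op])
      then show ?thesis
      proof (rule holomorphic_transform)
        fix \<zeta>
        show "(if \<zeta> = ?z then deriv ?k ?z else (?k \<zeta> - ?k ?z) / (\<zeta> - ?z)) = \<psi> (v + \<zeta> *s \<nu>)"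
        proof (cases "\<zeta> = ?z")
          case True2: True
          show ?thesis using DERIV_imp_deriv[OF kder[OF True]] hz[of ?z] unfolding True2 \<psi>_def by simp
        next
          case False
          then have "h \<cdot> (v + \<zeta> *s \<nu>) \<noteq> 0" unfolding hz by (metis eq_iff_diff_eq_0)
          then show ?thesis using False kz hz[of \<zeta>] by (simp add: \<psi>_def)
        qed
      qed
    next
      case False
      have "(\<lambda>\<zeta>. ?k \<zeta> / (\<zeta> - ?z)) holomorphic_on \<Omega> v"
        using False by (intro holomorphic_intros khol) (metis eq_iff_diff_eq_0)
      then show ?thesis
      proof (rule holomorphic_transform)
        fix \<zeta> assume "\<zeta> \<in> \<Omega> v"
        then have "h \<cdot> (v + \<zeta> *s \<nu>) \<noteq> 0" using False unfolding hz by (metis eq_iff_diff_eq_0)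
        then show "?k \<zeta> / (\<zeta> - ?z) = \<psi> (v + \<zeta> *s \<nu>)" using hz[of \<zeta>] by (simp add: \<psi>_def)
      qed
    qed
  qed
  have d\<psi>: "(\<psi> has_derivative (\<lambda>u. df v \<cdot> u)) (at v)" if v: "norm v < r" "h \<cdot> v \<noteq> 0" for v
  proof -
    have "((\<lambda>v. \<theta> v / (h \<cdot> v)) has_derivative (\<lambda>u. - \<theta> v * (inverse (h \<cdot> v) * (h \<cdot> u) * inverse (h \<cdot> v)) + D v u / (h \<cdot> v))) (at v)"
      by (rule has_derivative_divide[OF der bounded_linear_imp_has_derivative[OF bounded_linear_pairing_right]])
        (use v in auto)
    also have "(\<lambda>u. - \<theta> v * (inverse (h \<cdot> v) * (h \<cdot> u) * inverse (h \<cdot> v)) + D v u / (h \<cdot> v)) = (\<lambda>u. df v \<cdot> u)"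
      using v by (simp add: fun_eq_iff df_def pairing_simps eq field_simps power2_eq_square)
    finally have *: "((\<lambda>v. \<theta> v / (h \<cdot> v)) has_derivative (\<lambda>u. df v \<cdot> u)) (at v)" .
    have "open {v. h \<cdot> v \<noteq> 0}"
      by (intro open_Collect_neq continuous_intros)
    then show ?thesis
      by (rule has_derivative_transform_within_open[OF *]) (use v in \<open>auto simp: \<psi>_def\<close>)
  qed
  have cdf: "continuous_on {v. norm v < r \<and> h \<cdot> v \<noteq> 0} df"
    unfolding df_def
    by (intro continuous_intros continuous_on_subset[OF \<Phi>] continuous_on_subset[OF c\<theta>]) auto
  obtain r' d\<psi>' where r': "0 < r'" "r' \<le> r" "continuous_on (ball 0 r') d\<psi>'"
    and der': "\<And>v. norm v < r' \<Longrightarrow> (\<psi> has_derivative (\<lambda>u. d\<psi>' v \<cdot> u)) (at v)"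
    using C1_across_hyperplane[OF \<nu> r d\<psi> cdf line[unfolded \<Omega>_def]] by blast
  show ?thesis
    by (rule that[OF r' _ der']) (simp_all add: \<psi>_def pairing_simps)
qed

section \<open>Hermitian forms\<close>

definition hermitian_form :: "(complex^'n \<Rightarrow> complex^'n \<Rightarrow> complex) \<Rightarrow> bool" where
  "hermitian_form b \<longleftrightarrow>
     (\<forall>v. Vector_Spaces.linear (*s) (*) (\<lambda>u. b u v)) \<and> (\<forall>u v. b v u = cnj (b u v))"

lemma hermitian_form_simps:
  assumes "hermitian_form b"
  shows "b (u + u') v = b u v + b u' v" "b (u - u') v = b u v - b u' v" "b (c *s u) v = c * b u v"
    "b (- u) v = - b u v" "b 0 v = 0" "b (\<Sum>i\<in>I. f i) v = (\<Sum>i\<in>I. b (f i) v)"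
    "b v (u + u') = b v u + b v u'" "b v (u - u') = b v u - b v u'" "b v (c *s u) = cnj c * b v u"
    "b v (- u) = - b v u" "b v 0 = 0" "b v (\<Sum>i\<in>I. f i) = (\<Sum>i\<in>I. b v (f i))"
proof -
  interpret L: Vector_Spaces.linear "(*s)" "(*)" "\<lambda>u. b u v" for v
    using assms unfolding hermitian_form_def by blast
  have sym: "b v u = cnj (b u v)" for u v using assms unfolding hermitian_form_def by blast
  show l: "b (u + u') v = b u v + b u' v" "b (u - u') v = b u v - b u' v" "b (c *s u) v = c * b u v"
    "b (- u) v = - b u v" "b 0 v = 0" "b (\<Sum>i\<in>I. f i) v = (\<Sum>i\<in>I. b (f i) v)" for v u u' c
    by (simp_all add: L.add L.diff L.scale L.neg L.sum)
  show "b v (u + u') = b v u + b v u'" "b v (u - u') = b v u - b v u'" "b v (c *s u) = cnj c * b v u"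
    "b v (- u) = - b v u" "b v 0 = 0" "b v (\<Sum>i\<in>I. f i) = (\<Sum>i\<in>I. b v (f i))"
    unfolding sym[of v "u + u'"] sym[of v "u - u'"] sym[of v "c *s u"] sym[of v "- u"] sym[of v 0]
      sym[of v "\<Sum>i\<in>I. f i"] l sym[of v u] sym[of v u'] sym[of v "f _"]
    by simp_all
qed

lemma hermitian_form_expand:
  assumes b: "hermitian_form b" and T: "clinear_map T"
  shows "b (T p) q = (\<Sum>i\<in>UNIV. \<Sum>j\<in>UNIV. p $ i * cnj (q $ j) * b (T (axis i 1)) (axis j 1))"
    and "b q (T p) = (\<Sum>i\<in>UNIV. \<Sum>j\<in>UNIV. q $ i * cnj (p $ j) * b (axis i 1) (T (axis j 1)))"
proof -
  note B = hermitian_form_simps[OF b]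
  have Tp: "T p = (\<Sum>i\<in>UNIV. p $ i *s T (axis i 1))"
  proof -
    interpret Vector_Spaces.linear "(*s)" "(*s)" T by fact
    have "T p = T (\<Sum>i\<in>UNIV. p $ i *s axis i 1)" by (simp add: basis_expansion)
    then show ?thesis by (simp only: sum scale)
  qed
  have q: "q = (\<Sum>i\<in>UNIV. q $ i *s axis i 1)" by (simp add: basis_expansion)
  show "b (T p) q = (\<Sum>i\<in>UNIV. \<Sum>j\<in>UNIV. p $ i * cnj (q $ j) * b (T (axis i 1)) (axis j 1))"
    by (subst q, subst Tp, simp only: B(6) B(3), simp only: B(12) B(9))
      (simp add: sum_distrib_left mult_ac)
  show "b q (T p) = (\<Sum>i\<in>UNIV. \<Sum>j\<in>UNIV. q $ i * cnj (p $ j) * b (axis i 1) (T (axis j 1)))"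
    by (subst q, subst Tp, simp only: B(6) B(3), simp only: B(12) B(9))
      (simp add: sum_distrib_left mult_ac)
qed

lemma hermitian_form_self_real:
  assumes "hermitian_form b" shows "b u u = of_real (Re (b u u))"
proof -
  have "b u u = cnj (b u u)" using assms unfolding hermitian_form_def by blast
  then show ?thesis by (simp add: complex_eq_iff)
qed

text \<open>
  Completing the square: after subtracting \<open>\<bar>b p e\<bar>\<^sup>2 / b e e\<close> for one basis vector \<open>e\<close>, the form no longer sees \<open>e\<close>, and it
  remains positive on the span of the others because its value at \<open>u\<close> is the value of \<open>b\<close> at the
  component of \<open>u\<close> orthogonal to \<open>e\<close>. The supports make the induction over the index set possible on a
  fixed coordinate space.
\<close>

lemma hermitian_form_sum_of_squares:
  fixes b :: "complex^'n \<Rightarrow> complex^'n \<Rightarrow> complex"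
  assumes "finite I" "hermitian_form b"
    and "\<And>u :: complex^'n. (\<And>j. j \<notin> I \<Longrightarrow> u $ j = 0) \<Longrightarrow> u \<noteq> 0 \<Longrightarrow> 0 < Re (b u u)"
  shows "\<exists>L :: 'n \<Rightarrow> complex^'n. \<forall>p q :: complex^'n. (\<forall>j. j \<notin> I \<longrightarrow> p $ j = 0) \<longrightarrow> (\<forall>j. j \<notin> I \<longrightarrow> q $ j = 0) \<longrightarrow>
           b p q = (\<Sum>i\<in>I. (L i \<cdot> p) * cnj (L i \<cdot> q))"
  using assms
proof (induction I arbitrary: b rule: finite_induct)
  case empty
  have "b p q = 0" if "\<forall>j. p $ j = 0" for p q :: "complex^'n"
  proof -
    have "p = 0" using that by (simp add: vec_eq_iff)
    then show ?thesis by (simp add: hermitian_form_simps[OF empty.prems(1)])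
  qed
  then show ?case by simp
next
  case (insert i I b)
  note B = hermitian_form_simps[OF insert.prems(1)]
  have sym: "b v u = cnj (b u v)" for u v
    using insert.prems(1) unfolding hermitian_form_def by blast
  define e where "e = (axis i 1 :: complex^'n)"
  have ej: "e $ j = (if j = i then 1 else 0)" for j by (simp add: e_def axis_def)
  have "e \<noteq> 0" by (simp add: e_def)
  then have pos: "0 < Re (b e e)" by (intro insert.prems(2)) (auto simp: ej)
  define d where "d = Re (b e e)"
  have d: "d > 0" "b e e = of_real d"
    using pos hermitian_form_self_real[OF insert.prems(1)] by (simp_all add: d_def)
  define l where "l = (\<chi> j. b (axis j 1) e)"
  have l: "b p e = l \<cdot> p" for p
    by (subst basis_expansion[of p, symmetric]) (simp add: B scalar_product_def l_def mult.commute)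
  define b' where "b' p q = b p q - b p e * cnj (b q e) / of_real d" for p q
  have b': "hermitian_form b'"
    unfolding hermitian_form_def
  proof (intro conjI allI)
    show "Vector_Spaces.linear (*s) (*) (\<lambda>u. b' u v)" for v
      by unfold_locales (simp_all add: b'_def B algebra_simps add_divide_distrib)
    show "b' v u = cnj (b' u v)" for u v
      unfolding b'_def by (subst sym) simp
  qed
  note B' = hermitian_form_simps[OF b']
  have b'e: "b' e q = 0" "b' q e = 0" for q
    unfolding b'_def sym[of q e] using d by simp_all
  have pos': "0 < Re (b' u u)" if supp: "\<And>j. j \<notin> I \<Longrightarrow> u $ j = 0" and "u \<noteq> 0" for u :: "complex^'n"
  proof -
    define t where "t = b u e / of_real d"
    define z where "z = u - t *s e"
    have "z \<noteq> 0"
    proof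
      assume "z = 0"
      then have ue: "u = t *s e" by (simp add: z_def)
      have "u $ i = 0" using supp insert.hyps by blast
      then have "t = 0" using ue ej by simp
      then show False using ue \<open>u \<noteq> 0\<close> by simp
    qed
    then have "0 < Re (b z z)"
      by (intro insert.prems(2)) (auto simp: z_def ej supp)
    also have "b z z = b' z z"
      by (simp add: b'_def) (simp add: z_def B d t_def)
    also have "b' z z = b' u u" by (simp add: z_def B' b'e)
    finally show ?thesis .
  qed
  from insert.IH[OF b' pos'] obtain L :: "'n \<Rightarrow> complex^'n" where L:
    "\<forall>p q :: complex^'n. (\<forall>j. j \<notin> I \<longrightarrow> p $ j = 0) \<longrightarrow> (\<forall>j. j \<notin> I \<longrightarrow> q $ j = 0) \<longrightarrow>
           b' p q = (\<Sum>i\<in>I. (L i \<cdot> p) * cnj (L i \<cdot> q))" by (rule exE)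
  define L' where "L' j = (if j = i then (1 / of_real (sqrt d)) *s l else L j - (L j $ i) *s axis i 1)" for j
  have proj: "(L j - (L j $ i) *s axis i 1) \<cdot> p = L j \<cdot> (p - (p $ i) *s e)" for j and p :: "complex^'n"
  proof -
    have "a \<cdot> axis i 1 = a $ i" "axis i 1 \<cdot> a = a $ i" for a :: "complex^'n"
      by (simp_all add: scalar_product_def axis_def if_distrib if_distribR cong: if_cong)
    then show ?thesis by (simp add: pairing_simps e_def)
  qed
  show ?case
  proof (intro exI[of _ L'] allI impI)
    fix p q :: "complex^'n" assume p: "\<forall>j. j \<notin> insert i I \<longrightarrow> p $ j = 0" and q: "\<forall>j. j \<notin> insert i I \<longrightarrow> q $ j = 0"
    have "b' p q = b' (p - (p $ i) *s e) (q - (q $ i) *s e)" by (simp add: B' b'e)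
    also have "\<dots> = (\<Sum>j\<in>I. (L j \<cdot> (p - (p $ i) *s e)) * cnj (L j \<cdot> (q - (q $ i) *s e)))"
      by (rule L[rule_format]) (use p q ej in auto)
    also have "\<dots> = (\<Sum>j\<in>I. (L' j \<cdot> p) * cnj (L' j \<cdot> q))"
      using insert.hyps by (intro sum.cong) (auto simp: L'_def proj)
    finally have *: "b' p q = (\<Sum>j\<in>I. (L' j \<cdot> p) * cnj (L' j \<cdot> q))" .
    have "of_real (sqrt d) * of_real (sqrt d) = (of_real d :: complex)"
      using d by (simp flip: of_real_mult)
    then have "(L' i \<cdot> p) * cnj (L' i \<cdot> q) = b p e * cnj (b q e) / of_real d"
      by (simp add: L'_def pairing_simps l)
    then show "b p q = (\<Sum>j\<in>insert i I. (L' j \<cdot> p) * cnj (L' j \<cdot> q))"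
      using * insert.hyps by (simp add: b'_def diff_eq_eq add.commute)
  qed
qed

section \<open>Parallel metrics in a twisted flat coframe\<close>

text \<open>
  Two points off a hyperplane lie on a complex line that meets the hyperplane in at most one point, and
  a convex open subset of that line minus a point is connected.
\<close>

lemma constant_off_hyperplane:
  fixes f :: "complex^'n \<Rightarrow> complex"
  assumes f: "\<And>v. norm v < r \<Longrightarrow> h \<cdot> v \<noteq> 0 \<Longrightarrow> (f has_derivative (\<lambda>_. 0)) (at v)"
    and a: "norm a < r" "h \<cdot> a \<noteq> 0" and b: "norm b < r" "h \<cdot> b \<noteq> 0"
  shows "f a = f b"
proof -
  define p where "p \<zeta> = a + \<zeta> *s (b - a)" for \<zeta>
  define T where "T = {\<zeta>. h \<cdot> p \<zeta> = 0}"
  let ?S = "p -` ball 0 r"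
  have cp: "continuous_on A p" for A unfolding p_def by (intro continuous_intros)
  have op: "open ?S" using cp[of UNIV] by (intro open_vimage) auto
  have "convex ?S"
  proof (rule convexI)
    fix x y u v assume xy: "x \<in> ?S" "y \<in> ?S" and uv: "0 \<le> u" "0 \<le> v" "u + v = (1::real)"
    have "p (u *\<^sub>R x + v *\<^sub>R y) = u *\<^sub>R p x + v *\<^sub>R p y"
    proof -
      have "u *\<^sub>R p x + v *\<^sub>R p y = (u + v) *\<^sub>R a + (u *\<^sub>R x + v *\<^sub>R y) *s (b - a)"
        by (simp add: p_def scaleR_add_right scaleR_add_left scaleR_smult vector_sadd_rdistrib
            scaleR_conv_of_real[where 'a = complex])
      then show ?thesis using uv by (simp add: p_def)
    qed
    then show "u *\<^sub>R x + v *\<^sub>R y \<in> ?S"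
      using convexD[OF convex_ball[of "0::complex^'n" r], of "p x" "p y" u v] xy uv by simp
  qed
  have lin: "h \<cdot> p \<zeta> = h \<cdot> a + \<zeta> * (h \<cdot> b - h \<cdot> a)" for \<zeta>
    by (simp add: p_def pairing_simps algebra_simps)
  have "T \<subseteq> {- (h \<cdot> a) / (h \<cdot> b - h \<cdot> a)}"
  proof
    fix \<zeta> assume "\<zeta> \<in> T"
    then have z: "\<zeta> * (h \<cdot> b - h \<cdot> a) = - (h \<cdot> a)" by (simp add: T_def lin add_eq_0_iff)
    then have "h \<cdot> b - h \<cdot> a \<noteq> 0" using a(2) by auto
    then show "\<zeta> \<in> {- (h \<cdot> a) / (h \<cdot> b - h \<cdot> a)}" using z by (simp add: field_simps)
  qed
  then have fin: "finite T" using finite_subset by blast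
  have conn: "connected (?S - T)"
    using \<open>convex ?S\<close> op fin by (intro connected_open_diff_countable convex_connected countable_finite) auto
  have "(f \<circ> p) 0 = (f \<circ> p) 1"
  proof (rule has_derivative_zero_unique_connected[where f = "f \<circ> p" and x = 0 and y = 1, OF _ conn])
    show "open (?S - T)" using op fin by (intro open_Diff finite_imp_closed)
    show "0 \<in> ?S - T" "1 \<in> ?S - T" using a b by (auto simp: T_def p_def)
    fix \<zeta> assume z: "\<zeta> \<in> ?S - T"
    have "(p has_derivative (\<lambda>k. k *s (b - a))) (at \<zeta>)"
      unfolding p_def by (auto intro!: derivative_eq_intros)
    from has_derivative_compose[OF this f] z
    show "((f \<circ> p) has_derivative (\<lambda>_. 0)) (at \<zeta>)" by (auto simp: T_def o_def)
  qed
  then show ?thesis by (simp add: p_def)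
qed

lemma has_derivative_exp_line:
  fixes c :: complex and t :: real
  shows "((\<lambda>t. exp (c * of_real t)) has_derivative (\<lambda>s. of_real s * (c * exp (c * of_real t)))) (at t)"
proof -
  have 1: "((\<lambda>z. exp (c * z)) has_derivative (\<lambda>z. c * exp (c * of_real t) * z)) (at (of_real t))"
    unfolding has_field_derivative_def[symmetric] by (auto intro!: derivative_eq_intros)
  have 2: "(complex_of_real has_derivative of_real) (at t)"
    by (rule bounded_linear_imp_has_derivative[OF bounded_linear_of_real])
  show ?thesis using has_derivative_compose[OF 2 1] by (simp only: mult.commute)
qed

text \<open>
  \<open>gg\<close> is parallel for the connection \<open>d - Om\<close> on vectors, the forms \<open>w i\<close> with \<open>i \<noteq> k\<close> are flat for the dual connection,
  and \<open>h\<^sup>-\<^sup>a w k\<close> is flat.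
\<close>

locale parallel_metric_coframe =
  fixes h \<nu> :: "complex^'n" and r a :: real and k :: 'n
    and gg :: "complex^'n \<Rightarrow> complex^'n \<Rightarrow> complex^'n \<Rightarrow> complex"
    and Om :: "complex^'n \<Rightarrow> complex^'n \<Rightarrow> complex^'n \<Rightarrow> complex^'n"
    and w :: "'n \<Rightarrow> complex^'n \<Rightarrow> complex^'n" and Dw :: "'n \<Rightarrow> complex^'n \<Rightarrow> complex^'n \<Rightarrow> complex^'n"
  assumes \<nu>: "h \<cdot> \<nu> = 1" and r: "r > 0" and a: "a \<notin> \<int>"
    and herm: "\<And>v. norm v < r \<Longrightarrow> h \<cdot> v \<noteq> 0 \<Longrightarrow> hermitian_form (gg v)"
    and gpos: "\<And>v u. norm v < r \<Longrightarrow> h \<cdot> v \<noteq> 0 \<Longrightarrow> u \<noteq> 0 \<Longrightarrow> 0 < Re (gg v u u)"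
    and Om: "\<And>v X. clinear_map (Om v X)"
    and gder: "\<And>v u u'. norm v < r \<Longrightarrow> h \<cdot> v \<noteq> 0 \<Longrightarrow>
      ((\<lambda>v. gg v u u') has_derivative (\<lambda>X. - gg v (Om v X u) u' - gg v u (Om v X u'))) (at v)"
    and wder: "\<And>i v. norm v < r \<Longrightarrow> h \<cdot> v \<noteq> 0 \<Longrightarrow> (w i has_derivative Dw i v) (at v)"
    and weq: "\<And>i v X u. norm v < r \<Longrightarrow> h \<cdot> v \<noteq> 0 \<Longrightarrow>
      Dw i v X \<cdot> u = (if i = k then of_real a * (h \<cdot> X / (h \<cdot> v)) * (w k v \<cdot> u) else 0) - w i v \<cdot> Om v X u"
    and indep: "\<And>v u. norm v < r \<Longrightarrow> h \<cdot> v \<noteq> 0 \<Longrightarrow> (\<And>i. w i v \<cdot> u = 0) \<Longrightarrow> u = 0"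
begin

lemma open_domain: "open {v. norm v < r \<and> h \<cdot> v \<noteq> 0}"
  by (intro open_Collect_conj open_Collect_less open_Collect_neq continuous_intros)

text \<open>
  \<open>d(g(p, q)) = g(\<nabla>p, q) + g(p, \<nabla>q)\<close> for arbitrary fields, from the case of constant fields.
\<close>

lemma metric_product_rule:
  assumes v: "norm v < r" "h \<cdot> v \<noteq> 0"
    and p: "(p has_derivative p') (at v)" and q: "(q has_derivative q') (at v)"
  shows "((\<lambda>v. gg v (p v) (q v)) has_derivative
    (\<lambda>X. gg v (p' X - Om v X (p v)) (q v) + gg v (p v) (q' X - Om v X (q v)))) (at v)"
proof -
  note B = hermitian_form_simps[OF herm[OF v]]
  have cid: "clinear_map (\<lambda>x. x)" by (rule clinear_mapI) auto
  let ?c = "\<lambda>v i j. p v $ i * cnj (q v $ j)"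
  let ?c' = "\<lambda>X i j. p v $ i * cnj (q' X $ j) + p' X $ i * cnj (q v $ j)"
  let ?g' = "\<lambda>X i j. - gg v (Om v X (axis i 1)) (axis j 1) - gg v (axis i 1) (Om v X (axis j 1))"
  have "((\<lambda>v. \<Sum>i\<in>UNIV. \<Sum>j\<in>UNIV. ?c v i j * gg v (axis i 1) (axis j 1)) has_derivative
     (\<lambda>X. \<Sum>i\<in>UNIV. \<Sum>j\<in>UNIV. ?c v i j * ?g' X i j + ?c' X i j * gg v (axis i 1) (axis j 1))) (at v)"
    by (intro has_derivative_sum has_derivative_mult gder v
        bounded_linear.has_derivative[OF bounded_linear_vec_nth]
        bounded_linear.has_derivative[OF bounded_linear_cnj] p q)
  also have "(\<lambda>X. \<Sum>i\<in>UNIV. \<Sum>j\<in>UNIV. ?c v i j * ?g' X i j + ?c' X i j * gg v (axis i 1) (axis j 1))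
    = (\<lambda>X. gg v (p' X - Om v X (p v)) (q v) + gg v (p v) (q' X - Om v X (q v)))"
  proof
    fix X
    note ex = hermitian_form_expand[OF herm[OF v] Om[of v X]] hermitian_form_expand(1)[OF herm[OF v] cid]
    have "(\<Sum>i\<in>UNIV. \<Sum>j\<in>UNIV. ?c v i j * ?g' X i j + ?c' X i j * gg v (axis i 1) (axis j 1))
      = (\<Sum>i\<in>UNIV. \<Sum>j\<in>UNIV. p v $ i * cnj (q' X $ j) * gg v (axis i 1) (axis j 1))
      + (\<Sum>i\<in>UNIV. \<Sum>j\<in>UNIV. p' X $ i * cnj (q v $ j) * gg v (axis i 1) (axis j 1))
      - (\<Sum>i\<in>UNIV. \<Sum>j\<in>UNIV. p v $ i * cnj (q v $ j) * gg v (Om v X (axis i 1)) (axis j 1))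
      - (\<Sum>i\<in>UNIV. \<Sum>j\<in>UNIV. p v $ i * cnj (q v $ j) * gg v (axis i 1) (Om v X (axis j 1)))"
      by (simp add: algebra_simps sum.distrib sum_subtractf)
    also have "\<dots> = gg v (p v) (q' X) + gg v (p' X) (q v) - gg v (Om v X (p v)) (q v) - gg v (p v) (Om v X (q v))"
      unfolding ex(1)[of "p v" "q v"] ex(2)[of "p v" "q v"] ex(3)[of "p v" "q' X"] ex(3)[of "p' X" "q v"] ..
    also have "\<dots> = gg v (p' X - Om v X (p v)) (q v) + gg v (p v) (q' X - Om v X (q v))" by (simp add: B)
    finally show "(\<Sum>i\<in>UNIV. \<Sum>j\<in>UNIV. ?c v i j * ?g' X i j + ?c' X i j * gg v (axis i 1) (axis j 1))
      = gg v (p' X - Om v X (p v)) (q v) + gg v (p v) (q' X - Om v X (q v))" .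
  qed
  finally show ?thesis
  proof (rule has_derivative_transform_within_open[OF _ open_domain])
    show "(\<Sum>i\<in>UNIV. \<Sum>j\<in>UNIV. ?c x i j * gg x (axis i 1) (axis j 1)) = gg x (p x) (q x)"
      if "x \<in> {v. norm v < r \<and> h \<cdot> v \<noteq> 0}" for x
      using hermitian_form_expand(1)[OF herm cid, of x "p x" "q x"] that by simp
  qed (use v in auto)
qed

definition W where "W v = (\<chi> i. w i v)"
text \<open>
  The field with coordinates \<open>p\<close> in the coframe \<open>w\<close>. Cramer's rule is used as the definition because it shows
  differentiability.
\<close>

definition \<xi> where "\<xi> p v = (\<chi> m. det (\<chi> i j. if j = m then p $ i else W v $ i $ j) / det (W v))"

lemma W_mult: "(W v *v u) $ i = w i v \<cdot> u"
  by (simp add: W_def matrix_vector_mult_def scalar_product_def)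

lemma det_W:
  assumes v: "norm v < r" "h \<cdot> v \<noteq> 0" shows "det (W v) \<noteq> 0"
proof -
  have "inj ((*v) (W v))"
  proof (rule injI)
    fix x y assume "W v *v x = W v *v y"
    then have "w i v \<cdot> (x - y) = 0" for i by (simp add: pairing_simps W_mult[symmetric])
    then show "x = y" using indep[OF v, of "x - y"] by simp
  qed
  then show ?thesis
    by (simp add: invertible_det_nz[symmetric] invertible_left_inverse matrix_left_invertible_injective)
qed

lemma \<xi>_unique:
  assumes v: "norm v < r" "h \<cdot> v \<noteq> 0" shows "(\<forall>i. w i v \<cdot> u = p $ i) \<longleftrightarrow> u = \<xi> p v"
  using cramer[OF det_W[OF v], of u p] by (simp add: \<xi>_def vec_eq_iff[of "W v *v u"] W_mult)

lemma w_\<xi>: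
  assumes v: "norm v < r" "h \<cdot> v \<noteq> 0" shows "w i v \<cdot> \<xi> p v = p $ i"
  using \<xi>_unique[OF v] by blast

lemma \<xi>_differentiable:
  assumes v: "norm v < r" "h \<cdot> v \<noteq> 0" shows "\<exists>D. (\<xi> p has_derivative D) (at v)"
proof -
  have ent: "(\<lambda>v. W v $ i $ j) differentiable (at v)" for i j
    using bounded_linear.has_derivative[OF bounded_linear_vec_nth wder[OF v]]
    by (auto simp: W_def differentiable_def)
  have dd: "(\<lambda>v. det (M v)) differentiable (at v)"
    if M: "\<And>i j. (\<lambda>v. M v $ i $ j) differentiable (at v)" for M :: "complex^'n \<Rightarrow> complex^'n^'n"
  proof -
    have "(\<lambda>v. \<Prod>i\<in>UNIV. M v $ i $ s i) differentiable (at v)" for s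
      unfolding differentiable_def
      by (rule exI, rule has_derivative_prod) (rule frechet_derivative_works[THEN iffD1, OF M])
    then show ?thesis unfolding det_def
      by (intro differentiable_sum differentiable_mult differentiable_const ballI) auto
  qed
  have comp: "((\<lambda>v. \<Sum>m\<in>UNIV. f m v *s axis m 1) has_derivative (\<lambda>X. \<Sum>m\<in>UNIV. f m v *s 0 + f' m X *s axis m 1)) (at v)"
    if "\<And>m. (f m has_derivative f' m) (at v)" for f and f' :: "'n \<Rightarrow> complex^'n \<Rightarrow> complex"
    by (intro has_derivative_sum has_derivative_smult that has_derivative_const)
  define f where "f m v = det (\<chi> i j. if j = m then p $ i else W v $ i $ j) / det (W v)" for m v
  have "f m differentiable (at v)" for m
    unfolding f_def
  proof (intro differentiable_divide dd det_W v ent)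
    show "(\<lambda>v. (\<chi> i j. if j = m then p $ i else W v $ i $ j) $ i $ j) differentiable (at v)" for i j
      using ent by (cases "j = m") simp_all
  qed
  then have D: "(f m has_derivative frechet_derivative (f m) (at v)) (at v)" for m
    by (rule frechet_derivative_works[THEN iffD1])
  have "\<xi> p = (\<lambda>v. \<Sum>m\<in>UNIV. f m v *s axis m 1)"
    unfolding \<xi>_def f_def[symmetric] fun_eq_iff by (subst basis_expansion[symmetric]) simp
  then show ?thesis using comp[of f, OF D] by auto
qed

text \<open>
  The dual frame is flat up to the twist, by differentiating \<open>w i v \<cdot> \<xi> p v = p $ i\<close>.
\<close>

lemma \<xi>_covariant:
  assumes v: "norm v < r" "h \<cdot> v \<noteq> 0" and D: "(\<xi> p has_derivative D) (at v)"
  shows "D X - Om v X (\<xi> p v) = (- of_real a * (h \<cdot> X / (h \<cdot> v)) * p $ k) *s \<xi> (axis k 1) v"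
proof -
  let ?t = "- of_real a * (h \<cdot> X / (h \<cdot> v)) * p $ k"
  have "w i v \<cdot> (D X - Om v X (\<xi> p v) - ?t *s \<xi> (axis k 1) v) = 0" for i
  proof -
    have d1: "((\<lambda>v. w i v \<cdot> \<xi> p v) has_derivative (\<lambda>X. w i v \<cdot> D X + Dw i v X \<cdot> \<xi> p v)) (at v)"
      by (intro has_derivative_pairing wder v D)
    have d2: "((\<lambda>v. w i v \<cdot> \<xi> p v) has_derivative (\<lambda>X. 0)) (at v)"
      by (rule has_derivative_transform_within_open[OF has_derivative_const[of "p $ i"] open_domain])
        (use v w_\<xi> in auto)
    have "w i v \<cdot> D X + Dw i v X \<cdot> \<xi> p v = 0"
      by (rule fun_cong[OF has_derivative_unique[OF d1 d2]])
    then have "w i v \<cdot> D X + ((if i = k then of_real a * (h \<cdot> X / (h \<cdot> v)) * p $ k else 0)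
        - w i v \<cdot> Om v X (\<xi> p v)) = 0"
      by (simp only: weq[OF v] w_\<xi>[OF v])
    then have "w i v \<cdot> D X - w i v \<cdot> Om v X (\<xi> p v)
        = - (if i = k then of_real a * (h \<cdot> X / (h \<cdot> v)) * p $ k else 0)"
      by (simp add: algebra_simps eq_neg_iff_add_eq_0)
    then show ?thesis
      by (simp add: pairing_simps w_\<xi>[OF v] axis_def)
  qed
  then have "D X - Om v X (\<xi> p v) - ?t *s \<xi> (axis k 1) v = 0" by (rule indep[OF v])
  then show ?thesis by (simp only: right_minus_eq)
qed

definition G where "G p q v = gg v (\<xi> p v) (\<xi> q v)"

lemma has_derivative_G:
  assumes v: "norm v < r" "h \<cdot> v \<noteq> 0"
  shows "(G p q has_derivative (\<lambda>X. - of_real a * (h \<cdot> X / (h \<cdot> v)) * p $ k * G (axis k 1) q v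
     + cnj (- of_real a * (h \<cdot> X / (h \<cdot> v)) * q $ k) * G p (axis k 1) v)) (at v)"
proof -
  obtain P Q where P: "(\<xi> p has_derivative P) (at v)" and Q: "(\<xi> q has_derivative Q) (at v)"
    using \<xi>_differentiable[OF v] by meson
  show ?thesis
    using metric_product_rule[OF v P Q]
    unfolding \<xi>_covariant[OF v P] \<xi>_covariant[OF v Q] hermitian_form_simps(3,9)[OF herm[OF v]] G_def[abs_def] .
qed

lemma G_constant:
  assumes "p $ k = 0" "q $ k = 0" "norm v < r" "h \<cdot> v \<noteq> 0" "norm v' < r" "h \<cdot> v' \<noteq> 0"
  shows "G p q v = G p q v'"
  by (rule constant_off_hyperplane[OF _ assms(3-6)]) (use has_derivative_G[of _ p q] assms(1,2) in auto)

text \<open>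
  A loop around the hyperplane through a point of norm less than \<open>r'\<close> stays in the ball of radius \<open>r\<close>.
\<close>

definition r' where "r' = r / (1 + 2 * norm h * norm \<nu>)"

lemma r': "0 < r'" "r' \<le> r"
  using r by (auto simp: r'_def divide_le_eq add_pos_nonneg zero_less_divide_iff intro!: mult_left_le)

text \<open>
  On the loop \<open>\<gamma>\<close>, which turns the value of \<open>h\<close> once around \<open>0\<close>, the coefficient satisfies \<open>G' = \<i> a G\<close>, so it comes back
  multiplied by \<open>exp (2 \<pi> \<i> a) \<noteq> 1\<close>. Being single valued, it is \<open>0\<close>.
\<close>

lemma G_cross:
  assumes v: "norm v < r'" "h \<cdot> v \<noteq> 0" and p: "p $ k = 0"
  shows "G p (axis k 1) v = 0"
proof -
  define \<gamma> where "\<gamma> t = v + ((exp (\<i> * of_real t) - 1) * (h \<cdot> v)) *s \<nu>" for t :: real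
  have h\<gamma>: "h \<cdot> \<gamma> t = exp (\<i> * of_real t) * (h \<cdot> v)" for t
    using \<nu> by (simp add: \<gamma>_def pairing_simps algebra_simps)
  have dom: "norm (\<gamma> t) < r" "h \<cdot> \<gamma> t \<noteq> 0" for t
  proof -
    show "h \<cdot> \<gamma> t \<noteq> 0" using v by (simp add: h\<gamma>)
    have "cmod (exp (\<i> * of_real t) - 1) \<le> 2"
      using norm_triangle_ineq4[of "exp (\<i> * of_real t)" 1] by simp
    then have "cmod (exp (\<i> * of_real t) - 1) * cmod (h \<cdot> v) \<le> 2 * (norm h * norm v)"
      by (intro mult_mono norm_pairing_le) auto
    then have "norm (((exp (\<i> * of_real t) - 1) * (h \<cdot> v)) *s \<nu>) \<le> (2 * (norm h * norm v)) * norm \<nu>"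
      unfolding norm_smult norm_mult by (rule mult_right_mono) simp
    then have "norm (\<gamma> t) \<le> norm v + (2 * (norm h * norm v)) * norm \<nu>"
      unfolding \<gamma>_def using norm_triangle_mono by blast
    also have "\<dots> = norm v * (1 + 2 * norm h * norm \<nu>)" by (simp add: algebra_simps)
    also have "\<dots> < r" using v(1) by (simp add: r'_def pos_less_divide_eq add_pos_nonneg)
    finally show "norm (\<gamma> t) < r" .
  qed
  have d\<gamma>: "(\<gamma> has_derivative (\<lambda>s. (of_real s * (\<i> * exp (\<i> * of_real t) * (h \<cdot> v))) *s \<nu>)) (at t)" for t
  proof -
    have "(\<gamma> has_derivative (\<lambda>s. 0 + (((exp (\<i> * of_real t) - 1) * (h \<cdot> v)) *s 0
        + ((of_real s * (\<i> * exp (\<i> * of_real t)) - 0) * (h \<cdot> v)) *s \<nu>))) (at t)"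
      unfolding \<gamma>_def
      by (intro has_derivative_add has_derivative_const has_derivative_smult has_derivative_mult_left
          has_derivative_diff has_derivative_exp_line)
    then show ?thesis by (simp add: mult.assoc)
  qed
  let ?f = "\<lambda>t. G p (axis k 1) (\<gamma> t) * exp (- \<i> * of_real a * of_real t)"
  have "(?f has_derivative (\<lambda>s. 0)) (at t)" for t
  proof -
    have "((\<lambda>t. G p (axis k 1) (\<gamma> t)) has_derivative
      (\<lambda>s. of_real s * (\<i> * of_real a * G p (axis k 1) (\<gamma> t)))) (at t)"
      by (rule has_derivative_eq_rhs[OF has_derivative_compose[OF d\<gamma> has_derivative_G[OF dom]]])
        (use v \<nu> p in \<open>auto simp: fun_eq_iff pairing_simps h\<gamma> axis_def\<close>)
    moreover note has_derivative_exp_line[of "- \<i> * of_real a" t]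
    ultimately show ?thesis
      by (rule has_derivative_eq_rhs[OF has_derivative_mult]) (simp add: fun_eq_iff algebra_simps)
  qed
  then have "?f 0 = ?f (2 * pi)"
    by (intro has_derivative_zero_unique_connected[where f = ?f and s = UNIV]) auto
  moreover have "\<gamma> (2 * pi) = v" "\<gamma> 0 = v"
    by (simp_all add: \<gamma>_def exp_two_pi_i' mult.commute mult.left_commute)
  ultimately have eq: "G p (axis k 1) v = G p (axis k 1) v * exp (- \<i> * of_real a * of_real (2 * pi))" by simp
  have "exp (- \<i> * of_real a * of_real (2 * pi)) \<noteq> 1"
  proof
    assume "exp (- \<i> * of_real a * of_real (2 * pi)) = 1"
    then obtain m :: int where "- (a * (2 * pi)) = of_int (2 * m) * pi" by (auto simp: exp_eq_1)
    then have "pi * (a + of_int m) = 0" by (simp add: algebra_simps)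
    then have "a = of_int (- m)" by simp
    then show False using a Ints_of_int by metis
  qed
  then show ?thesis using eq by auto
qed

text \<open>
  The logarithmic derivative of the coefficient is \<open>- 2 a Re (dh/h)\<close>, that of \<open>\<bar>h\<bar>\<^bsup>-2a\<^esup>\<close>.
\<close>

lemma G_diagonal:
  assumes "norm v < r" "h \<cdot> v \<noteq> 0" "norm v' < r" "h \<cdot> v' \<noteq> 0"
  shows "of_real (cmod (h \<cdot> v) powr (2 * a)) * G (axis k 1) (axis k 1) v
       = of_real (cmod (h \<cdot> v') powr (2 * a)) * G (axis k 1) (axis k 1) v'"
proof (rule constant_off_hyperplane[OF _ assms])
  fix v assume v: "norm v < r" "h \<cdot> v \<noteq> 0"
  let ?w = "h \<cdot> v" and ?G = "G (axis k 1) (axis k 1)"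
  have "((\<lambda>v. cmod (h \<cdot> v)) has_derivative (\<lambda>X. inner (h \<cdot> X) (sgn ?w))) (at v)"
    by (rule has_derivative_compose[OF bounded_linear_imp_has_derivative[OF bounded_linear_pairing_right]
          has_derivative_norm[OF v(2)]])
  from has_derivative_powr[OF this has_derivative_const[of "2 * a"]]
  have "((\<lambda>v. cmod (h \<cdot> v) powr (2 * a)) has_derivative
     (\<lambda>X. cmod ?w powr (2 * a) * (inner (h \<cdot> X) (sgn ?w) * (2 * a) / cmod ?w))) (at v)"
    using v by simp
  also have "(\<lambda>X. cmod ?w powr (2 * a) * (inner (h \<cdot> X) (sgn ?w) * (2 * a) / cmod ?w))
     = (\<lambda>X. cmod ?w powr (2 * a) * (2 * a * Re (h \<cdot> X / ?w)))"
  proof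
    fix X
    have "inner z (sgn ?w) / cmod ?w = Re (z / ?w)" for z
    proof -
      have "inner z (sgn ?w) / cmod ?w = (Re z * Re ?w + Im z * Im ?w) / (cmod ?w)\<^sup>2"
        by (simp add: sgn_div_norm inner_complex_def power2_eq_square divide_inverse algebra_simps)
      then show ?thesis by (simp add: Re_divide cmod_power2)
    qed
    then show "cmod ?w powr (2 * a) * (inner (h \<cdot> X) (sgn ?w) * (2 * a) / cmod ?w)
      = cmod ?w powr (2 * a) * (2 * a * Re (h \<cdot> X / ?w))"
      by (metis mult.commute times_divide_eq_left)
  qed
  finally have 1: "((\<lambda>v. complex_of_real (cmod (h \<cdot> v) powr (2 * a))) has_derivative
     (\<lambda>X. of_real (cmod ?w powr (2 * a) * (2 * a * Re (h \<cdot> X / ?w))))) (at v)"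
    by (rule bounded_linear.has_derivative[OF bounded_linear_of_real])
  have 2: "(?G has_derivative (\<lambda>X. - of_real (2 * a * Re (h \<cdot> X / ?w)) * ?G v)) (at v)"
  proof (rule has_derivative_eq_rhs[OF has_derivative_G[OF v]], rule ext)
    fix X
    have "- of_real a * z + cnj (- of_real a * z) = - of_real (2 * a * Re z)" for z
      by (simp add: complex_eq_iff)
    from this[of "h \<cdot> X / ?w"]
    show "- of_real a * (h \<cdot> X / ?w) * axis k 1 $ k * G (axis k 1) (axis k 1) v
      + cnj (- of_real a * (h \<cdot> X / ?w) * axis k 1 $ k) * G (axis k 1) (axis k 1) v
      = - of_real (2 * a * Re (h \<cdot> X / ?w)) * ?G v"
      by (simp only: distrib_right[symmetric] axis_nth mult_1_right)
  qed
  show "((\<lambda>v. of_real (cmod (h \<cdot> v) powr (2 * a)) * ?G v) has_derivative (\<lambda>_. 0)) (at v)"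
    by (rule has_derivative_eq_rhs[OF has_derivative_mult[OF 1 2]]) (simp add: fun_eq_iff algebra_simps)
qed

text \<open>
  The constant block of the metric is diagonalised by \<open>hermitian_form_sum_of_squares\<close> at an arbitrary point off the
  hyperplane. The last clause says that the resulting linear forms are independent.
\<close>

lemma metric_normal_form:
  obtains L :: "'n \<Rightarrow> complex^'n" and \<kappa> where "\<kappa> > 0"
    "\<And>v u u'. norm v < r' \<Longrightarrow> h \<cdot> v \<noteq> 0 \<Longrightarrow> gg v u u' =
      (\<Sum>i\<in>UNIV - {k}. (\<Sum>j\<in>UNIV - {k}. L i $ j * (w j v \<cdot> u)) * cnj (\<Sum>j\<in>UNIV - {k}. L i $ j * (w j v \<cdot> u')))
      + of_real (\<kappa> * cmod (h \<cdot> v) powr (- 2 * a)) * ((w k v \<cdot> u) * cnj (w k v \<cdot> u'))"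
    "\<forall>p. p $ k = 0 \<longrightarrow> (\<forall>i. i \<noteq> k \<longrightarrow> (\<Sum>j\<in>UNIV - {k}. L i $ j * p $ j) = 0) \<longrightarrow> p = 0"
proof -
  define t where "t = r' / (2 * norm \<nu>)"
  define v0 where "v0 = of_real t *s \<nu>"
  have "\<nu> \<noteq> 0" using \<nu> by (auto simp: pairing_simps)
  then have v0: "norm v0 < r'" "h \<cdot> v0 \<noteq> 0"
    using r' \<nu> by (auto simp: v0_def t_def norm_smult pairing_simps norm_divide norm_mult)
  have v0r: "norm v0 < r" using v0 r' by simp
  note H0 = herm[OF v0r v0(2)]
  have \<xi>lin: "\<xi> (p + q) v = \<xi> p v + \<xi> q v" "\<xi> (c *s p) v = c *s \<xi> p v"
    if "norm v < r" "h \<cdot> v \<noteq> 0" for p q c v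
    using \<xi>_unique[OF that, of "\<xi> p v + \<xi> q v" "p + q"] \<xi>_unique[OF that, of "c *s \<xi> p v" "c *s p"]
    by (simp_all add: pairing_simps w_\<xi>[OF that])
  have hb: "hermitian_form (\<lambda>p q. G p q v0)"
    unfolding hermitian_form_def
  proof (intro conjI allI)
    show "Vector_Spaces.linear (*s) (*) (\<lambda>u. G u q v0)" for q
      by unfold_locales (simp_all add: G_def \<xi>lin[OF v0r v0(2)] hermitian_form_simps[OF H0] algebra_simps)
    show "G q p v0 = cnj (G p q v0)" for p q
      using H0 unfolding G_def hermitian_form_def by blast
  qed
  have \<xi>0: "p = 0" if "\<xi> p v0 = 0" for p
    using w_\<xi>[OF v0r v0(2), of _ p] that by (simp add: vec_eq_iff pairing_simps)
  have pos: "0 < Re (G p p v0)" if "p \<noteq> 0" for p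
    unfolding G_def using that \<xi>0 by (intro gpos v0r v0(2)) auto
  obtain L :: "'n \<Rightarrow> complex^'n" where L: "\<And>p q. p $ k = 0 \<Longrightarrow> q $ k = 0 \<Longrightarrow>
      G p q v0 = (\<Sum>i\<in>UNIV - {k}. (L i \<cdot> p) * cnj (L i \<cdot> q))"
    using hermitian_form_sum_of_squares[OF _ hb, of "UNIV - {k}"] pos by auto
  have sp: "L i \<cdot> p = (\<Sum>j\<in>UNIV - {k}. L i $ j * p $ j)" if "p $ k = 0" for i and p :: "complex^'n"
    unfolding scalar_product_def using that by (simp add: sum.remove[of UNIV k])
  define \<kappa> where "\<kappa> = cmod (h \<cdot> v0) powr (2 * a) * Re (G (axis k 1) (axis k 1) v0)"
  have ne: "axis k (1::complex) \<noteq> 0" by simp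
  have "\<kappa> > 0" unfolding \<kappa>_def using pos[OF ne] v0(2) by simp
  moreover have "gg v u u' =
      (\<Sum>i\<in>UNIV - {k}. (\<Sum>j\<in>UNIV - {k}. L i $ j * (w j v \<cdot> u)) * cnj (\<Sum>j\<in>UNIV - {k}. L i $ j * (w j v \<cdot> u')))
      + of_real (\<kappa> * cmod (h \<cdot> v) powr (- 2 * a)) * ((w k v \<cdot> u) * cnj (w k v \<cdot> u'))"
    if v: "norm v < r'" "h \<cdot> v \<noteq> 0" for v u u'
  proof -
    have vr: "norm v < r" using v r' by simp
    note H = hermitian_form_simps[OF herm[OF vr v(2)]]
    have sym: "gg v q p = cnj (gg v p q)" for p q
      using herm[OF vr v(2)] unfolding hermitian_form_def by blast
    define c where "c u = (\<chi> i. if i = k then 0 else w i v \<cdot> u)" for u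
    have ck: "c u $ k = 0" "j \<noteq> k \<Longrightarrow> c u $ j = w j v \<cdot> u" for u j by (simp_all add: c_def)
    have dec: "u = \<xi> (c u) v + (w k v \<cdot> u) *s \<xi> (axis k 1) v" for u
    proof -
      have "c u + (w k v \<cdot> u) *s axis k 1 = (\<chi> i. w i v \<cdot> u)"
        by (simp add: vec_eq_iff c_def axis_def)
      then have "u = \<xi> (c u + (w k v \<cdot> u) *s axis k 1) v"
        using \<xi>_unique[OF vr v(2), of u "\<chi> i. w i v \<cdot> u"] by simp
      then show ?thesis by (simp add: \<xi>lin[OF vr v(2)])
    qed
    have cr: "gg v (\<xi> (c u) v) (\<xi> (axis k 1) v) = 0" for u
      using G_cross[OF v ck(1)] by (simp add: G_def)
    then have cr': "gg v (\<xi> (axis k 1) v) (\<xi> (c u) v) = 0" for u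
      unfolding sym[of "\<xi> (axis k 1) v"] by simp
    have "gg v u u' = gg v (\<xi> (c u) v + (w k v \<cdot> u) *s \<xi> (axis k 1) v) (\<xi> (c u') v + (w k v \<cdot> u') *s \<xi> (axis k 1) v)"
      using dec by simp
    also have "\<dots> = G (c u) (c u') v + ((w k v \<cdot> u) * cnj (w k v \<cdot> u')) * G (axis k 1) (axis k 1) v"
      by (simp add: H cr cr' G_def)
    also have "G (c u) (c u') v = G (c u) (c u') v0"
      by (rule G_constant[OF ck(1) ck(1) vr v(2) v0r v0(2)])
    also have "G (axis k 1) (axis k 1) v = of_real (\<kappa> * cmod (h \<cdot> v) powr (- 2 * a))"
    proof -
      have "of_real (cmod (h \<cdot> v) powr (2 * a)) * G (axis k 1) (axis k 1) v = of_real \<kappa>"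
        using G_diagonal[OF vr v(2) v0r v0(2)] hermitian_form_self_real[OF hb, of "axis k 1"]
        by (simp add: \<kappa>_def)
      then show ?thesis using v(2) by (simp add: powr_minus divide_inverse[symmetric] field_simps)
    qed
    also have "G (c u) (c u') v0 = (\<Sum>i\<in>UNIV - {k}. (\<Sum>j\<in>UNIV - {k}. L i $ j * (w j v \<cdot> u)) * cnj (\<Sum>j\<in>UNIV - {k}. L i $ j * (w j v \<cdot> u')))"
    proof -
      have "(\<Sum>j\<in>UNIV - {k}. L i $ j * c u $ j) = (\<Sum>j\<in>UNIV - {k}. L i $ j * (w j v \<cdot> u))" for i u
        by (intro sum.cong) (auto simp: ck)
      then show ?thesis unfolding L[OF ck(1) ck(1)] sp[OF ck(1)] by simp
    qed
    finally show ?thesis by (simp only: mult.commute)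
  qed
  moreover have "\<forall>p. p $ k = 0 \<longrightarrow> (\<forall>i. i \<noteq> k \<longrightarrow> (\<Sum>j\<in>UNIV - {k}. L i $ j * p $ j) = 0) \<longrightarrow> p = 0"
  proof (intro allI impI, rule ccontr)
    fix p assume that: "p $ k = 0" "\<forall>i. i \<noteq> k \<longrightarrow> (\<Sum>j\<in>UNIV - {k}. L i $ j * p $ j) = 0" and "p \<noteq> 0"
    from \<open>p \<noteq> 0\<close> have "0 < Re (G p p v0)" by (rule pos)
    also have "G p p v0 = 0"
      unfolding L[OF that(1) that(1)] sp[OF that(1)] using that(2) by (intro sum.neutral) auto
    finally show False by simp
  qed
  ultimately show ?thesis by (rule that)
qed

end

section \<open>Adapted bases and charts\<close>

lemma pairing_axis: "a \<cdot> axis i 1 = a $ i" "axis i 1 \<cdot> a = a $ i"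
  by (simp_all add: scalar_product_def axis_def if_distrib if_distribR cong: if_cong)

lemma pairing_ext: "(\<And>w. a \<cdot> w = b \<cdot> w) \<Longrightarrow> a = b"
  by (metis pairing_axis(1) vec_eq_iff)

text \<open>
  Choose \<open>i0\<close> with \<open>n $ i0 \<noteq> 0\<close>. The forms \<open>u \<mapsto> u $ m - (n $ m / n $ i0) * u $ i0\<close> with \<open>m \<noteq> i0\<close> cut out the line of \<open>n\<close>, on which \<open>h\<close> is
  injective; they are numbered by the indices other than \<open>k\<close>.
\<close>

lemma adapted_basis:
  fixes h n :: "complex^'n"
  assumes "h \<cdot> n \<noteq> 0"
  obtains P :: "'n \<Rightarrow> complex^'n" where "P k = h" "\<And>i. i \<noteq> k \<Longrightarrow> P i \<cdot> n = 0"
    "\<And>u. (\<And>i. P i \<cdot> u = 0) \<Longrightarrow> u = 0"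
proof -
  have "n \<noteq> 0" using assms by (auto simp: pairing_simps)
  then obtain i0 where i0: "n $ i0 \<noteq> 0" by (auto simp: vec_eq_iff)
  define j where "j i = (if i = i0 then k else i)" for i
  define P where "P i = (if i = k then h else axis (j i) 1 - (n $ j i / n $ i0) *s axis i0 1)" for i
  have Pu: "P i \<cdot> u = u $ j i - n $ j i / n $ i0 * u $ i0" if "i \<noteq> k" for i and u :: "complex^'n"
    using that by (simp add: P_def pairing_simps pairing_axis)
  show ?thesis
  proof (rule that[of P])
    show "P k = h" by (simp add: P_def)
    show "P i \<cdot> n = 0" if "i \<noteq> k" for i using Pu[OF that, of n] i0 by simp
    fix u assume u: "\<And>i. P i \<cdot> u = 0"
    have um: "u $ m = u $ i0 / n $ i0 * n $ m" for m
    proof (cases "m = i0")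
      case False
      define i where "i = (if m = k then i0 else m)"
      have "i \<noteq> k" "j i = m" using False by (auto simp: i_def j_def)
      then show ?thesis using Pu[of i u] u[of i] by simp
    qed (use i0 in simp)
    define c where "c = u $ i0 / n $ i0"
    have un: "u = c *s n"
      unfolding vec_eq_iff vector_smult_component c_def by (intro allI um)
    have "h \<cdot> u = c * (h \<cdot> n)" unfolding un by (rule pairing_simps)
    then have "c = 0" using u[of k] assms by (simp add: P_def)
    then show "u = 0" using un by simp
  qed
qed

text \<open>
  Independence is the non-vanishing of a determinant.
\<close>

lemma independent_near:
  fixes w :: "'n \<Rightarrow> complex^'n \<Rightarrow> complex^'n"
  assumes cont: "\<And>i. isCont (w i) 0" and ind: "\<And>u. (\<And>i. w i 0 \<cdot> u = 0) \<Longrightarrow> u = 0"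
  obtains r where "r > 0" "\<And>v u. norm v < r \<Longrightarrow> (\<And>i. w i v \<cdot> u = 0) \<Longrightarrow> u = 0"
proof -
  define W where "W v = (\<chi> i. w i v)" for v
  have mult: "(W v *v u) $ i = w i v \<cdot> u" for v u i
    by (simp add: W_def matrix_vector_mult_def scalar_product_def)
  have inj: "inj ((*v) (W v)) \<longleftrightarrow> (\<forall>u. (\<forall>i. w i v \<cdot> u = 0) \<longrightarrow> u = 0)" for v
  proof -
    have "inj ((*v) (W v)) \<longleftrightarrow> (\<forall>u. W v *v u = 0 \<longrightarrow> u = 0)"
      using matrix_left_invertible_injective[of "W v"] matrix_left_invertible_ker[of "W v"] by simp
    then show ?thesis by (simp add: vec_eq_iff[of "W v *v _"] mult)
  qed
  have det: "det (W v) \<noteq> 0 \<longleftrightarrow> inj ((*v) (W v))" for v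
    by (simp add: invertible_det_nz[symmetric] invertible_left_inverse matrix_left_invertible_injective)
  have "((\<lambda>v. det (W v)) \<longlongrightarrow> det (W 0)) (at 0)"
    unfolding det_def W_def vec_lambda_beta
    by (intro tendsto_sum tendsto_mult tendsto_const tendsto_prod tendsto_vec_nth)
      (use cont in \<open>simp add: isCont_def\<close>)
  moreover have d0: "det (W 0) \<noteq> 0" using det inj ind by blast
  ultimately have "\<forall>\<^sub>F v in at 0. det (W v) \<noteq> 0" by (rule tendsto_imp_eventually_ne)
  then obtain r where r: "r > 0" "\<And>v. v \<noteq> 0 \<Longrightarrow> dist v 0 < r \<Longrightarrow> det (W v) \<noteq> 0"
    unfolding eventually_at by blast
  show ?thesis
  proof (rule that[OF r(1)])
    fix v u assume "norm v < r" "\<And>i. w i v \<cdot> u = 0"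
    then show "u = 0" using r(2)[of v] d0 det[of v] inj[of v] by (cases "v = 0") auto
  qed
qed

lemma clinear_map_rows: "clinear_map (\<lambda>u. \<chi> i. q i \<cdot> u)"
  by (rule clinear_mapI) (simp_all add: vec_eq_iff pairing_simps)

lemma holomorphic_inverse_function:
  fixes f :: "'n \<Rightarrow> complex^'n \<Rightarrow> complex" and q :: "'n \<Rightarrow> complex^'n \<Rightarrow> complex^'n"
  assumes R: "R > 0"
    and der: "\<And>i v. norm v < R \<Longrightarrow> (f i has_derivative (\<lambda>u. q i v \<cdot> u)) (at v)"
    and cont: "\<And>i. continuous_on (ball 0 R) (q i)"
    and ind: "\<And>u. (\<And>i. q i 0 \<cdot> u = 0) \<Longrightarrow> u = 0"
  obtains U V g where "open U" "U \<subseteq> ball 0 R" "0 \<in> U" "open V"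
    "homeomorphism U V (\<lambda>v. \<chi> i. f i v) g"
    "\<And>y. y \<in> V \<Longrightarrow> \<exists>D. (g has_derivative D) (at y) \<and> clinear_map D"
proof -
  let ?F = "\<lambda>v. \<chi> i. f i v"
  define M where "M v = (\<lambda>u. \<chi> i. q i v \<cdot> u)" for v
  have blM: "bounded_linear (M v)" for v
    unfolding M_def by (rule clinear_map_bounded[OF clinear_map_rows])
  define F' where "F' v = Blinfun (M v)" for v
  have F': "blinfun_apply (F' v) = M v" for v by (simp add: F'_def bounded_linear_Blinfun_apply blM)
  have vec: "((\<lambda>v. \<Sum>i\<in>UNIV. f i v *s axis i 1) has_derivative (\<lambda>u. \<Sum>i\<in>UNIV. f i v *s 0 + (q i v \<cdot> u) *s axis i 1)) (at v)"
    if "norm v < R" for v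
    by (intro has_derivative_sum has_derivative_smult der that has_derivative_const)
  have ax: "(\<Sum>i\<in>UNIV. c i *s axis i 1) = (\<chi> i. c i)" for c :: "'n \<Rightarrow> complex"
    using basis_expansion[of "\<chi> i. c i"] by simp
  have dF: "(?F has_derivative blinfun_apply (F' v)) (at v)" if "v \<in> ball 0 R" for v
    using vec[of v] that by (simp add: ax F' M_def)
  have cF: "continuous_on (ball 0 R) F'"
    by (rule continuous_on_blinfun_componentwise)
      (auto simp: F' M_def intro!: continuous_intros cont)
  obtain Mi where Mi: "Mi ** (\<chi> i. q i 0) = mat 1"
  proof -
    have "(\<chi> i. q i 0) *v u = M 0 u" for u
      by (simp add: M_def vec_eq_iff matrix_vector_mult_def scalar_product_def)
    moreover have "u = 0" if "M 0 u = 0" for u using that ind by (simp add: M_def vec_eq_iff)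
    ultimately show ?thesis using that matrix_left_invertible_ker[of "\<chi> i. q i 0"] by metis
  qed
  define invf where "invf = Blinfun (\<lambda>w. Mi *v w)"
  have blMi: "bounded_linear (\<lambda>w. Mi *v w)"
    by (rule clinear_map_bounded[OF clinear_mapI]) (simp_all add: matrix_vector_right_distrib vector_scalar_commute)
  have "invf o\<^sub>L F' 0 = id_blinfun"
  proof (rule blinfun_eqI)
    fix u
    have "M 0 u = (\<chi> i. q i 0) *v u"
      by (simp add: M_def vec_eq_iff matrix_vector_mult_def scalar_product_def)
    then show "blinfun_apply (invf o\<^sub>L F' 0) u = blinfun_apply id_blinfun u"
      by (simp add: invf_def F' bounded_linear_Blinfun_apply[OF blMi] matrix_vector_mul_assoc Mi)
  qed
  from inverse_function_theorem[OF open_ball dF cF _ this] R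
  obtain U V g g' where UV: "open U" "U \<subseteq> ball 0 R" "0 \<in> U" "open V" "homeomorphism U V ?F g"
    and g': "\<And>y. y \<in> V \<Longrightarrow> (g has_derivative (g' y)) (at y)"
      "\<And>y. y \<in> V \<Longrightarrow> g' y = inv (blinfun_apply (F' (g y)))"
      "\<And>y. y \<in> V \<Longrightarrow> bij (blinfun_apply (F' (g y)))"
    by (metis centre_in_ball)
  have "\<exists>D. (g has_derivative D) (at y) \<and> clinear_map D" if y: "y \<in> V" for y
  proof (intro exI conjI)
    show "(g has_derivative g' y) (at y)" by (rule g'(1)[OF y])
    have bij: "bij (M (g y))" and inv: "g' y = inv (M (g y))" using g'(2,3)[OF y] by (simp_all add: F')
    have lin: "clinear_map (M (g y))" unfolding M_def by (rule clinear_map_rows)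
    show "clinear_map (g' y)"
    proof (rule clinear_mapI)
      have Mg: "M (g y) (g' y w) = w" for w unfolding inv by (rule surj_f_inv_f[OF bij_is_surj[OF bij]])
      have injM: "M (g y) v = M (g y) w \<Longrightarrow> v = w" for v w using bij_is_inj[OF bij] by (simp add: inj_eq)
      show "g' y (v + w) = g' y v + g' y w" for v w
        by (rule injM) (simp only: clinear_map_simps(1)[OF lin] Mg)
      show "g' y (c *s v) = c *s g' y v" for c v
        by (rule injM) (simp only: clinear_map_simps(4)[OF lin] Mg)
    qed
  qed
  with UV show ?thesis by (rule that)
qed

section \<open>Germs of flat connections with one logarithmic pole\<close>

lemma pairing_matrix: "(\<beta> v* A) \<cdot> w = \<beta> \<cdot> (A *v w)" for A :: "complex^'n^'n"
  unfolding scalar_product_def vector_matrix_mult_def matrix_vector_mult_def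
  by (simp add: sum_distrib_left sum_distrib_right mult_ac) (rule sum.swap)

lemma finite_common_radius:
  fixes Q :: "'i::finite \<Rightarrow> real \<Rightarrow> bool"
  assumes "\<And>i. \<exists>r>0. Q i r" "\<And>i r s. Q i r \<Longrightarrow> 0 < s \<Longrightarrow> s \<le> r \<Longrightarrow> Q i s"
  obtains r where "r > 0" "\<And>i. Q i r"
proof -
  obtain \<rho> where \<rho>: "\<And>i. \<rho> i > 0" "\<And>i. Q i (\<rho> i)" using assms(1) by metis
  let ?r = "Min (range \<rho>)"
  have "?r > 0" using \<rho>(1) by (subst Min_gr_iff) auto
  moreover have "Q i ?r" for i by (rule assms(2)[OF \<rho>(2) \<open>?r > 0\<close>]) simp
  ultimately show ?thesis by (rule that)
qed

text \<open>
  The situation at a point of a hyperplane \<open>h = 0\<close> that lies on no other hyperplane: \<open>1 + l j\<close> is a multiple of the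
  equation of another hyperplane, and \<open>\<Omega> v X u\<close> is the connection form in the direction \<open>X\<close> applied to the
  vector \<open>u\<close>. \<open>Om\<close> below is its transpose.
\<close>

locale log_flat_germ =
  fixes I :: "'i set" and l :: "'i \<Rightarrow> complex^'n" and A :: "'i \<Rightarrow> complex^'n^'n"
    and h n \<nu> :: "complex^'n" and a :: real and k :: 'n
    and gg :: "complex^'n \<Rightarrow> complex^'n \<Rightarrow> complex^'n \<Rightarrow> complex"
    and \<Omega> :: "complex^'n \<Rightarrow> complex^'n \<Rightarrow> complex^'n \<Rightarrow> complex^'n" and dom :: "complex^'n \<Rightarrow> bool"
  assumes \<Omega>_def: "\<Omega> = (\<lambda>v X u. (h \<cdot> X / (h \<cdot> v)) *s ((h \<cdot> u) *s n) + (\<Sum>j\<in>I. (l j \<cdot> X / (1 + l j \<cdot> v)) *s (A j *v u)))"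
    and dom_def: "dom = (\<lambda>v. h \<cdot> v \<noteq> 0 \<and> (\<forall>j\<in>I. 1 + l j \<cdot> v \<noteq> 0))"
    and finI: "finite I" and \<nu>: "h \<cdot> \<nu> = 1" and hn: "h \<cdot> n = of_real a" and a: "a \<notin> \<int>" "a < 1"
    and flat: "\<And>v X Y u. dom v \<Longrightarrow> \<Omega> v X (\<Omega> v Y u) = \<Omega> v Y (\<Omega> v X u)"
    and torsion_free: "\<And>v X Y. dom v \<Longrightarrow> \<Omega> v X Y = \<Omega> v Y X"
    and herm: "\<And>v. dom v \<Longrightarrow> hermitian_form (gg v)"
    and gpos: "\<And>v u. dom v \<Longrightarrow> u \<noteq> 0 \<Longrightarrow> 0 < Re (gg v u u)"
    and gder: "\<And>v u u'. dom v \<Longrightarrow>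
      ((\<lambda>v. gg v u u') has_derivative (\<lambda>X. - gg v (\<Omega> v X u) u' - gg v u (\<Omega> v X u'))) (at v)"
begin

definition Om where "Om v u \<beta> = (h \<cdot> u / (h \<cdot> v)) *s ((\<beta> \<cdot> n) *s h) + (\<Sum>j\<in>I. (l j \<cdot> u / (1 + l j \<cdot> v)) *s (\<beta> v* A j))"

lemma Om_dual: "Om v u \<beta> \<cdot> w = \<beta> \<cdot> \<Omega> v u w"
  by (simp add: Om_def \<Omega>_def pairing_simps pairing_sum pairing_matrix)

lemma a_nonzero: "a \<noteq> 0" "of_nat m \<noteq> complex_of_real a" "of_nat m + complex_of_real a \<noteq> 0"
proof -
  show "a \<noteq> 0" using a(1) by auto
  have "real m \<noteq> a" using a(1) Ints_of_nat[of m] by auto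
  moreover have "real m \<noteq> - a"
  proof
    assume "real m = - a"
    then have "a = - real m" by simp
    then show False using a(1) by simp
  qed
  ultimately have "complex_of_real (real m) \<noteq> complex_of_real a" "complex_of_real (real m) \<noteq> complex_of_real (- a)"
    unfolding of_real_eq_iff by auto
  then show "of_nat m \<noteq> complex_of_real a" "of_nat m + complex_of_real a \<noteq> 0"
    by (simp_all add: eq_neg_iff_add_eq_0)
qed

lemma flat_fuchsian_germ:
  assumes "\<And>m::nat. m \<ge> 1 \<Longrightarrow> of_nat m \<noteq> c" "\<And>m::nat. m \<ge> 1 \<Longrightarrow> of_nat m - c + of_real a \<noteq> 0"
  shows "flat_fuchsian I l (\<lambda>j \<beta>. \<beta> v* A j) h n c Om"
proof (intro flat_fuchsian.intro fuchsian_recursion.intro flat_fuchsian_axioms.intro)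
  show "finite I" by (rule finI)
  show "clinear_map (\<lambda>\<beta>. \<beta> v* A j)" for j
    by (rule clinear_mapI) (simp_all add: vector_matrix_left_distrib scalar_vector_matrix_assoc)
  show "m \<ge> 1 \<Longrightarrow> of_nat m \<noteq> c" "m \<ge> 1 \<Longrightarrow> of_nat m - c + h \<cdot> n \<noteq> 0" for m
    using assms by (simp_all add: hn)
  show "Om = (\<lambda>v u \<beta>. (h \<cdot> u / (h \<cdot> v)) *s ((\<beta> \<cdot> n) *s h) + (\<Sum>j\<in>I. (l j \<cdot> u / (1 + l j \<cdot> v)) *s (\<beta> v* A j)))"
    by (simp add: fun_eq_iff Om_def)
  fix v u u' \<beta> assume "h \<cdot> v \<noteq> 0" "\<And>j. j \<in> I \<Longrightarrow> 1 + l j \<cdot> v \<noteq> 0"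
  then have d: "dom v" by (simp add: dom_def)
  show "Om v u (Om v u' \<beta>) = Om v u' (Om v u \<beta>)"
    by (rule pairing_ext) (simp only: Om_dual flat[OF d])
  show "Om v u \<beta> \<cdot> u' = Om v u' \<beta> \<cdot> u"
    by (simp only: Om_dual torsion_free[OF d])
qed

text \<open>
  \<open>h\<^sup>-\<^sup>c \<Phi>\<close> is a flat one-form with primitive \<open>h\<^sup>-\<^sup>c \<theta>\<close>, normalised by \<open>\<Phi> 0 = \<beta>\<close>.
\<close>

definition flat_form where
  "flat_form r c \<beta> \<Phi> D\<Phi> \<theta> D\<theta> \<longleftrightarrow> \<Phi> 0 = \<beta> \<and> \<theta> 0 = 0 \<and> (\<forall>u. D\<theta> 0 u = (\<beta> \<cdot> u) / (1 - c)) \<and>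
     (\<forall>v. norm v < r \<longrightarrow>
      (\<forall>j\<in>I. 1 + l j \<cdot> v \<noteq> 0) \<and>
      (\<Phi> has_derivative D\<Phi> v) (at v) \<and> (\<theta> has_derivative D\<theta> v) (at v) \<and>
      (\<forall>b u. D\<theta> v (b *s u) = b * D\<theta> v u) \<and>
      (h \<cdot> v \<noteq> 0 \<longrightarrow> (\<forall>u. D\<Phi> v u = (c * (h \<cdot> u / (h \<cdot> v))) *s \<Phi> v - Om v u (\<Phi> v) \<and>
          D\<theta> v u = c * (h \<cdot> u / (h \<cdot> v)) * \<theta> v + \<Phi> v \<cdot> u)))"

lemma flat_form_shrink:
  "flat_form r c \<beta> \<Phi> D\<Phi> \<theta> D\<theta> \<Longrightarrow> s \<le> r \<Longrightarrow> flat_form s c \<beta> \<Phi> D\<Phi> \<theta> D\<theta>"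
  unfolding flat_form_def by (meson less_le_trans)

text \<open>
  Since \<open>a\<close> is not an integer, there is no resonance for either of the exponents \<open>0\<close> and \<open>a\<close>.
\<close>

lemma flat_form_exists:
  assumes ker: "(\<beta> \<cdot> n) *s h = c *s \<beta>" and c: "c = 0 \<or> c = of_real a"
  shows "\<exists>r>0. \<exists>\<Phi> D\<Phi> \<theta> D\<theta>. flat_form r c \<beta> \<Phi> D\<Phi> \<theta> D\<theta>"
proof -
  interpret F: flat_fuchsian I l "\<lambda>j \<beta>. \<beta> v* A j" h n c Om
    by (rule flat_fuchsian_germ) (use c a_nonzero in auto)
  obtain \<Phi> D\<Phi> \<theta> D\<theta> where *: "\<Phi> 0 = \<beta>" "\<theta> 0 = 0" "\<And>u. D\<theta> 0 u = (\<beta> \<cdot> u) / (1 - c)"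
    "\<And>v. norm v < F.r \<Longrightarrow> (\<Phi> has_derivative D\<Phi> v) (at v)"
    "\<And>v u. norm v < F.r \<Longrightarrow> h \<cdot> v \<noteq> 0 \<Longrightarrow> D\<Phi> v u = (c * (h \<cdot> u / (h \<cdot> v))) *s \<Phi> v - Om v u (\<Phi> v)"
    "\<And>v. norm v < F.r \<Longrightarrow> (\<theta> has_derivative D\<theta> v) (at v)"
    "\<And>v b u. norm v < F.r \<Longrightarrow> D\<theta> v (b *s u) = b * D\<theta> v u"
    "\<And>v u. norm v < F.r \<Longrightarrow> h \<cdot> v \<noteq> 0 \<Longrightarrow> D\<theta> v u = c * (h \<cdot> u / (h \<cdot> v)) * \<theta> v + \<Phi> v \<cdot> u"
    by (rule F.flat_form_exists[OF ker]) (rule that)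
  have "flat_form F.r c \<beta> \<Phi> D\<Phi> \<theta> D\<theta>"
    unfolding flat_form_def by (intro conjI allI impI ballI * F.small_l)
  then show ?thesis using F.r_pos by blast
qed

lemma flat_coframe_exists:
  obtains r P \<Phi> D\<Phi> \<theta> D\<theta> where "r > 0" "P k = h" "\<And>u. (\<And>i. P i \<cdot> u = 0) \<Longrightarrow> u = 0"
    "\<And>i. flat_form r (if i = k then of_real a else 0) (P i) (\<Phi> i) (D\<Phi> i) (\<theta> i) (D\<theta> i)"
proof -
  have hn0: "h \<cdot> n \<noteq> 0" using a_nonzero by (simp add: hn)
  obtain P :: "'n \<Rightarrow> complex^'n" where P: "P k = h" "\<And>i. i \<noteq> k \<Longrightarrow> P i \<cdot> n = 0"
    "\<And>u. (\<And>i. P i \<cdot> u = 0) \<Longrightarrow> u = 0" using adapted_basis[where k = k, OF hn0] by blast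
  let ?c = "\<lambda>i. if i = k then complex_of_real a else 0"
  have ex: "\<exists>r>0. \<exists>\<Phi> D\<Phi> \<theta> D\<theta>. flat_form r (?c i) (P i) \<Phi> D\<Phi> \<theta> D\<theta>" for i
    by (rule flat_form_exists) (use P(1,2) in \<open>auto simp: hn\<close>)
  obtain r where r: "r > 0" "\<And>i. \<exists>\<Phi> D\<Phi> \<theta> D\<theta>. flat_form r (?c i) (P i) \<Phi> D\<Phi> \<theta> D\<theta>"
  proof (rule finite_common_radius[where Q = "\<lambda>i r. \<exists>\<Phi> D\<Phi> \<theta> D\<theta>. flat_form r (?c i) (P i) \<Phi> D\<Phi> \<theta> D\<theta>", OF ex])
    show "\<exists>\<Phi> D\<Phi> \<theta> D\<theta>. flat_form t (?c i) (P i) \<Phi> D\<Phi> \<theta> D\<theta>"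
      if "\<exists>\<Phi> D\<Phi> \<theta> D\<theta>. flat_form r (?c i) (P i) \<Phi> D\<Phi> \<theta> D\<theta>" "t \<le> r" for i r t
      using that flat_form_shrink by meson
  qed (rule that)
  then have "\<forall>i. \<exists>\<Phi> D\<Phi> \<theta> D\<theta>. flat_form r (?c i) (P i) \<Phi> D\<Phi> \<theta> D\<theta>" by (intro allI)
  then obtain \<Phi> D\<Phi> \<theta> D\<theta> where "\<forall>i. flat_form r (?c i) (P i) (\<Phi> i) (D\<Phi> i) (\<theta> i) (D\<theta> i)"
    unfolding choice_iff by (elim exE)
  then have ff: "flat_form r (?c i) (P i) (\<Phi> i) (D\<Phi> i) (\<theta> i) (D\<theta> i)" for i by (rule spec)
  show ?thesis by (rule that[OF r(1) P(1) P(3) ff])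
qed

text \<open>
  The functions \<open>f i\<close> with \<open>i \<noteq> k\<close> are the linear combinations of flat functions that diagonalise the metric. The
  function \<open>f k\<close> is \<open>y = \<rho> h (\<alpha> \<psi>)\<^bsup>1/\<alpha>\<^esup>\<close> with \<open>\<alpha> = 1 - a\<close> and \<open>\<theta> k = h \<psi>\<close>: then \<open>y\<^sup>\<alpha>\<close> is a constant times the flat function \<open>h\<^sup>-\<^sup>a \<theta> k\<close>,
  so \<open>y\<^bsup>-a\<^esup> dy\<close> is a constant multiple of \<open>h\<^sup>-\<^sup>a \<Phi> k\<close>. The chart \<open>f\<close> is recorded with its differentials \<open>q\<close>.
\<close>

lemma adapted_chart:
  obtains R f q where "R > 0" "\<And>v j. norm v < R \<Longrightarrow> j \<in> I \<Longrightarrow> 1 + l j \<cdot> v \<noteq> 0"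
    "\<And>i. f i 0 = 0" "\<And>i v. norm v < R \<Longrightarrow> (f i has_derivative (\<lambda>u. q i v \<cdot> u)) (at v)"
    "\<And>i. continuous_on (ball 0 R) (q i)" "\<forall>u. (\<forall>i. q i 0 \<cdot> u = 0) \<longrightarrow> u = 0"
    "\<And>v. norm v < R \<Longrightarrow> f k v = 0 \<longleftrightarrow> h \<cdot> v = 0"
    "\<And>v u u'. norm v < R \<Longrightarrow> h \<cdot> v \<noteq> 0 \<Longrightarrow> gg v u u' =
       (\<Sum>i\<in>UNIV - {k}. (q i v \<cdot> u) * cnj (q i v \<cdot> u'))
       + of_real (cmod (f k v) powr (2 * ((1 - a) - 1))) * ((q k v \<cdot> u) * cnj (q k v \<cdot> u'))"
proof -
  obtain r P \<Phi> D\<Phi> \<theta> D\<theta> where r: "r > 0" and P: "P k = h" "\<And>u. (\<And>i. P i \<cdot> u = 0) \<Longrightarrow> u = 0"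
    and ff: "\<And>i. flat_form r (if i = k then of_real a else 0) (P i) (\<Phi> i) (D\<Phi> i) (\<theta> i) (D\<theta> i)"
    using flat_coframe_exists by blast
  let ?c = "\<lambda>i. if i = k then complex_of_real a else 0"
  have at0: "\<Phi> i 0 = P i" "\<theta> i 0 = 0" "D\<theta> i 0 u = (P i \<cdot> u) / (1 - ?c i)" for i u
    using ff[of i] unfolding flat_form_def by blast+
  have l0: "1 + l j \<cdot> v \<noteq> 0" if "norm v < r" "j \<in> I" for v j
    using ff[of k] that unfolding flat_form_def by blast
  have \<Phi>: "(\<Phi> i has_derivative D\<Phi> i v) (at v)" and \<theta>: "(\<theta> i has_derivative D\<theta> i v) (at v)"
    and lin: "D\<theta> i v (b *s u) = b * D\<theta> i v u" if "norm v < r" for i v b u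
    using ff[of i] that unfolding flat_form_def by blast+
  have D\<Phi>: "D\<Phi> i v u = (?c i * (h \<cdot> u / (h \<cdot> v))) *s \<Phi> i v - Om v u (\<Phi> i v)"
    and D\<theta>: "D\<theta> i v u = ?c i * (h \<cdot> u / (h \<cdot> v)) * \<theta> i v + \<Phi> i v \<cdot> u"
    if "norm v < r" "h \<cdot> v \<noteq> 0" for i v u
    using ff[of i] that unfolding flat_form_def by blast+
  have c\<Phi>: "continuous_on (ball 0 r) (\<Phi> i)" for i
    by (intro continuous_at_imp_continuous_on ballI has_derivative_continuous[OF \<Phi>]) simp

  \<comment> \<open>At \<open>0\<close> the forms are the independent rows \<open>P\<close>, so they are a coframe nearby.\<close>
  obtain r1 where r1: "r1 > 0" "\<And>v u. norm v < r1 \<Longrightarrow> (\<And>i. \<Phi> i v \<cdot> u = 0) \<Longrightarrow> u = 0"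
  proof (rule independent_near[of \<Phi>])
    show "isCont (\<Phi> i) 0" for i by (rule has_derivative_continuous[OF \<Phi>]) (simp add: r)
    show "u = 0" if "\<And>i. \<Phi> i 0 \<cdot> u = 0" for u using P(2) that by (simp add: at0)
  qed blast
  define s where "s = min r r1"
  have s: "s > 0" "s \<le> r" "s \<le> r1" using r r1 by (auto simp: s_def)
  have d: "dom v" if "norm v < s" "h \<cdot> v \<noteq> 0" for v
    using that l0[of v] s by (auto simp: dom_def)
  interpret M: parallel_metric_coframe h \<nu> s a k gg \<Omega> \<Phi> D\<Phi>
  proof (rule parallel_metric_coframe.intro)
    show "clinear_map (\<Omega> v X)" for v X
      unfolding \<Omega>_def
      by (rule clinear_mapI)
        (simp_all add: pairing_simps matrix_vector_right_distrib vector_scalar_commute vec_eq_iff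
          sum.distrib sum_distrib_left algebra_simps)
    fix v i X u assume v: "norm v < s" "h \<cdot> v \<noteq> 0"
    have vr: "norm v < r" using v s by simp
    show "(\<Phi> i has_derivative D\<Phi> i v) (at v)" by (rule \<Phi>[OF vr])
    show "D\<Phi> i v X \<cdot> u = (if i = k then of_real a * (h \<cdot> X / (h \<cdot> v)) * (\<Phi> k v \<cdot> u) else 0) - \<Phi> i v \<cdot> \<Omega> v X u"
      unfolding D\<Phi>[OF vr v(2)] by (simp add: pairing_simps Om_dual)
    show "u = 0" if "\<And>i. \<Phi> i v \<cdot> u = 0" using r1(2)[of v u] that v s by simp
  qed (use \<nu> s a herm gpos gder d in auto)
  obtain L \<kappa> where \<kappa>: "\<kappa> > 0" and gg: "\<And>v u u'. norm v < M.r' \<Longrightarrow> h \<cdot> v \<noteq> 0 \<Longrightarrow> gg v u u' =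
      (\<Sum>i\<in>UNIV - {k}. (\<Sum>j\<in>UNIV - {k}. L i $ j * (\<Phi> j v \<cdot> u)) * cnj (\<Sum>j\<in>UNIV - {k}. L i $ j * (\<Phi> j v \<cdot> u')))
      + of_real (\<kappa> * cmod (h \<cdot> v) powr (- 2 * a)) * ((\<Phi> k v \<cdot> u) * cnj (\<Phi> k v \<cdot> u'))"
    and Linj: "\<forall>p. p $ k = 0 \<longrightarrow> (\<forall>i. i \<noteq> k \<longrightarrow> (\<Sum>j\<in>UNIV - {k}. L i $ j * p $ j) = 0) \<longrightarrow> p = 0"
    by (rule M.metric_normal_form) (rule that)

  \<comment> \<open>The equation for the differential of \<open>\<theta> i\<close> is available off the hyperplane only, whereas the inverse
    function theorem needs a continuous differential near \<open>0\<close>.\<close>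
  have "\<exists>r2>0. \<exists>d. continuous_on (ball 0 r2) d \<and> (\<forall>v. norm v < r2 \<longrightarrow> (\<theta> i has_derivative (\<lambda>u. d v \<cdot> u)) (at v))"
    if i: "i \<noteq> k" for i
  proof -
    have 1: "(\<theta> i has_derivative (\<lambda>u. \<Phi> i v \<cdot> u)) (at v)" if "norm v < r" "h \<cdot> v \<noteq> 0" for v
    proof -
      have "D\<theta> i v = (\<lambda>u. \<Phi> i v \<cdot> u)" using D\<theta>[OF that, of i] i by auto
      then show ?thesis using \<theta>[OF that(1), of i] by simp
    qed
    obtain r2 d where "0 < r2" "r2 \<le> r" "continuous_on (ball 0 r2) d"
      "\<And>v. norm v < r2 \<Longrightarrow> (\<theta> i has_derivative (\<lambda>u. d v \<cdot> u)) (at v)"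
      by (rule C1_across_hyperplane[OF \<nu> r 1 continuous_on_subset[OF c\<Phi>] holomorphic_on_line[OF \<theta> lin]])
        (auto intro: that)
    then show ?thesis by blast
  qed
  then have ex: "\<exists>r2>0. \<exists>d. i \<noteq> k \<longrightarrow> continuous_on (ball 0 r2) d \<and> (\<forall>v. norm v < r2 \<longrightarrow> (\<theta> i has_derivative (\<lambda>u. d v \<cdot> u)) (at v))" for i
    using zero_less_one by (cases "i = k") blast+
  obtain r2 where r2: "r2 > 0" "\<And>i. \<exists>d. i \<noteq> k \<longrightarrow> continuous_on (ball 0 r2) d \<and> (\<forall>v. norm v < r2 \<longrightarrow> (\<theta> i has_derivative (\<lambda>u. d v \<cdot> u)) (at v))"
  proof (rule finite_common_radius[where Q = "\<lambda>i r2. \<exists>d. i \<noteq> k \<longrightarrow> continuous_on (ball 0 r2) d \<and> (\<forall>v. norm v < r2 \<longrightarrow> (\<theta> i has_derivative (\<lambda>u. d v \<cdot> u)) (at v))", OF ex])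
    fix i and t t' :: real assume tt: "0 < t'" "t' \<le> t"
      and "\<exists>d. i \<noteq> k \<longrightarrow> continuous_on (ball 0 t) d \<and> (\<forall>v. norm v < t \<longrightarrow> (\<theta> i has_derivative (\<lambda>u. d v \<cdot> u)) (at v))"
    then obtain d where "i \<noteq> k \<longrightarrow> continuous_on (ball 0 t) d \<and> (\<forall>v. norm v < t \<longrightarrow> (\<theta> i has_derivative (\<lambda>u. d v \<cdot> u)) (at v))"
      by blast
    then show "\<exists>d. i \<noteq> k \<longrightarrow> continuous_on (ball 0 t') d \<and> (\<forall>v. norm v < t' \<longrightarrow> (\<theta> i has_derivative (\<lambda>u. d v \<cdot> u)) (at v))"
      using tt continuous_on_subset[OF _ subset_ball[of t' t 0]] by (intro exI[of _ d]) auto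
  qed (rule that)
  then obtain d\<theta> where cd\<theta>: "\<And>i. i \<noteq> k \<Longrightarrow> continuous_on (ball 0 r2) (d\<theta> i)"
    and d\<theta>: "\<And>i v. i \<noteq> k \<Longrightarrow> norm v < r2 \<Longrightarrow> (\<theta> i has_derivative (\<lambda>u. d\<theta> i v \<cdot> u)) (at v)"
    by metis
  have d\<theta>_eq: "d\<theta> i v \<cdot> u = D\<theta> i v u" if "i \<noteq> k" "norm v < r2" "norm v < r" for i v u
    using has_derivative_unique[OF d\<theta>[OF that(1,2)] \<theta>[OF that(3)]] by metis

  \<comment> \<open>The quotient \<open>\<psi>\<close> is nonzero at \<open>0\<close>: its value there is the transverse derivative \<open>1 / (1 - a)\<close>.\<close>
  obtain r3 \<psi> d\<psi> where r3: "0 < r3" "r3 \<le> r" and cd\<psi>: "continuous_on (ball 0 r3) d\<psi>" and \<psi>0: "\<psi> 0 = D\<theta> k 0 \<nu>"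
    and d\<psi>: "\<And>v. norm v < r3 \<Longrightarrow> (\<psi> has_derivative (\<lambda>u. d\<psi> v \<cdot> u)) (at v)"
    and \<theta>\<psi>: "\<And>v. norm v < r \<Longrightarrow> h \<cdot> v \<noteq> 0 \<Longrightarrow> \<theta> k v = (h \<cdot> v) * \<psi> v"
  proof (rule divide_by_linear_form[OF \<nu> r _ c\<Phi> \<theta> lin])
    show "complex_of_real a \<noteq> 0" using a_nonzero by simp
    show "D\<theta> k v u = of_real a * (h \<cdot> u / (h \<cdot> v)) * \<theta> k v + \<Phi> k v \<cdot> u" if "norm v < r" "h \<cdot> v \<noteq> 0" for v u
      using D\<theta>[OF that, of k u] by simp
  qed (assumption | rule that)+
  define \<alpha> where "\<alpha> = 1 - a"
  have \<alpha>: "\<alpha> > 0" using a by (simp add: \<alpha>_def)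
  define \<psi>1 where "\<psi>1 v = of_real \<alpha> * \<psi> v" for v
  have \<psi>10: "\<psi>1 0 = 1"
  proof -
    have "\<psi> 0 = 1 / of_real \<alpha>" unfolding \<psi>0 at0(3) P(1) \<nu> by (simp add: \<alpha>_def)
    then show ?thesis using \<alpha> unfolding \<psi>1_def by simp
  qed
  have d\<psi>1: "(\<psi>1 has_derivative (\<lambda>u. of_real \<alpha> * (d\<psi> v \<cdot> u))) (at v)" if "norm v < r3" for v
    unfolding \<psi>1_def by (intro has_derivative_mult_right d\<psi> that)
  obtain r4 where r4: "r4 > 0" "\<And>v. norm v < r4 \<Longrightarrow> Re (\<psi>1 v) > 0"
  proof -
    have "isCont \<psi>1 0" by (rule has_derivative_continuous[OF d\<psi>1]) (simp add: r3)
    then obtain t where "t > 0" "\<And>v. dist v 0 < t \<Longrightarrow> dist (\<psi>1 v) (\<psi>1 0) < 1"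
      unfolding continuous_at_eps_delta by (metis dist_norm zero_less_one)
    then show ?thesis
    proof (intro that[of t])
      fix v assume t: "\<And>v. dist v 0 < t \<Longrightarrow> dist (\<psi>1 v) (\<psi>1 0) < 1" and v: "norm (v :: complex^'n) < t"
      have "cmod (\<psi>1 v - 1) < 1" using t[of v] v by (simp add: dist_norm \<psi>10)
      then show "Re (\<psi>1 v) > 0" using abs_Re_le_cmod[of "\<psi>1 v - 1"] by simp
    qed
  qed
  \<comment> \<open>The scale for which the cone metric of \<open>y\<close> has the coefficient \<open>\<kappa>\<close>: it enters as \<open>\<rho> powr (2 * \<alpha>)\<close>.\<close>
  define \<rho> where "\<rho> = \<kappa> powr (1 / (2 * \<alpha>))"
  have \<rho>: "\<rho> > 0" "\<rho> powr (2 * \<alpha>) = \<kappa>" using \<kappa> \<alpha> by (simp_all add: \<rho>_def powr_powr)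
  define E where "E v = exp (Ln (\<psi>1 v) / of_real \<alpha>)" for v
  define y where "y v = of_real \<rho> * ((h \<cdot> v) * E v)" for v
  define dy where "dy v = (of_real \<rho> * E v) *s (h + ((h \<cdot> v) / \<psi>1 v) *s d\<psi> v)" for v
  have \<psi>1nz: "\<psi>1 v \<noteq> 0" "\<psi>1 v \<notin> \<real>\<^sub>\<le>\<^sub>0" if "norm v < r4" for v
    using r4(2)[OF that] by (auto simp: complex_nonpos_Reals_iff)
  have dE: "(E has_derivative (\<lambda>u. E v * ((d\<psi> v \<cdot> u) / \<psi>1 v))) (at v)" if v: "norm v < r3" "norm v < r4" for v
  proof -
    have "((\<lambda>z. exp (Ln z / of_real \<alpha>)) has_field_derivative (exp (Ln (\<psi>1 v) / of_real \<alpha>) * (inverse (\<psi>1 v) / of_real \<alpha>))) (at (\<psi>1 v))"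
      using \<psi>1nz[OF v(2)] \<alpha> by (auto intro!: derivative_eq_intros)
    from has_derivative_compose[OF d\<psi>1[OF v(1)] this[unfolded has_field_derivative_def]]
    show ?thesis
      unfolding E_def using \<alpha> by (rule_tac has_derivative_eq_rhs) (auto simp: fun_eq_iff field_simps)
  qed
  have dyder: "(y has_derivative (\<lambda>u. dy v \<cdot> u)) (at v)" if v: "norm v < r3" "norm v < r4" for v
  proof -
    have "(y has_derivative (\<lambda>u. of_real \<rho> * ((h \<cdot> v) * (E v * ((d\<psi> v \<cdot> u) / \<psi>1 v)) + (h \<cdot> u) * E v))) (at v)"
      unfolding y_def
      by (intro has_derivative_mult_right has_derivative_mult dE v
          bounded_linear_imp_has_derivative[OF bounded_linear_pairing_right])
    then show ?thesis
      by (rule has_derivative_eq_rhs) (simp add: fun_eq_iff dy_def pairing_simps algebra_simps)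
  qed
  define R where "R = min (min s M.r') (min r2 (min r3 r4))"
  have R: "R > 0" "R \<le> s" "R \<le> M.r'" "R \<le> r2" "R \<le> r3" "R \<le> r4" "R \<le> r"
    using s M.r'(1) r2(1) r3(1) r4(1) by (auto simp: R_def)
  define f where "f i v = (if i = k then y v else \<Sum>j\<in>UNIV - {k}. L i $ j * \<theta> j v)" for i v
  define q where "q i v = (if i = k then dy v else \<Sum>j\<in>UNIV - {k}. (L i $ j) *s d\<theta> j v)" for i v
  have qk: "q k v = dy v" "f k v = y v" for v by (simp_all add: q_def f_def)
  have qi: "q i v \<cdot> u = (\<Sum>j\<in>UNIV - {k}. L i $ j * (d\<theta> j v \<cdot> u))" if "i \<noteq> k" for i v u
    using that by (simp add: q_def pairing_simps pairing_sum)
  have E0: "E v \<noteq> 0" for v by (simp add: E_def)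
  show ?thesis
  proof (rule that[OF R(1)])
    show "1 + l j \<cdot> v \<noteq> 0" if "norm v < R" "j \<in> I" for v j using l0[of v j] that R by simp
    show "f i 0 = 0" for i by (simp add: f_def y_def at0 pairing_simps)
    show "(f i has_derivative (\<lambda>u. q i v \<cdot> u)) (at v)" if v: "norm v < R" for i v
    proof (cases "i = k")
      case True
      have "f k = y" by (simp add: f_def fun_eq_iff)
      then show ?thesis using True dyder[of v] v R by (simp add: qk)
    next
      case False
      have "((\<lambda>v. \<Sum>j\<in>UNIV - {k}. L i $ j * \<theta> j v) has_derivative (\<lambda>u. \<Sum>j\<in>UNIV - {k}. L i $ j * (d\<theta> j v \<cdot> u))) (at v)"
        using v R by (intro has_derivative_sum has_derivative_mult_right d\<theta>) auto
      then show ?thesis using False by (simp add: qi) (simp add: f_def[abs_def])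
    qed
    show "continuous_on (ball 0 R) (q i)" for i
    proof (cases "i = k")
      case True
      have 1: "continuous_on (ball 0 R) d\<psi>" using cd\<psi> R by (rule_tac continuous_on_subset) auto
      have 2: "continuous_on (ball 0 R) \<psi>1"
        using R by (intro continuous_at_imp_continuous_on ballI has_derivative_continuous[OF d\<psi>1]) simp
      have 3: "continuous_on (ball 0 R) E"
        using R by (intro continuous_at_imp_continuous_on ballI has_derivative_continuous[OF dE]) simp_all
      have "continuous_on (ball 0 R) dy"
        unfolding dy_def using \<psi>1nz R by (intro continuous_intros 1 2 3) auto
      then show ?thesis using True by (simp add: q_def[abs_def])
    next
      case False
      have "continuous_on (ball 0 R) (d\<theta> j)" if "j \<noteq> k" for j
        using cd\<theta>[OF that] R by (rule_tac continuous_on_subset) auto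
      then show ?thesis using False by (auto simp: q_def[abs_def] intro!: continuous_intros)
    qed
    show "\<forall>u. (\<forall>i. q i 0 \<cdot> u = 0) \<longrightarrow> u = 0"
    proof (intro allI impI)
      fix u assume q0: "\<forall>i. q i 0 \<cdot> u = 0"
      have "E 0 = 1" by (simp add: E_def \<psi>10)
      then have "h \<cdot> u = 0" using q0[rule_format, of k] \<rho> by (simp add: qk dy_def pairing_simps)
      moreover have "P j \<cdot> u = 0" if "j \<noteq> k" for j
      proof -
        let ?p = "\<chi> j. if j = k then 0 else P j \<cdot> u"
        have "?p = 0"
        proof (rule Linj[rule_format])
          fix i assume i: "i \<noteq> k"
          have "(\<Sum>j\<in>UNIV - {k}. L i $ j * ?p $ j) = q i 0 \<cdot> u"
            unfolding qi[OF i] using r r2(1) by (intro sum.cong) (auto simp: d\<theta>_eq at0)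
          then show "(\<Sum>j\<in>UNIV - {k}. L i $ j * ?p $ j) = 0" using q0 by simp
        qed simp
        then have "?p $ j = 0" by simp
        then show ?thesis using that by simp
      qed
      ultimately show "u = 0" using P by metis
    qed
    show "f k v = 0 \<longleftrightarrow> h \<cdot> v = 0" if "norm v < R" for v
      using \<rho> E0 by (simp add: qk y_def)
    fix v u u' assume v: "norm v < R" and hv: "h \<cdot> v \<noteq> 0"
    have vs: "norm v < r" "norm v < M.r'" "norm v < r2" "norm v < r3" "norm v < r4" using v R by auto
    have flat_q: "q i v \<cdot> u = (\<Sum>j\<in>UNIV - {k}. L i $ j * (\<Phi> j v \<cdot> u))" if "i \<noteq> k" for i u
      unfolding qi[OF that] using vs hv by (intro sum.cong) (auto simp: d\<theta>_eq D\<theta>)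
    have \<Phi>k: "\<Phi> k v \<cdot> u = \<psi>1 v * (h \<cdot> u) + (h \<cdot> v) * (d\<psi> v \<cdot> u)" for u
    proof -
      have d1: "((\<lambda>v. (h \<cdot> v) * \<psi> v) has_derivative (\<lambda>u. (h \<cdot> v) * (d\<psi> v \<cdot> u) + (h \<cdot> u) * \<psi> v)) (at v)"
        by (intro has_derivative_mult d\<psi> vs bounded_linear_imp_has_derivative[OF bounded_linear_pairing_right])
      have d2: "((\<lambda>v. (h \<cdot> v) * \<psi> v) has_derivative D\<theta> k v) (at v)"
        by (rule has_derivative_transform_within_open[OF \<theta>[OF vs(1)] M.open_domain])
          (use v hv s R \<theta>\<psi> in auto)
      have "D\<theta> k v u = (h \<cdot> v) * (d\<psi> v \<cdot> u) + (h \<cdot> u) * \<psi> v"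
        by (rule fun_cong[OF has_derivative_unique[OF d2 d1]])
      moreover have "D\<theta> k v u = of_real a * (h \<cdot> u) * \<psi> v + \<Phi> k v \<cdot> u"
        unfolding D\<theta>[OF vs(1) hv] \<theta>\<psi>[OF vs(1) hv] using hv by simp
      ultimately have "\<Phi> k v \<cdot> u = (h \<cdot> v) * (d\<psi> v \<cdot> u) + (1 - of_real a) * (h \<cdot> u) * \<psi> v"
        by (simp add: algebra_simps)
      then show ?thesis by (simp add: \<psi>1_def \<alpha>_def algebra_simps)
    qed
    have qk_flat: "q k v \<cdot> u = (of_real \<rho> * E v / \<psi>1 v) * (\<Phi> k v \<cdot> u)" for u
      unfolding \<Phi>k using \<psi>1nz[OF vs(5)] by (simp add: qk dy_def pairing_simps field_simps)
    have factor: "cmod (y v) powr (2 * ((1 - a) - 1)) * (cmod (of_real \<rho> * E v / \<psi>1 v))\<^sup>2 = \<kappa> * cmod (h \<cdot> v) powr (- 2 * a)"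
    proof -
      define m where "m = cmod (h \<cdot> v)"
      define e where "e = cmod (E v)"
      define p where "p = cmod (\<psi>1 v)"
      have pos: "m > 0" "e > 0" "p > 0" using hv E0 \<psi>1nz[OF vs(5)] by (auto simp: m_def e_def p_def)
      have "e = exp (ln p / \<alpha>)"
        using \<psi>1nz[OF vs(5)] by (simp add: e_def E_def p_def)
      then have "e powr (2 * \<alpha>) = exp (2 * ln p)" using \<alpha> by (simp add: powr_def)
      then have ep: "e powr (2 * \<alpha>) = p\<^sup>2" using pos by (simp add: exp_double)
      have sq: "x powr (2 * (\<alpha> - 1)) = x powr (2 * \<alpha>) / x\<^sup>2" if "x > 0" for x :: real
        using that by (simp add: right_diff_distrib powr_diff)
      have "cmod (y v) = \<rho> * m * e" using \<rho> by (simp add: y_def norm_mult m_def e_def)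
      then have "cmod (y v) powr (2 * (\<alpha> - 1)) = (\<rho> powr (2 * \<alpha>) * m powr (2 * \<alpha>) * e powr (2 * \<alpha>)) / (\<rho> * m * e)\<^sup>2"
        using sq[of "\<rho> * m * e"] \<rho>(1) pos by (simp add: powr_mult)
      also have "\<dots> = \<kappa> * (m powr (2 * \<alpha>) / m\<^sup>2) * p\<^sup>2 / (\<rho> * e)\<^sup>2"
        unfolding \<rho>(2) ep by (simp add: power_mult_distrib mult_ac)
      also have "m powr (2 * \<alpha>) / m\<^sup>2 = m powr (- 2 * a)"
        using sq[OF pos(1)] by (simp add: \<alpha>_def)
      finally have "cmod (y v) powr (2 * (\<alpha> - 1)) = \<kappa> * m powr (- 2 * a) * p\<^sup>2 / (\<rho> * e)\<^sup>2" .
      moreover have "cmod (of_real \<rho> * E v / \<psi>1 v) = \<rho> * e / p"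
        using \<rho> by (simp add: norm_mult norm_divide e_def p_def)
      ultimately show ?thesis
        using pos \<rho>(1) by (simp add: \<alpha>_def m_def power_divide)
    qed
    have "of_real (cmod (f k v) powr (2 * ((1 - a) - 1))) * ((q k v \<cdot> u) * cnj (q k v \<cdot> u'))
      = of_real (\<kappa> * cmod (h \<cdot> v) powr (- 2 * a)) * ((\<Phi> k v \<cdot> u) * cnj (\<Phi> k v \<cdot> u'))"
    proof -
      let ?t = "of_real \<rho> * E v / \<psi>1 v"
      have "(q k v \<cdot> u) * cnj (q k v \<cdot> u') = (?t * cnj ?t) * ((\<Phi> k v \<cdot> u) * cnj (\<Phi> k v \<cdot> u'))"
        unfolding qk_flat by (simp only: complex_cnj_mult mult_ac)
      also have "?t * cnj ?t = of_real ((cmod ?t)\<^sup>2)" by (rule complex_norm_square[symmetric])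
      finally show ?thesis
        unfolding factor[symmetric] qk(2) by (simp only: of_real_mult mult_ac)
    qed
    then show "gg v u u' =
       (\<Sum>i\<in>UNIV - {k}. (q i v \<cdot> u) * cnj (q i v \<cdot> u'))
       + of_real (cmod (f k v) powr (2 * ((1 - a) - 1))) * ((q k v \<cdot> u) * cnj (q k v \<cdot> u'))"
      unfolding gg[OF vs(2) hv] by (simp add: flat_q)
  qed
qed

end

section \<open>Standard connections near a regular point of a hyperplane\<close>

lemma iter_deriv_const: "iter_deriv vs (\<lambda>_. c) = (\<lambda>_. if vs = [] then c else 0)"
  by (induction vs) simp_all

lemma smooth_on_const: "smooth_on U (\<lambda>_. c)"
  by (simp add: smooth_on_def iter_deriv_const)

definition connection_form where
  "connection_form \<H> h A z X Y = (\<Sum>H\<in>\<H>. (h H \<cdot> X / (h H \<cdot> z)) *s (A H *v Y))"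

lemma clinear_connection_form: "clinear_map (connection_form \<H> h A z X)"
  unfolding connection_form_def
  by (rule clinear_mapI)
    (simp_all add: matrix_vector_right_distrib vector_scalar_commute vec_eq_iff
      sum.distrib sum_distrib_left algebra_simps)

lemma standard_connection_const:
  "standard_connection \<H> h A (\<lambda>_. X) (\<lambda>_. Y) = (\<lambda>z. - connection_form \<H> h A z X Y)"
  by (simp add: fun_eq_iff standard_connection_def connection_form_def frechet_derivative_const)

locale flat_standard_connection =
  fixes \<H> :: "(complex^'n) set set" and h :: "(complex^'n) set \<Rightarrow> complex^'n"
    and A :: "(complex^'n) set \<Rightarrow> complex^'n^'n"
  assumes arr: "arrangement \<H> h"
    and flat: "flat_on (- \<Union>\<H>) (standard_connection \<H> h A)"
    and torsion: "torsion_free_on (- \<Union>\<H>) (standard_connection \<H> h A)"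
begin

abbreviation "\<Gamma> \<equiv> connection_form \<H> h A"

lemma fin: "finite \<H>" using arr by (simp add: arrangement_def)

lemma mem_hyperplane: "H \<in> \<H> \<Longrightarrow> z \<in> H \<longleftrightarrow> h H \<cdot> z = 0"
  using arr unfolding arrangement_def by blast

lemma complement: "z \<in> - \<Union>\<H> \<longleftrightarrow> (\<forall>H\<in>\<H>. h H \<cdot> z \<noteq> 0)"
  using mem_hyperplane by auto

lemma connection_form_symmetric:
  assumes "z \<in> - \<Union>\<H>" shows "\<Gamma> z X Y = \<Gamma> z Y X"
proof -
  have "torsion (standard_connection \<H> h A) (\<lambda>_. X) (\<lambda>_. Y) z = 0"
    using torsion assms smooth_on_const unfolding torsion_free_on_def by blast
  then show ?thesis
    by (simp add: torsion_def standard_connection_const lie_bracket_def frechet_derivative_const)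
qed

text \<open>
  The connection form is a sum of closed forms with constant coefficients, so its derivative is
  symmetric in the two directions and curvature reduces to the commutator.
\<close>

lemma connection_form_commute:
  assumes z: "z \<in> - \<Union>\<H>" shows "\<Gamma> z X (\<Gamma> z Y Z) = \<Gamma> z Y (\<Gamma> z X Z)"
proof -
  let ?D = "standard_connection \<H> h A"
  let ?Q = "\<lambda>X Y. \<Sum>H\<in>\<H>. ((h H \<cdot> X) * (h H \<cdot> Y) / (h H \<cdot> z)\<^sup>2) *s (A H *v Z)"
  note G = clinear_map_simps[OF clinear_connection_form]
  have der: "((\<lambda>y. - \<Gamma> y Y Z) has_derivative (\<lambda>X. ?Q X Y)) (at z)" for Y
  proof -
    have "((\<lambda>y. (h H \<cdot> Y / (h H \<cdot> y)) *s (A H *v Z)) has_derivative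
        (\<lambda>X. (h H \<cdot> Y / (h H \<cdot> z)) *s 0
          + (- (h H \<cdot> Y) * (inverse (h H \<cdot> z) * (h H \<cdot> X) * inverse (h H \<cdot> z)) + 0 / (h H \<cdot> z)) *s (A H *v Z))) (at z)"
      if "H \<in> \<H>" for H
      by (intro has_derivative_smult has_derivative_divide has_derivative_const
          bounded_linear_imp_has_derivative[OF bounded_linear_pairing_right])
        (use z complement that in blast)
    from has_derivative_minus[OF has_derivative_sum[where I = \<H>, OF this]]
    show ?thesis
      unfolding connection_form_def
      by (rule has_derivative_eq_rhs)
        (auto simp: fun_eq_iff vec_eq_iff sum_negf[symmetric] power2_eq_square divide_inverse mult_ac
          intro!: sum.cong)
  qed
  have D2: "?D (\<lambda>_. X) (?D (\<lambda>_. Y) (\<lambda>_. Z)) z = ?Q X Y + \<Gamma> z X (\<Gamma> z Y Z)" for X Y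
  proof -
    have "?D (\<lambda>_. X) (\<lambda>y. - \<Gamma> y Y Z) z = frechet_derivative (\<lambda>y. - \<Gamma> y Y Z) (at z) X - \<Gamma> z X (- \<Gamma> z Y Z)"
      by (simp add: standard_connection_def connection_form_def)
    then show ?thesis
      unfolding standard_connection_const frechet_derivative_at[OF der, symmetric] by (simp add: G)
  qed
  have "curvature ?D (\<lambda>_. X) (\<lambda>_. Y) (\<lambda>_. Z) z = 0"
    using flat z smooth_on_const unfolding flat_on_def by blast
  moreover have "lie_bracket (\<lambda>_. X) (\<lambda>_. Y) = (\<lambda>_. 0)"
    by (simp add: fun_eq_iff lie_bracket_def frechet_derivative_const)
  moreover have "?D (\<lambda>_. 0) (\<lambda>_. Z) z = 0"
    unfolding standard_connection_const by (simp add: connection_form_def pairing_simps)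
  ultimately have "?Q X Y + \<Gamma> z X (\<Gamma> z Y Z) - (?Q Y X + \<Gamma> z Y (\<Gamma> z X Z)) = 0"
    unfolding curvature_def D2 by simp
  moreover have "?Q Y X = ?Q X Y" by (simp add: mult.commute)
  ultimately show ?thesis by simp
qed

text \<open>
  Multiply the symmetry of the connection form by the equation of \<open>H\<close> and let the point tend to \<open>x\<close> along the
  transverse direction \<open>\<nu>\<close>: only the residue at \<open>H\<close> survives, and \<open>h(X) A\<^sub>H Y = h(Y) A\<^sub>H X\<close>.
\<close>

lemma residue_rank_one:
  assumes H: "H \<in> \<H>" and x: "x \<in> hyperplane_regular_part \<H> H" and \<nu>: "h H \<cdot> \<nu> = 1"
  shows "A H *v Y = (h H \<cdot> Y) *s (A H *v \<nu>)"
proof -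
  have hx: "h H \<cdot> x = 0" and h'x: "\<And>H'. H' \<in> \<H> - {H} \<Longrightarrow> h H' \<cdot> x \<noteq> 0"
    using x H mem_hyperplane unfolding hyperplane_regular_part_def by auto
  define p where "p s = x + complex_of_real s *s \<nu>" for s
  have p: "(p \<longlongrightarrow> x) (at_right 0)"
  proof -
    have "(p \<longlongrightarrow> x + complex_of_real 0 *s \<nu>) (at_right 0)" unfolding p_def by (intro tendsto_intros)
    then show ?thesis by simp
  qed
  have lim: "((\<lambda>s. h H' \<cdot> p s) \<longlongrightarrow> h H' \<cdot> x) (at_right 0)" for H' by (intro tendsto_intros p)
  have hp: "h H \<cdot> p s = of_real s" for s using hx \<nu> by (simp add: p_def pairing_simps)
  define N where "N X Y s = (\<Sum>H'\<in>\<H> - {H}. (h H' \<cdot> X / (h H' \<cdot> p s)) *s (A H' *v Y))" for X Y s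
  have limN: "((\<lambda>s. (h H \<cdot> X) *s (A H *v Y) + of_real s *s N X Y s) \<longlongrightarrow> (h H \<cdot> X) *s (A H *v Y)) (at_right 0)" for X Y
  proof -
    have "((\<lambda>s. (h H \<cdot> X) *s (A H *v Y) + of_real s *s N X Y s) \<longlongrightarrow>
       (h H \<cdot> X) *s (A H *v Y) + of_real 0 *s (\<Sum>H'\<in>\<H> - {H}. (h H' \<cdot> X / (h H' \<cdot> x)) *s (A H' *v Y))) (at_right 0)"
      unfolding N_def by (intro tendsto_intros lim h'x)
    then show ?thesis by simp
  qed
  have ev: "\<forall>\<^sub>F s in at_right 0. s > 0 \<and> (\<forall>H'\<in>\<H> - {H}. h H' \<cdot> p s \<noteq> 0)"
    using fin by (intro eventually_conj eventually_at_right_less eventually_ball_finite ballI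
        tendsto_imp_eventually_ne[OF lim] h'x) auto
  have "\<forall>\<^sub>F s in at_right 0. (h H \<cdot> \<nu>) *s (A H *v Y) + of_real s *s N \<nu> Y s
     = (h H \<cdot> Y) *s (A H *v \<nu>) + of_real s *s N Y \<nu> s"
  proof (rule eventually_mono[OF ev])
    fix s :: real assume s: "s > 0 \<and> (\<forall>H'\<in>\<H> - {H}. h H' \<cdot> p s \<noteq> 0)"
    have split: "of_real s *s \<Gamma> (p s) X Y = (h H \<cdot> X) *s (A H *v Y) + of_real s *s N X Y s" for X Y
      using s unfolding connection_form_def N_def sum.remove[OF fin H] hp
      by (simp add: vector_add_ldistrib)
    have "p s \<in> - \<Union>\<H>" unfolding complement using s hp[of s] by (cases "H \<in> \<H>") auto
    then show "(h H \<cdot> \<nu>) *s (A H *v Y) + of_real s *s N \<nu> Y s = (h H \<cdot> Y) *s (A H *v \<nu>) + of_real s *s N Y \<nu> s"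
      unfolding split[symmetric] by (simp only: connection_form_symmetric)
  qed
  from Lim_transform_eventually[OF limN this]
  have "((\<lambda>s. (h H \<cdot> Y) *s (A H *v \<nu>) + of_real s *s N Y \<nu> s) \<longlongrightarrow> (h H \<cdot> \<nu>) *s (A H *v Y)) (at_right 0)" .
  from tendsto_unique[OF _ this limN] show ?thesis using \<nu> by (simp add: trivial_limit_at_right_real)
qed

end

lemma trace_rank_one:
  fixes M :: "complex^'n^'n"
  assumes "\<And>Y. M *v Y = (b \<cdot> Y) *s n" shows "trace M = b \<cdot> n"
proof -
  have "M $ i $ i = b $ i * n $ i" for i
  proof -
    have "M $ i $ i = (M *v axis i 1) $ i"
      by (simp add: matrix_vector_mult_def axis_def if_distrib cong: if_cong)
    also have "\<dots> = b $ i * n $ i" unfolding assms by (simp add: pairing_axis)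
    finally show ?thesis .
  qed
  then show ?thesis by (simp add: trace_def scalar_product_def)
qed

lemma dim_hyperplane:
  fixes b :: "complex^'n"
  assumes "b \<cdot> \<nu> = 1" shows "CARD('n) - vec.dim {z. b \<cdot> z = 0} = 1"
proof -
  let ?H = "{z. b \<cdot> z = 0}"
  have sub: "vec.subspace ?H"
    by (rule vec.subspaceI) (auto simp: pairing_simps)
  have "\<nu> \<notin> vec.span ?H" using assms by (simp add: vec.span_eq_iff[THEN iffD2, OF sub])
  then have "vec.dim (insert \<nu> ?H) = vec.dim ?H + 1" by (simp add: vec.dim_insert)
  moreover have "z \<in> vec.span (insert \<nu> ?H)" for z
  proof -
    have "z = (b \<cdot> z) *s \<nu> + (z - (b \<cdot> z) *s \<nu>)" by simp
    moreover have "z - (b \<cdot> z) *s \<nu> \<in> ?H" using assms by (simp add: pairing_simps)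
    ultimately show ?thesis
      by (metis vec.span_add vec.span_base vec.span_scale insertI1 insertI2)
  qed
  then have "vec.span (insert \<nu> ?H) = UNIV" by blast
  then have "vec.dim (insert \<nu> ?H) = CARD('n)" by (metis vec.dim_span vec_dim_card)
  ultimately show ?thesis by simp
qed

context flat_standard_connection
begin

lemma localization_hyperplane:
  assumes "H \<in> \<H>" "x \<in> hyperplane_regular_part \<H> H" shows "localization \<H> H = {H}"
  using assms unfolding localization_def hyperplane_regular_part_def by blast

lemma form_nonzero: "H \<in> \<H> \<Longrightarrow> h H \<noteq> 0" and hyperplane_eq: "H \<in> \<H> \<Longrightarrow> H = {z. h H \<cdot> z = 0}"
  using arr unfolding arrangement_def by blast+

lemma transversal:
  assumes "H \<in> \<H>" obtains \<nu> where "h H \<cdot> \<nu> = 1"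
proof -
  obtain i where "h H $ i \<noteq> 0" using form_nonzero[OF assms] by (auto simp: vec_eq_iff)
  then have "h H \<cdot> ((1 / h H $ i) *s axis i 1) = 1" by (simp add: pairing_simps pairing_axis)
  then show ?thesis by (rule that)
qed

lemma hyperplane_irreducible:
  assumes H: "H \<in> \<H>" and x: "x \<in> hyperplane_regular_part \<H> H"
  shows "H \<in> irreducible_intersections \<H> h"
proof -
  have "H \<in> intersection_lattice \<H>"
    unfolding intersection_lattice_def using H by (intro CollectI exI[of _ "{H}"]) auto
  moreover have "H \<noteq> UNIV"
  proof
    assume U: "H = UNIV"
    obtain \<nu> where "h H \<cdot> \<nu> = 1" by (rule transversal[OF H])
    moreover have "\<nu> \<in> H" using U by simp
    ultimately show False using mem_hyperplane[OF H] by simp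
  qed
  moreover have "\<not> reducible_arr h {H}"
  proof
    assume "reducible_arr h {H}"
    then obtain B1 B2 where B: "B1 \<noteq> {}" "B2 \<noteq> {}" "{H} = B1 \<union> B2"
      and sum: "is_direct_sum (equation_span h {H}) (equation_span h B1) (equation_span h B2)"
      unfolding reducible_arr_def by blast
    have "B1 \<subseteq> {H}" "B2 \<subseteq> {H}" unfolding B(3) by simp_all
    then have "B1 = {H}" "B2 = {H}" using B(1,2) by (simp_all add: subset_singleton_iff)
    then have "equation_span h {H} = {0}" using sum unfolding is_direct_sum_def by simp
    moreover have "h H \<in> equation_span h {H}"
      unfolding equation_span_def by (rule vec.span_base) simp
    ultimately show False using form_nonzero[OF H] by simp
  qed
  ultimately show ?thesis
    unfolding irreducible_intersections_def using localization_hyperplane[OF H x] by simp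
qed

lemma weight_hyperplane:
  assumes H: "H \<in> \<H>" and x: "x \<in> hyperplane_regular_part \<H> H"
  shows "weight \<H> A H = trace (A H)"
proof -
  obtain \<nu> where "h H \<cdot> \<nu> = 1" by (rule transversal[OF H])
  then have "CARD('n) - vec.dim {z. h H \<cdot> z = 0} = 1" by (rule dim_hyperplane)
  then have "CARD('n) - vec.dim H = 1" using hyperplane_eq[OF H] by simp
  then show ?thesis unfolding weight_def localization_hyperplane[OF H x] by simp
qed

text \<open>
  Constant fields suffice: the derivatives of the metric coefficients determine everything else.
\<close>

lemma parallel_metric_derivative:
  assumes g: "hermitian_metric_on (- \<Union>\<H>) g"
    and par: "parallel_metric_on (- \<Union>\<H>) (standard_connection \<H> h A) g"
    and z: "z \<in> - \<Union>\<H>"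
  shows "((\<lambda>y. g y u u') has_derivative (\<lambda>X. - g z (\<Gamma> z X u) u' - g z u (\<Gamma> z X u'))) (at z)"
    and "hermitian_form (g z)" "u \<noteq> 0 \<Longrightarrow> 0 < Re (g z u u)"
proof -
  show herm: "hermitian_form (g z)" and "u \<noteq> 0 \<Longrightarrow> 0 < Re (g z u u)"
    using g z unfolding hermitian_metric_on_def hermitian_inner_product_def hermitian_form_def by blast+
  have "smooth_on (- \<Union>\<H>) (\<lambda>y. g y u u')" using g unfolding hermitian_metric_on_def by blast
  then have "iter_deriv [] (\<lambda>y. g y u u') differentiable (at z)" using z unfolding smooth_on_def by blast
  then have d: "((\<lambda>y. g y u u') has_derivative frechet_derivative (\<lambda>y. g y u u') (at z)) (at z)"
    by (simp add: frechet_derivative_works)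
  have "frechet_derivative (\<lambda>y. g y u u') (at z) X = - g z (\<Gamma> z X u) u' - g z u (\<Gamma> z X u')" for X
  proof -
    let ?D = "standard_connection \<H> h A"
    have "\<forall>X Y Z. smooth_on (- \<Union>\<H>) X \<longrightarrow> smooth_on (- \<Union>\<H>) Y \<longrightarrow> smooth_on (- \<Union>\<H>) Z \<longrightarrow>
        frechet_derivative (\<lambda>y. g y (Y y) (Z y)) (at z) (X z) = g z (?D X Y z) (Z z) + g z (Y z) (?D X Z z)"
      using par z unfolding parallel_metric_on_def by blast
    from this[rule_format, of "\<lambda>_. X" "\<lambda>_. u" "\<lambda>_. u'"]
    show ?thesis
      unfolding standard_connection_const by (simp add: smooth_on_const hermitian_form_simps[OF herm])
  qed
  then have "frechet_derivative (\<lambda>y. g y u u') (at z) = (\<lambda>X. - g z (\<Gamma> z X u) u' - g z u (\<Gamma> z X u'))"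
    by (rule ext)
  then show "((\<lambda>y. g y u u') has_derivative (\<lambda>X. - g z (\<Gamma> z X u) u' - g z u (\<Gamma> z X u'))) (at z)"
    using d by simp
qed

text \<open>
  Translating \<open>x\<close> to the origin turns the connection into a germ with one logarithmic pole; the chart \<open>F\<close>
  is the inverse function theorem applied to the functions of \<open>adapted_chart\<close>.
\<close>

lemma locally_isometric:
  fixes k :: 'n
  assumes g: "hermitian_metric_on (- \<Union>\<H>) g"
    and par: "parallel_metric_on (- \<Union>\<H>) (standard_connection \<H> h A) g"
    and H: "H \<in> \<H>" and x: "x \<in> hyperplane_regular_part \<H> H"
    and tr: "trace (A H) = of_real a" and a: "a \<notin> \<int>" "a < 1"
  shows "locally_isometric_to_cone_product \<H> g H x k (1 - a)"
proof -
  have hx: "h H \<cdot> x = 0" and h'x: "\<And>H'. H' \<in> \<H> - {H} \<Longrightarrow> h H' \<cdot> x \<noteq> 0"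
    using x H mem_hyperplane unfolding hyperplane_regular_part_def by auto
  obtain \<nu> where \<nu>: "h H \<cdot> \<nu> = 1" by (rule transversal[OF H])
  define n where "n = A H *v \<nu>"
  have rank1: "A H *v Y = (h H \<cdot> Y) *s n" for Y
    unfolding n_def by (rule residue_rank_one[OF H x \<nu>])
  define l where "l j = (1 / (h j \<cdot> x)) *s h j" for j
  have l: "h j \<cdot> (x + v) = (h j \<cdot> x) * (1 + l j \<cdot> v)" if "j \<in> \<H> - {H}" for j v
    using h'x[OF that] by (simp add: l_def pairing_simps distrib_left)
  define \<Omega> where "\<Omega> = (\<lambda>v X u. (h H \<cdot> X / (h H \<cdot> v)) *s ((h H \<cdot> u) *s n)
      + (\<Sum>j\<in>\<H> - {H}. (l j \<cdot> X / (1 + l j \<cdot> v)) *s (A j *v u)))"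
  define dom where "dom = (\<lambda>v. h H \<cdot> v \<noteq> 0 \<and> (\<forall>j\<in>\<H> - {H}. 1 + l j \<cdot> v \<noteq> 0))"
  have dom: "x + v \<in> - \<Union>\<H>" if "dom v" for v
    unfolding complement
  proof
    fix j assume "j \<in> \<H>"
    then show "h j \<cdot> (x + v) \<noteq> 0"
      using that l[of j v] h'x[of j] hx by (cases "j = H") (auto simp: dom_def pairing_simps)
  qed
  have \<Omega>: "\<Omega> v X u = \<Gamma> (x + v) X u" for v X u
  proof -
    have "l j \<cdot> X / (1 + l j \<cdot> v) = h j \<cdot> X / (h j \<cdot> (x + v))" if "j \<in> \<H> - {H}" for j
      unfolding l[OF that] using h'x[OF that] by (simp add: l_def pairing_simps)
    then show ?thesis
      unfolding \<Omega>_def connection_form_def sum.remove[OF fin H] rank1 by (simp add: pairing_simps hx)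
  qed
  interpret germ: log_flat_germ "\<H> - {H}" l A "h H" n \<nu> a k "\<lambda>v. g (x + v)" \<Omega> dom
  proof (rule log_flat_germ.intro)
    show "finite (\<H> - {H})" using fin by simp
    show "h H \<cdot> n = of_real a" using trace_rank_one[OF rank1] tr by simp
    fix v X Y u u' assume "dom v"
    note z = dom[OF this]
    show "\<Omega> v X (\<Omega> v Y u) = \<Omega> v Y (\<Omega> v X u)" unfolding \<Omega> by (rule connection_form_commute[OF z])
    show "\<Omega> v X Y = \<Omega> v Y X" unfolding \<Omega> by (rule connection_form_symmetric[OF z])
    show "hermitian_form (g (x + v))" by (rule parallel_metric_derivative(2)[OF g par z])
    show "0 < Re (g (x + v) u u)" if "u \<noteq> 0" by (rule parallel_metric_derivative(3)[OF g par z that])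
    have "((\<lambda>v. x + v) has_derivative (\<lambda>u. u)) (at v)" by (auto intro!: derivative_eq_intros)
    from has_derivative_compose[OF this parallel_metric_derivative(1)[OF g par z]]
    show "((\<lambda>v. g (x + v) u u') has_derivative (\<lambda>X. - g (x + v) (\<Omega> v X u) u' - g (x + v) u (\<Omega> v X u'))) (at v)"
      unfolding \<Omega> .
  qed (rule \<Omega>_def dom_def \<nu> a)+
  obtain R f q where R: "R > 0" and lR: "\<And>v j. norm v < R \<Longrightarrow> j \<in> \<H> - {H} \<Longrightarrow> 1 + l j \<cdot> v \<noteq> 0"
    and f0: "\<And>i. f i 0 = 0" and df: "\<And>i v. norm v < R \<Longrightarrow> (f i has_derivative (\<lambda>u. q i v \<cdot> u)) (at v)"
    and cq: "\<And>i. continuous_on (ball 0 R) (q i)" and q0: "\<forall>u. (\<forall>i. q i 0 \<cdot> u = 0) \<longrightarrow> u = 0"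
    and fk: "\<And>v. norm v < R \<Longrightarrow> f k v = 0 \<longleftrightarrow> h H \<cdot> v = 0"
    and met: "\<And>v u u'. norm v < R \<Longrightarrow> h H \<cdot> v \<noteq> 0 \<Longrightarrow> g (x + v) u u' =
       (\<Sum>i\<in>UNIV - {k}. (q i v \<cdot> u) * cnj (q i v \<cdot> u'))
       + of_real (cmod (f k v) powr (2 * ((1 - a) - 1))) * ((q k v \<cdot> u) * cnj (q k v \<cdot> u'))"
    by (rule germ.adapted_chart) (rule that)
  let ?F = "\<lambda>v. \<chi> i. f i v"
  obtain U V G where U: "open U" "U \<subseteq> ball 0 R" "0 \<in> U" and V: "open V"
    and hom: "homeomorphism U V ?F G"
    and dG: "\<And>y. y \<in> V \<Longrightarrow> \<exists>D. (G has_derivative D) (at y) \<and> clinear_map D"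
  proof (rule holomorphic_inverse_function[where R = R and f = f and q = q])
    show "u = 0" if "\<And>i. q i 0 \<cdot> u = 0" for u using that q0 by blast
  qed (assumption | rule R df cq that)+
  have vec: "((\<lambda>v. \<Sum>i\<in>UNIV. f i v *s axis i 1) has_derivative (\<lambda>u. \<Sum>i\<in>UNIV. f i v *s 0 + (q i v \<cdot> u) *s axis i 1)) (at v)"
    if "norm v < R" for v
    by (intro has_derivative_sum has_derivative_smult df that has_derivative_const)
  have ax: "(\<Sum>i\<in>UNIV. c i *s axis i 1) = (\<chi> i. c i)" for c :: "'n \<Rightarrow> complex"
    using basis_expansion[of "\<chi> i. c i"] by simp
  have dF: "(?F has_derivative (\<lambda>u. \<chi> i. q i v \<cdot> u)) (at v)" if "norm v < R" for v
    using vec[OF that] by (simp add: ax)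
  define F where "F z = ?F (z - x)" for z
  define U' where "U' = (\<lambda>z. z - x) -` U"
  have inU: "z \<in> U' \<longleftrightarrow> z - x \<in> U" for z by (simp add: U'_def)
  have nU: "norm (z - x) < R" if "z \<in> U'" for z using that U(2) inU by auto
  have dFz: "(F has_derivative (\<lambda>u. \<chi> i. q i (z - x) \<cdot> u)) (at z)" if "z \<in> U'" for z
  proof -
    have "((\<lambda>z. z - x) has_derivative (\<lambda>u. u)) (at z)" by (auto intro!: derivative_eq_intros)
    from has_derivative_compose[OF this dF[OF nU[OF that]]] show ?thesis by (simp add: F_def[abs_def])
  qed
  have bij: "bij_betw F U' V"
  proof (rule bij_betwI[where g = "\<lambda>y. x + G y"])
    show "F \<in> U' \<rightarrow> V" "(\<lambda>y. x + G y) \<in> V \<rightarrow> U'"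
      using hom unfolding homeomorphism_def by (auto simp: F_def inU)
    show "x + G (F z) = z" if "z \<in> U'" for z
      using hom that unfolding homeomorphism_def by (simp add: F_def inU)
    show "F (x + G y) = y" if "y \<in> V" for y
      using hom that unfolding homeomorphism_def by (simp add: F_def)
  qed
  have openU: "open U'" unfolding U'_def by (intro open_vimage U continuous_intros)
  have inv: "inv_into U' F y = x + G y" if "y \<in> V" for y
  proof (rule inv_into_f_eq[OF bij_betw_imp_inj_on[OF bij]])
    show "x + G y \<in> U'" "F (x + G y) = y"
      using hom that unfolding homeomorphism_def by (auto simp: F_def inU)
  qed
  have biholo: "biholomorphism U' V F"
    unfolding biholomorphism_def holomorphic_map_on_def
  proof (intro conjI ballI openU V bij)
    show "\<exists>F'. (F has_derivative F') (at z) \<and> clinear_map F'" if "z \<in> U'" for z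
      by (rule exI, rule conjI, rule dFz[OF that], rule clinear_map_rows)
    show "\<exists>F'. (inv_into U' F has_derivative F') (at y) \<and> clinear_map F'" if y: "y \<in> V" for y
    proof -
      obtain D where D: "(G has_derivative D) (at y)" "clinear_map D" using dG[OF y] by blast
      have "((\<lambda>y. x + G y) has_derivative D) (at y)" using D(1) by (auto intro!: derivative_eq_intros)
      then have "(inv_into U' F has_derivative D) (at y)"
        by (rule has_derivative_transform_within_open[OF _ V y]) (simp add: inv)
      then show ?thesis using D(2) by blast
    qed
  qed
  have H_iff: "z \<in> H \<longleftrightarrow> h H \<cdot> (z - x) = 0" for z
    using mem_hyperplane[OF H] hx by (simp add: pairing_simps)
  have F_H: "F z $ k = 0 \<longleftrightarrow> z \<in> H" if "z \<in> U'" for z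
    using fk[OF nU[OF that]] by (simp add: F_def H_iff)
  show ?thesis
    unfolding locally_isometric_to_cone_product_def
  proof (intro exI conjI ballI allI)
    show "biholomorphism U' V F" by (rule biholo)
    show "x \<in> U'" using U by (simp add: inU)
    show "F x = 0" by (simp add: F_def f0 vec_eq_iff)
    show "U' \<inter> \<Union>\<H> \<subseteq> H"
    proof
      fix z assume "z \<in> U' \<inter> \<Union>\<H>"
      then obtain j where z: "z \<in> U'" "j \<in> \<H>" "z \<in> j" by blast
      have "j = H"
      proof (rule ccontr)
        assume "j \<noteq> H"
        then have j: "j \<in> \<H> - {H}" using z by simp
        have "h j \<cdot> z \<noteq> 0" using l[OF j, of "z - x"] lR[OF nU[OF z(1)] j] h'x[OF j] by simp
        then show False using z mem_hyperplane by blast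
      qed
      then show "z \<in> H" using z by simp
    qed
    show "F ` (U' \<inter> H) = V \<inter> {y. y $ k = 0}"
      using bij F_H unfolding bij_betw_def by auto
    fix z u u' assume z: "z \<in> U' - H"
    then have zU: "z \<in> U'" and hz: "h H \<cdot> (z - x) \<noteq> 0" by (auto simp: H_iff)
    have "frechet_derivative F (at z) = (\<lambda>u. \<chi> i. q i (z - x) \<cdot> u)"
      by (rule frechet_derivative_at[OF dFz[OF zU], symmetric])
    then show "g z u u' = cone_product_metric k (1 - a) (F z) (frechet_derivative F (at z) u) (frechet_derivative F (at z) u')"
      using met[OF nU[OF zU] hz, of u u'] by (simp add: cone_product_metric_def F_def)
  qed
qed

end

theorem corollary1p3:
  fixes \<H> :: "(complex^'n) set set"
    and h :: "(complex^'n) set \<Rightarrow> complex^'n"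
    and A :: "(complex^'n) set \<Rightarrow> complex^'n^'n"
    and g :: "complex^'n \<Rightarrow> complex^'n \<Rightarrow> complex^'n \<Rightarrow> complex"
    and H :: "(complex^'n) set" and x :: "complex^'n" and k :: 'n
  assumes "arrangement \<H> h"
    and "flat_on (- \<Union>\<H>) (standard_connection \<H> h A)"
    and "torsion_free_on (- \<Union>\<H>) (standard_connection \<H> h A)"
    and "unitary_on (- \<Union>\<H>) (standard_connection \<H> h A)"
    and "kaehler_metric_on (- \<Union>\<H>) g"
    and "parallel_metric_on (- \<Union>\<H>) (standard_connection \<H> h A) g"
    and "\<And>L. L \<in> irreducible_intersections \<H> h \<Longrightarrow> weight \<H> A L \<notin> \<int> \<and> 1 - weight \<H> A L > 0"
    and "H \<in> \<H>"
    and "x \<in> hyperplane_regular_part \<H> H"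
  shows "\<exists>\<alpha>>0. complex_of_real \<alpha> = 1 - weight \<H> A H \<and>
                complex_of_real \<alpha> = 1 - trace (A H) \<and>
                locally_isometric_to_cone_product \<H> g H x k \<alpha>"
proof -
  interpret flat_standard_connection \<H> h A
    by (rule flat_standard_connection.intro) fact+
  have herm: "hermitian_metric_on (- \<Union>\<H>) g" using assms(5) unfolding kaehler_metric_on_def by blast
  define a where "a = Re (trace (A H))"
  have w: "weight \<H> A H = trace (A H)" by (rule weight_hyperplane[OF assms(8,9)])
  have wH: "trace (A H) \<notin> \<int>" "1 - trace (A H) > 0"
    using assms(7)[OF hyperplane_irreducible[OF assms(8,9)]] unfolding w by blast+
  then have tr: "trace (A H) = of_real a" and "a < 1"
    by (auto simp: a_def less_complex_def complex_eq_iff)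
  have "a \<notin> \<int>"
  proof
    assume "a \<in> \<int>"
    then have "complex_of_real a \<in> \<int>" by (auto elim: Ints_cases)
    then show False using wH(1) tr by simp
  qed
  show ?thesis
  proof (intro exI[of _ "1 - a"] conjI)
    show "1 - a > 0" using \<open>a < 1\<close> by simp
    show "complex_of_real (1 - a) = 1 - trace (A H)" "complex_of_real (1 - a) = 1 - weight \<H> A H"
      by (simp_all add: w tr)
    show "locally_isometric_to_cone_product \<H> g H x k (1 - a)"
      by (rule locally_isometric[OF herm assms(6,8,9) tr \<open>a \<notin> \<int>\<close> \<open>a < 1\<close>])
  qed
qed

end
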